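(* Let $d,k\in\mathbb{N}$ with $k\ge d+1$, let $(n_i)_{i\ge1}$ be a sequence of $d$-admissible numbers with $\lim_{i\to\infty}n_i=\infty$, and let $X_i$ be a $(d,k,n_i)$-random Steiner complex. Then the empirical spectral distribution $\mu_{\Delta^+_{d-1}(X_i)}$ converges weakly in probability to $\nu_{d,k}$, the Borel probability measure on $\mathbb{R}$ given by \[ \nu_{d,k}(B)=\int_{B\cap I_{d,k}}\frac{k\sqrt{4(k-1)d-(k-1+d-x)^2}}{2\pi x((d+1)k-x)}\,dx,\qquad I_{d,k}=\big[(\sqrt{k-1}-\sqrt d)^2,(\sqrt{k-1}+\sqrt d)^2\big]. \] Similarly, $\mu_{A_{X_i}}$ converges weakly in probability to the measure $\mu_{d,k}$ obtained from $\nu_{d,k}$ by the map $x\mapsto k-x$, i.e. \[ \mu_{d,k}(B)=\int_{B\cap J_{d,k}}\frac{k\sqrt{4(k-1)d-(x-1+d)^2}}{2\pi(k-x)(dk+x)}\,dx,\qquad J_{d,k}=\big[-d+1-2\sqrt{(k-1)d},\,-d+1+2\sqrt{(k-1)d}\big]. \]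
   Context: $d$-admissible numbers, $(n,d)$-Steiner systems and random Steiner complexes: an integer $n\ge d+1$ is $d$-admissible if $d-j$ divides $\binom{n-j-1}{d-j-1}$ for all $0\le j\le d-1$; an $(n,d)$-Steiner system is a family $S$ of $(d+1)$-subsets of $[n]$ with every $d$-subset of $[n]$ in exactly one member of $S$; a $(d,k,n)$-random Steiner complex is the complex on $[n]$ consisting of all subsets of $[n]$ of size $\le d$ together with $S_1\cup\dots\cup S_k$, with $S_j$ i.i.d. uniform $(n,d)$-Steiner systems. Operators: each $\ell$-face ($\ell\ge1$) has two orientations (vertex orderings up to even permutations), $\overline{\sigma}$ denotes the opposite orientation. $\Omega^{d-1}(X)$ is the real vector space of functions $f$ on oriented $(d-1)$-faces with $f(\overline\sigma)=-f(\sigma)$, with inner product $\langle f,g\rangle=\sum_{\sigma\in X^{d-1}}f(\sigma)g(\sigma)$. An oriented $d$-face $[v_0,\dots,v_d]$ induces on its boundary face omitting $v_i$ the orientation $(-1)^i[v_0,\dots,\hat v_i,\dots,v_d]$ (where $(-1)\tau:=\overline\tau$). Oriented $(d-1)$-faces $\sigma,\sigma'$ are neighbours, $\sigma\sim\sigma'$, if there is an oriented $d$-face $\tau$ having both $\sigma$ and $\overline{\sigma'}$ in its boundary as oriented faces. The adjacency operator is $A_Xf(\sigma)=\sum_{\sigma'\sim\sigma}f(\sigma')$ and the upper Laplacian is $\Delta^+_{d-1}(X)f(\sigma)=\deg(\sigma)f(\sigma)-\sum_{\sigma'\sim\sigma}f(\sigma')$, where $\deg(\sigma)$ is the number of $d$-faces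 containing $\sigma$. For a self-adjoint operator $M$ on an $r$-dimensional space with eigenvalues $\lambda_1,\dots,\lambda_r$, $\mu_M=\frac1r\sum_j\delta_{\lambda_j}$. Random probability measures $\mu_n$ converge weakly in probability to $\mu$ if $\lim_n\mathbb{P}(|\int f\,d\mu_n-\int f\,d\mu|>\varepsilon)=0$ for all $\varepsilon>0$ and all bounded continuous $f:\mathbb{R}\to\mathbb{R}$.
   Formalization: Neighbours σ ~ σ' are required to satisfy σ' ≠ σ̄ (so σ and σ̄' are two different boundary faces); read literally, every σ would be a neighbour of its own opposite, shifting A by −I and Δ⁺ by +I, and the stated limits would fail (mean of μ_A would be −1, not 0). *)

theory Defs
  imports
    "HOL-Probability.Probability"
    "HOL-Combinatorics.Permutations"
    "HOL-Library.Function_Algebras"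
begin

section \<open>Random Steiner complexes\<close>

definition d_admissible :: "nat \<Rightarrow> nat \<Rightarrow> bool" where
  "d_admissible d n \<longleftrightarrow> d + 1 \<le> n \<and>
     (\<forall>j\<in>{0..d - 1}. (d - j) dvd ((n - j - 1) choose (d - j - 1)))"

definition steiner_systems :: "nat \<Rightarrow> nat \<Rightarrow> nat set set set" where
  "steiner_systems n d = {S. (\<forall>s\<in>S. s \<subseteq> {1..n} \<and> card s = d + 1) \<and>
     (\<forall>t. t \<subseteq> {1..n} \<and> card t = d \<longrightarrow> (\<exists>!s. s \<in> S \<and> t \<subseteq> s))}"

text \<open>
  If there is no \<open>(n,d)\<close>-Steiner system, the predicate below is unsatisfiable, because a map
  from a probability space into the empty set does not exist. Admissibility alone is not meant
  to guarantee existence.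
\<close>

definition random_steiner_complex ::
  "'a measure \<Rightarrow> nat \<Rightarrow> nat \<Rightarrow> nat \<Rightarrow> ('a \<Rightarrow> nat set set) \<Rightarrow> bool" where
  "random_steiner_complex M d k n X \<longleftrightarrow> prob_space M \<and>
     (\<exists>S :: nat \<Rightarrow> 'a \<Rightarrow> nat set set.
        prob_space.indep_vars M (\<lambda>_. count_space (steiner_systems n d)) S {1..k} \<and>
        (\<forall>j\<in>{1..k}. distr M (count_space (steiner_systems n d)) (S j)
                      = uniform_count_measure (steiner_systems n d)) \<and>
        (\<forall>\<omega>\<in>space M. X \<omega> = {s. s \<subseteq> {1..n} \<and> card s \<le> d} \<union> (\<Union>j\<in>{1..k}. S j \<omega>)))"

section \<open>Oriented faces\<close>

text \<open>
  An oriented face is the class of a signed vertex ordering \<open>(s, vs)\<close>, \<open>s = 1\<close> or \<open>s = -1\<close>,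
  where permuting the ordering by \<open>p\<close> multiplies the sign by \<open>sign p\<close>. For faces with at least
  two vertices this is an ordering up to even permutations, and changing \<open>s\<close> gives the class of
  the odd permutations. The sign only matters for a single vertex \<open>v\<close>, whose orderings
  do not see it: there \<open>+[v]\<close> and \<open>-[v]\<close> are kept as formal opposites, so that
  the boundary convention also makes sense for graphs (\<open>d = 1\<close>). Antisymmetric functions on
  oriented vertices are the same as functions on vertices, and adjacency is graph adjacency.
\<close>

type_synonym oface = "(int \<times> nat list) set"

definition orient :: "int \<Rightarrow> nat list \<Rightarrow> oface" where
  "orient s vs = {(s * sign p, permute_list p vs) | p. p permutes {..<length vs}}"

definition opposite :: "oface \<Rightarrow> oface" where
  "opposite \<sigma> = (\<lambda>(s, vs). (- s, vs)) ` \<sigma>"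

definition vertices :: "oface \<Rightarrow> nat set" where
  "vertices \<sigma> = (\<Union>(s, vs)\<in>\<sigma>. set vs)"

definition oriented_faces :: "nat set set \<Rightarrow> nat \<Rightarrow> oface set" where
  "oriented_faces X l =
     {orient s vs | s vs. s \<in> {1, -1} \<and> distinct vs \<and> length vs = l + 1 \<and> set vs \<in> X}"

definition oriented_boundary :: "oface \<Rightarrow> oface set" where
  "oriented_boundary \<tau> =
     {orient (s * (-1) ^ i) (take i vs @ drop (Suc i) vs) | s vs i. (s, vs) \<in> \<tau> \<and> i < length vs}"

text \<open>
  The two boundary faces \<open>\<sigma>\<close> and \<open>opposite \<sigma>'\<close> of \<open>\<tau>\<close> are understood to be distinct:
  without this, every \<open>\<sigma>\<close> in some \<open>d\<close>-face would be a neighbour of its own opposite, and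
  \<open>\<Delta>\<^sup>+\<close> would not be the upper Laplacian.
\<close>

definition neighbours :: "nat set set \<Rightarrow> nat \<Rightarrow> oface \<Rightarrow> oface set" where
  "neighbours X d \<sigma> = {\<sigma>' \<in> oriented_faces X (d - 1).
     opposite \<sigma>' \<noteq> \<sigma> \<and>
     (\<exists>\<tau>\<in>oriented_faces X d. \<sigma> \<in> oriented_boundary \<tau> \<and> opposite \<sigma>' \<in> oriented_boundary \<tau>)}"

definition face_degree :: "nat set set \<Rightarrow> nat \<Rightarrow> oface \<Rightarrow> nat" where
  "face_degree X d \<sigma> = card {s \<in> X. card s = d + 1 \<and> vertices \<sigma> \<subseteq> s}"

section \<open>Adjacency operator and upper Laplacian\<close>

text \<open>Functions on oriented \<open>l\<close>-faces are total functions that vanish off these faces.\<close>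

definition cochains :: "nat set set \<Rightarrow> nat \<Rightarrow> (oface \<Rightarrow> real) set" where
  "cochains X l = {f. (\<forall>\<sigma>\<in>oriented_faces X l. f (opposite \<sigma>) = - f \<sigma>) \<and>
                      (\<forall>\<sigma>. \<sigma> \<notin> oriented_faces X l \<longrightarrow> f \<sigma> = 0)}"

definition adjacency_op :: "nat set set \<Rightarrow> nat \<Rightarrow> (oface \<Rightarrow> real) \<Rightarrow> oface \<Rightarrow> real" where
  "adjacency_op X d f \<sigma> =
     (if \<sigma> \<in> oriented_faces X (d - 1) then \<Sum>\<sigma>'\<in>neighbours X d \<sigma>. f \<sigma>' else 0)"

definition upper_laplacian :: "nat set set \<Rightarrow> nat \<Rightarrow> (oface \<Rightarrow> real) \<Rightarrow> oface \<Rightarrow> real" where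
  "upper_laplacian X d f \<sigma> =
     (if \<sigma> \<in> oriented_faces X (d - 1)
      then real (face_degree X d \<sigma>) * f \<sigma> - (\<Sum>\<sigma>'\<in>neighbours X d \<sigma>. f \<sigma>') else 0)"

section \<open>Empirical spectral distributions\<close>

interpretation fun_space: vector_space "\<lambda>(c::real) (f :: 'b \<Rightarrow> real) x. c * f x"
  by unfold_locales (auto simp: fun_eq_iff algebra_simps)

definition eigenspace :: "('b \<Rightarrow> real) set \<Rightarrow> (('b \<Rightarrow> real) \<Rightarrow> 'b \<Rightarrow> real) \<Rightarrow> real \<Rightarrow> ('b \<Rightarrow> real) set" where
  "eigenspace V T c = {f \<in> V. T f = (\<lambda>x. c * f x)}"

definition eigenvalues :: "('b \<Rightarrow> real) set \<Rightarrow> (('b \<Rightarrow> real) \<Rightarrow> 'b \<Rightarrow> real) \<Rightarrow> real set" where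
  "eigenvalues V T = {c. \<exists>f\<in>eigenspace V T c. f \<noteq> 0}"

text \<open>
  For a self-adjoint operator \<open>T\<close> on \<open>V\<close>: every eigenvalue is repeated according to its
  multiplicity, the dimension of its eigenspace.
\<close>

definition esd :: "('b \<Rightarrow> real) set \<Rightarrow> (('b \<Rightarrow> real) \<Rightarrow> 'b \<Rightarrow> real) \<Rightarrow> real measure" where
  "esd V T = distr
     (point_measure (eigenvalues V T)
        (\<lambda>c. ennreal (real (fun_space.dim (eigenspace V T c)) / real (fun_space.dim V))))
     borel (\<lambda>c. c)"

section \<open>Convergence and limit measures\<close>

text \<open>
  The first two conjuncts say that the \<open>\<mu> i\<close> are random Borel probability measures and that
  \<open>\<nu>\<close> is a Borel probability measure; in particular the events in the third are measurable.
\<close>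

definition weakly_in_probability ::
  "(nat \<Rightarrow> 'a measure) \<Rightarrow> (nat \<Rightarrow> 'a \<Rightarrow> real measure) \<Rightarrow> real measure \<Rightarrow> bool" where
  "weakly_in_probability M \<mu> \<nu> \<longleftrightarrow>
     (\<forall>i. \<mu> i \<in> measurable (M i) (prob_algebra borel)) \<and>
     prob_space \<nu> \<and> sets \<nu> = sets borel \<and>
     (\<forall>(f :: real \<Rightarrow> real) \<epsilon>. continuous_on UNIV f \<and> bounded (range f) \<and> 0 < \<epsilon> \<longrightarrow>
        (\<lambda>i. measure (M i) {\<omega> \<in> space (M i). \<bar>(\<integral>x. f x \<partial>\<mu> i \<omega>) - (\<integral>x. f x \<partial>\<nu>)\<bar> > \<epsilon>})
          \<longlonglongrightarrow> 0)"

definition I_int :: "nat \<Rightarrow> nat \<Rightarrow> real set" where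
  "I_int d k = {(sqrt (real k - 1) - sqrt (real d))\<^sup>2 .. (sqrt (real k - 1) + sqrt (real d))\<^sup>2}"

definition J_int :: "nat \<Rightarrow> nat \<Rightarrow> real set" where
  "J_int d k = {- real d + 1 - 2 * sqrt ((real k - 1) * real d) ..
                - real d + 1 + 2 * sqrt ((real k - 1) * real d)}"

definition nu :: "nat \<Rightarrow> nat \<Rightarrow> real measure" where
  "nu d k = density lborel (\<lambda>x. ennreal (indicator (I_int d k) x *
     (real k * sqrt (4 * (real k - 1) * real d - (real k - 1 + real d - x)\<^sup>2) /
       (2 * pi * x * ((real d + 1) * real k - x)))))"

definition mu :: "nat \<Rightarrow> nat \<Rightarrow> real measure" where
  "mu d k = density lborel (\<lambda>x. ennreal (indicator (J_int d k) x *
     (real k * sqrt (4 * (real k - 1) * real d - (x - 1 + real d)\<^sup>2) /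
       (2 * pi * (real k - x) * (real d * real k + x)))))"

end

theory Submission
  imports Defs "HOL-Real_Asymp.Real_Asymp"
begin

text \<open>
  Signing every \<open>d\<close>-set by its increasing order turns a Steiner system \<open>S\<^sub>j\<close> into a block matrix
  \<open>B\<^sub>j\<close> on \<open>d\<close>-sets with \<open>B\<^sub>j\<^sup>2 = (d - 1) B\<^sub>j + d\<close>. Away from the few \<open>d\<close>-sets
  that lie in a common cell of two of the systems, \<open>\<Delta>\<^sup>+ = k + B\<^sub>1 + \<dots> + B\<^sub>k\<close> and
  \<open>A = - (B\<^sub>1 + \<dots> + B\<^sub>k)\<close>. Words in the \<open>B\<^sub>j\<close> without repeated adjacent letters have
  asymptotically vanishing normalised trace: the trace is bounded by the number of closed walks, and
  since the law of each system is invariant under permutations of the vertices, a walk that changes the system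
  in every step meets a new vertex in every step up to probability \<open>O(1 / n)\<close>. The sum of all these words of
  length \<open>m\<close> is a polynomial \<open>p\<^sub>m\<close> in \<open>B\<^sub>1 + \<dots> + B\<^sub>k\<close>, and the substitution
  \<open>x = k - 1 + d - 2 sqrt (d (k - 1)) cos \<theta>\<close> shows that \<open>p\<^sub>m(x - k)\<close> has integral \<open>0\<close> under
  \<open>nu d k\<close> for \<open>m \<ge> 1\<close>. The \<open>p\<^sub>m\<close> span all polynomials, and all measures
  live on one compact interval, so this determines the limit.
\<close>

subsection \<open>Symmetric matrices\<close>

text \<open>Beyond the independence of the systems, the only probabilistic input about a uniform
  Steiner system is that its law is invariant under vertex permutations; nothing is used about the
  number of systems or their local statistics. The walk estimate is therefore a switching argument,
  a double count over tuples of systems. A first moment is enough: the signs are dropped at once,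
  the normalised number of closed walks is nonnegative, and its vanishing mean yields convergence in
  mean of the spectral integrals, without any variance. Since the tuple is uniform on a finite set,
  means are plain averages.

  The quadratic relation has a simple origin: on the facets of one cell a block is
  \<open>c c^T - 1\<close> with a sign vector \<open>c\<close> of length d + 1, so its eigenvalues
  are d and -1. The vanishing traces of the words express asymptotic freeness of the blocks.

  The delicate case is k = d + 1: the lower end of \<open>I_int d k\<close> is then 0, where a
  factor of the denominator of the density vanishes. The integrals are therefore computed for radii
  inside the unit disc first and extended to the boundary by dominated convergence.\<close>

definition fsupp :: "'b set \<Rightarrow> ('b \<Rightarrow> real) set" where
  "fsupp D = {g. \<forall>x. x \<notin> D \<longrightarrow> g x = 0}"

definition matop :: "'b set \<Rightarrow> ('b \<Rightarrow> 'b \<Rightarrow> real) \<Rightarrow> ('b \<Rightarrow> real) \<Rightarrow> 'b \<Rightarrow> real" where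
  "matop D M g = (\<lambda>x. if x \<in> D then \<Sum>y\<in>D. M x y * g y else 0)"

definition orthonormal_on :: "'b set \<Rightarrow> ('b \<Rightarrow> real) set \<Rightarrow> bool" where
  "orthonormal_on D B \<longleftrightarrow> B \<subseteq> fsupp D \<and>
     (\<forall>b\<in>B. \<forall>c\<in>B. (\<Sum>x\<in>D. b x * c x) = (if b = c then 1 else 0))"

text \<open>The last conjunct is the resolution of the identity, the form in which completeness
  enters expansions and traces.\<close>

definition eigen_system :: "'b set \<Rightarrow> ('b \<Rightarrow> 'b \<Rightarrow> real) \<Rightarrow> ('b \<Rightarrow> real) set \<Rightarrow> (('b \<Rightarrow> real) \<Rightarrow> real) \<Rightarrow> bool" where
  "eigen_system D M B evl \<longleftrightarrow> finite D \<and> finite B \<and> D \<noteq> {} \<and> (\<forall>x y. M x y = M y x) \<and>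
     card B = card D \<and> orthonormal_on D B \<and> (\<forall>b\<in>B. matop D M b = (\<lambda>x. evl b * b x)) \<and>
     (\<forall>x\<in>D. \<forall>y\<in>D. (\<Sum>b\<in>B. b x * b y) = (if x = y then 1 else 0))"

section \<open>Spectral theorem by maximising the Rayleigh quotient\<close>

lemma quadratic_nonpos_imp_linear_zero:
  fixes a b :: real
  assumes "\<And>t. 2 * t * a + t\<^sup>2 * b \<le> 0"
  shows "a = 0"
proof (rule ccontr)
  assume a: "a \<noteq> 0"
  \<comment> \<open>For t = a s the linear term 2 a^2 s dominates the quadratic one, because s times
    the modulus of b is below 1.\<close>
  define s where "s = 1 / (\<bar>b\<bar> + 1)"
  have s: "s > 0" "s * (\<bar>b\<bar> + 1) = 1" by (auto simp: s_def)
  have "s * (\<bar>b\<bar> + b) \<ge> 0" using s by (intro mult_nonneg_nonneg) auto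
  then have "2 + s * b > 0" using s by (simp add: distrib_left)
  then have "0 < a\<^sup>2 * s * (2 + s * b)" using s a by (intro mult_pos_pos) auto
  also have "\<dots> = 2 * (a * s) * a + (a * s)\<^sup>2 * b" by (simp add: power2_eq_square algebra_simps)
  also have "\<dots> \<le> 0" by (rule assms)
  finally show False by simp
qed

lemma sum_matop_sym:
  assumes sym: "\<And>x y. x \<in> D \<Longrightarrow> y \<in> D \<Longrightarrow> M x y = M y x"
  shows "(\<Sum>x\<in>D. matop D M f x * g x) = (\<Sum>x\<in>D. f x * matop D M g x)"
proof -
  have "(\<Sum>x\<in>D. matop D M f x * g x) = (\<Sum>x\<in>D. \<Sum>y\<in>D. M x y * f y * g x)"
    by (simp add: matop_def sum_distrib_right)
  also have "\<dots> = (\<Sum>y\<in>D. \<Sum>x\<in>D. M x y * f y * g x)" by (rule sum.swap)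
  also have "\<dots> = (\<Sum>y\<in>D. \<Sum>x\<in>D. f y * (M y x * g x))"
    by (intro sum.cong refl) (simp add: sym)
  also have "\<dots> = (\<Sum>x\<in>D. f x * matop D M g x)"
    by (simp add: matop_def sum_distrib_left)
  finally show ?thesis .
qed

lemma matop_lin: "matop D M (\<lambda>x. f x + t * g x) = (\<lambda>x. matop D M f x + t * matop D M g x)"
  by (simp add: matop_def fun_eq_iff sum.distrib sum_distrib_left distrib_left mult.left_commute)

lemma sum_mult_lin:
  fixes f g h k :: "'b \<Rightarrow> real"
  shows "(\<Sum>x\<in>D. (f x + t * g x) * (h x + s * k x)) = (\<Sum>x\<in>D. f x * h x)
    + s * (\<Sum>x\<in>D. f x * k x) + t * (\<Sum>x\<in>D. g x * h x) + t * s * (\<Sum>x\<in>D. g x * k x)"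
proof -
  have "(f x + t * g x) * (h x + s * k x) = f x * h x + s * (f x * k x) + t * (g x * h x) + t * s * (g x * k x)" for x
    by (simp add: algebra_simps)
  then show ?thesis by (simp add: sum.distrib sum_distrib_left)
qed

text \<open>A maximiser \<open>u\<close> of the quadratic form on the unit sphere of
  \<open>U\<close> is an eigenvector: stationarity makes \<open>M u - c u\<close> orthogonal to
  \<open>U\<close>, and invariance puts this vector into \<open>U\<close>. Staying inside the
  complement of \<open>B\<close> yields an eigenvector that can be added to
  \<open>B\<close>.\<close>

lemma ex_eigenvector_orthogonal:
  fixes D :: "'b set" and B :: "('b \<Rightarrow> real) set"
  assumes fin: "finite D" and sym: "\<And>x y. x \<in> D \<Longrightarrow> y \<in> D \<Longrightarrow> M x y = M y x"
  defines "U \<equiv> {g \<in> fsupp D. \<forall>b\<in>B. (\<Sum>x\<in>D. g x * b x) = 0}"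
  assumes inv: "\<And>g. g \<in> U \<Longrightarrow> matop D M g \<in> U" and g: "g \<in> U" "g \<noteq> (\<lambda>_. 0)"
  shows "\<exists>u\<in>U. (\<Sum>x\<in>D. u x * u x) = 1 \<and> (\<exists>c. matop D M u = (\<lambda>x. c * u x))"
proof -
  have sa: "(\<Sum>x\<in>D. matop D M f x * g x) = (\<Sum>x\<in>D. f x * matop D M g x)" for f g
    by (rule sum_matop_sym) (rule sym)
  \<comment> \<open>The unit sphere of \<open>U\<close>, cut out of a product of compact intervals
    with factor {0} off \<open>D\<close>. Functions carry the product topology, so compactness comes
    from Tychonoff's theorem.\<close>
  define K where "K = {a \<in> (\<Pi>\<^sub>E x\<in>UNIV. if x \<in> D then {-1..1} else {0::real}).
     (\<Sum>x\<in>D. a x * a x) = 1 \<and> (\<forall>b\<in>B. (\<Sum>x\<in>D. a x * b x) = 0)}"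
  have K: "K = {u \<in> U. (\<Sum>x\<in>D. u x * u x) = 1}"
  proof (intro equalityI subsetI)
    fix u assume "u \<in> K"
    then show "u \<in> {u \<in> U. (\<Sum>x\<in>D. u x * u x) = 1}"
      by (auto simp: K_def U_def fsupp_def PiE_iff split: if_splits)
  next
    fix u assume u: "u \<in> {u \<in> U. (\<Sum>x\<in>D. u x * u x) = 1}"
    have "\<bar>u x\<bar> \<le> 1" if "x \<in> D" for x
    proof -
      have "u x * u x \<le> (\<Sum>x\<in>D. u x * u x)"
        by (rule member_le_sum) (use that fin in auto)
      then have "(u x)\<^sup>2 \<le> 1" using u by (simp add: power2_eq_square)
      then show ?thesis by (simp add: abs_square_le_1)
    qed
    then show "u \<in> K" using u by (auto simp: K_def U_def fsupp_def abs_le_iff minus_le_iff)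
  qed
  have cl: "closed {a :: 'b \<Rightarrow> real. (\<Sum>x\<in>D. a x * a x) = 1 \<and> (\<forall>b\<in>B. (\<Sum>x\<in>D. a x * b x) = 0)}"
  proof -
    have "{a :: 'b \<Rightarrow> real. (\<Sum>x\<in>D. a x * a x) = 1 \<and> (\<forall>b\<in>B. (\<Sum>x\<in>D. a x * b x) = 0)}
      = {a. (\<Sum>x\<in>D. a x * a x) = 1} \<inter> (\<Inter>b\<in>B. {a. (\<Sum>x\<in>D. a x * b x) = 0})" by auto
    also have "closed \<dots>"
      by (intro closed_Int closed_INT ballI closed_Collect_eq continuous_intros continuous_on_product_coordinates)
    finally show ?thesis .
  qed
  have cpt: "compact (\<Pi>\<^sub>E x\<in>UNIV. if x \<in> D then {-1..1} else {0::real})"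
  proof -
    have "compactin (product_topology (\<lambda>_. euclidean) UNIV)
        (\<Pi>\<^sub>E x\<in>(UNIV :: 'b set). if x \<in> D then {-1..1} else {0::real})"
      unfolding compactin_PiE by (simp add: compactin_euclidean_iff)
    then show ?thesis by (simp add: euclidean_product_topology compactin_euclidean_iff)
  qed
  have Keq: "K = (\<Pi>\<^sub>E x\<in>UNIV. if x \<in> D then {-1..1} else {0::real}) \<inter>
    {a. (\<Sum>x\<in>D. a x * a x) = 1 \<and> (\<forall>b\<in>B. (\<Sum>x\<in>D. a x * b x) = 0)}"
    unfolding K_def Int_def mem_Collect_eq by (rule refl)
  have "compact K" unfolding Keq by (rule compact_Int_closed[OF cpt cl])
  define nn where "nn = sqrt (\<Sum>x\<in>D. g x * g x)"
  obtain x0 where x0: "x0 \<in> D" "g x0 \<noteq> 0" using g by (auto simp: U_def fsupp_def fun_eq_iff)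
  have pos: "(\<Sum>x\<in>D. g x * g x) > 0"
    by (rule sum_pos2[OF fin x0(1)]) (use x0 in \<open>auto simp: zero_less_mult_iff\<close>)
  have "nn > 0" "nn * nn = (\<Sum>x\<in>D. g x * g x)" using pos by (auto simp: nn_def)
  then have "(\<lambda>x. g x / nn) \<in> K" using g(1)
    by (auto simp: K U_def fsupp_def sum_divide_distrib[symmetric])
  then have "K \<noteq> {}" by auto
  have "continuous_on K (\<lambda>a. \<Sum>x\<in>D. (\<Sum>y\<in>D. M x y * a y) * a x)"
    by (intro continuous_intros continuous_on_product_coordinates continuous_on_subset[OF continuous_on_product_coordinates]) auto
  from continuous_attains_sup[OF \<open>compact K\<close> \<open>K \<noteq> {}\<close> this]
  obtain u where u: "u \<in> K" and max: "\<And>v. v \<in> K \<Longrightarrow>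
    (\<Sum>x\<in>D. matop D M v x * v x) \<le> (\<Sum>x\<in>D. matop D M u x * u x)"
    by (auto simp: matop_def)
  define c where "c = (\<Sum>x\<in>D. matop D M u x * u x)"
  have uU: "u \<in> U" and u1: "(\<Sum>x\<in>D. u x * u x) = 1" using u by (auto simp: K)
  \<comment> \<open>Homogeneity extends the maximum on the sphere to all of
    \<open>U\<close>.\<close>
  have le: "(\<Sum>x\<in>D. matop D M v x * v x) \<le> c * (\<Sum>x\<in>D. v x * v x)" if v: "v \<in> U" for v
  proof (cases "(\<Sum>x\<in>D. v x * v x) = 0")
    case True
    then have "\<forall>x\<in>D. v x = 0" using fin by (simp add: sum_nonneg_eq_0_iff)
    then show ?thesis by simp
  next
    case False
    define m where "m = sqrt (\<Sum>x\<in>D. v x * v x)"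
    have p: "(\<Sum>x\<in>D. v x * v x) > 0" using False sum_nonneg[of D "\<lambda>x. v x * v x"] by simp
    have m: "m > 0" "m * m = (\<Sum>x\<in>D. v x * v x)" using p by (auto simp: m_def)
    have "(\<lambda>x. v x / m) \<in> K" using v m
      by (auto simp: K U_def fsupp_def sum_divide_distrib[symmetric])
    from max[OF this] have "(\<Sum>x\<in>D. matop D M (\<lambda>x. v x / m) x * (v x / m)) \<le> c" by (simp add: c_def)
    moreover have "(\<Sum>x\<in>D. matop D M (\<lambda>x. v x / m) x * (v x / m)) = (\<Sum>x\<in>D. matop D M v x * v x) / (m * m)"
      by (simp add: matop_def sum_divide_distrib[symmetric] times_divide_eq_right)
    ultimately have "(\<Sum>x\<in>D. matop D M v x * v x) / (m * m) \<le> c" by simp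
    then show ?thesis using p unfolding m(2) by (simp only: pos_divide_le_eq)
  qed
  have orth: "(\<Sum>x\<in>D. (matop D M u x - c * u x) * v x) = 0" if v: "v \<in> U" for v
  proof -
    let ?a = "(\<Sum>x\<in>D. (matop D M u x - c * u x) * v x)"
    let ?b = "(\<Sum>x\<in>D. (matop D M v x - c * v x) * v x)"
    have vu: "(\<Sum>x\<in>D. v x * u x) = (\<Sum>x\<in>D. u x * v x)" by (simp only: mult.commute)
    \<comment> \<open>This is \<open>le\<close> at \<open>u + t v\<close>, expanded; the constant
      terms cancel because \<open>u\<close> attains \<open>c\<close>.\<close>
    have "2 * t * ?a + t\<^sup>2 * ?b \<le> 0" for t
    proof -
      have "(\<lambda>x. u x + t * v x) \<in> U" using uU v
        sum_mult_lin[where f = u and g = v and s = 0 and k = u and D = D]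
        by (auto simp: U_def fsupp_def)
      from le[OF this] have "(\<Sum>x\<in>D. (matop D M u x + t * matop D M v x) * (u x + t * v x))
         \<le> c * (\<Sum>x\<in>D. (u x + t * v x) * (u x + t * v x))" by (simp add: matop_lin)
      moreover have "(\<Sum>x\<in>D. (matop D M u x + t * matop D M v x) * (u x + t * v x))
        = c + t * (\<Sum>x\<in>D. matop D M u x * v x) + t * (\<Sum>x\<in>D. matop D M v x * u x) + t\<^sup>2 * (\<Sum>x\<in>D. matop D M v x * v x)"
        unfolding sum_mult_lin by (simp add: c_def power2_eq_square)
      moreover have "(\<Sum>x\<in>D. matop D M v x * u x) = (\<Sum>x\<in>D. matop D M u x * v x)"
        using sa[of v u] by (simp add: mult.commute)
      moreover have "(\<Sum>x\<in>D. (u x + t * v x) * (u x + t * v x)) = 1 + 2 * t * (\<Sum>x\<in>D. u x * v x) + t\<^sup>2 * (\<Sum>x\<in>D. v x * v x)"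
        unfolding sum_mult_lin u1 vu by (simp add: power2_eq_square)
      ultimately have "c + 2 * t * (\<Sum>x\<in>D. matop D M u x * v x) + t\<^sup>2 * (\<Sum>x\<in>D. matop D M v x * v x)
        \<le> c * (1 + 2 * t * (\<Sum>x\<in>D. u x * v x) + t\<^sup>2 * (\<Sum>x\<in>D. v x * v x))" by simp
      moreover
      have ea: "?a = (\<Sum>x\<in>D. matop D M u x * v x) - c * (\<Sum>x\<in>D. u x * v x)"
        by (simp add: left_diff_distrib sum_subtractf sum_distrib_left mult.assoc)
      have eb: "?b = (\<Sum>x\<in>D. matop D M v x * v x) - c * (\<Sum>x\<in>D. v x * v x)"
        by (simp add: left_diff_distrib sum_subtractf sum_distrib_left mult.assoc)
      ultimately show ?thesis unfolding ea eb by (simp only: distrib_left right_diff_distrib mult.assoc mult.left_commute[of c] mult_1_right)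
    qed
    then show ?thesis by (rule quadratic_nonpos_imp_linear_zero)
  qed
  \<comment> \<open>The residual lies in \<open>U\<close>, hence is orthogonal to itself.\<close>
  define w where "w = (\<lambda>x. matop D M u x - c * u x)"
  have "w \<in> U" using inv[OF uU] uU
    sum_mult_lin[where f = "matop D M u" and g = u and t = "- c" and s = 0 and k = u and D = D]
    by (auto simp: w_def U_def fsupp_def)
  from orth[OF this] have "(\<Sum>x\<in>D. w x * w x) = 0" by (simp add: w_def)
  then have "\<forall>x\<in>D. w x = 0" using fin by (simp add: sum_nonneg_eq_0_iff)
  then have "matop D M u = (\<lambda>x. c * u x)" using uU
    by (auto simp: w_def fun_eq_iff U_def fsupp_def matop_def)
  then show ?thesis using uU u1 by blast
qed

text \<open>Expands the squared length of the indicator of \<open>x\<close> minus its projection to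
  the span of \<open>B\<close>. Summed over \<open>x\<close>, this bounds the size of an orthonormal
  family.\<close>

lemma orthonormal_on_bessel:
  assumes fin: "finite D" "finite B" and B: "orthonormal_on D B" and x: "x \<in> D"
  shows "(\<Sum>b\<in>B. (b x)\<^sup>2) \<le> 1"
proof -
  have ip: "(\<Sum>y\<in>D. b y * c y) = (if b = c then 1 else 0)" if "b \<in> B" "c \<in> B" for b c
    using B that by (auto simp: orthonormal_on_def)
  let ?s = "\<lambda>y. \<Sum>b\<in>B. b x * b y"
  have "0 \<le> (\<Sum>y\<in>D. ((if y = x then 1 else 0) - ?s y)\<^sup>2)" by (intro sum_nonneg) auto
  also have "\<dots> = (\<Sum>y\<in>D. (if y = x then 1 - 2 * ?s x else 0) + ?s y * ?s y)"
    by (intro sum.cong refl) (auto simp: power2_eq_square algebra_simps)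
  also have "\<dots> = 1 - 2 * ?s x + (\<Sum>y\<in>D. ?s y * ?s y)"
    using fin x by (simp add: sum.distrib)
  also have "(\<Sum>y\<in>D. ?s y * ?s y) = (\<Sum>y\<in>D. \<Sum>b\<in>B. \<Sum>c\<in>B. b x * c x * (b y * c y))"
    unfolding sum_product by (intro sum.cong refl) (simp add: ac_simps)
  also have "\<dots> = (\<Sum>b\<in>B. \<Sum>c\<in>B. \<Sum>y\<in>D. b x * c x * (b y * c y))"
    by (subst sum.swap, intro sum.cong refl, rule sum.swap)
  also have "\<dots> = (\<Sum>b\<in>B. \<Sum>c\<in>B. if b = c then b x * c x else 0)"
    by (intro sum.cong refl) (simp add: sum_distrib_left[symmetric] ip)
  also have "\<dots> = ?s x" using fin by (simp add: sum.delta)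
  finally show ?thesis by (simp add: power2_eq_square)
qed

text \<open>An orthonormal family of eigenvectors of maximal cardinality is complete: otherwise its
  orthogonal complement is a nonzero invariant subspace and contains another eigenvector.\<close>

lemma ex_eigen_system:
  fixes D :: "'b set" and M :: "'b \<Rightarrow> 'b \<Rightarrow> real"
  assumes fin: "finite D" and ne: "D \<noteq> {}" and sym: "\<And>x y. M x y = M y x"
  shows "\<exists>B evl. eigen_system D M B evl"
proof -
  define P where "P B \<longleftrightarrow> finite B \<and> orthonormal_on D B \<and>
    (\<forall>b\<in>B. \<exists>c. matop D M b = (\<lambda>x. c * b x))" for B
  have norm: "(\<Sum>b\<in>B. \<Sum>x\<in>D. (b x)\<^sup>2) = card B" if "orthonormal_on D B" for B
    using that by (simp add: orthonormal_on_def power2_eq_square)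
  have bound: "card B \<le> card D" if "P B" for B
  proof -
    have "real (card B) = (\<Sum>x\<in>D. \<Sum>b\<in>B. (b x)\<^sup>2)"
      using that norm[of B] by (simp add: P_def sum.swap[of _ D])
    also have "\<dots> \<le> (\<Sum>x\<in>D. 1)"
      using that fin by (intro sum_mono orthonormal_on_bessel) (auto simp: P_def)
    finally show ?thesis by simp
  qed
  have "P {}" by (simp add: P_def orthonormal_on_def)
  then obtain B where B: "P B" and max: "\<And>C. P C \<Longrightarrow> card C \<le> card B"
    using ex_has_greatest_nat[of P "{}" card "card D + 1"] bound by (metis less_Suc_eq_le Suc_eq_plus1)
  obtain evl where evl: "\<And>b. b \<in> B \<Longrightarrow> matop D M b = (\<lambda>x. evl b * b x)"
    using B unfolding P_def by metis
  have finB: "finite B" and on: "orthonormal_on D B" using B by (auto simp: P_def)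
  have ip: "(\<Sum>y\<in>D. b y * c y) = (if b = c then 1 else 0)" if "b \<in> B" "c \<in> B" for b c
    using on that by (auto simp: orthonormal_on_def)
  let ?U = "{g \<in> fsupp D. \<forall>b\<in>B. (\<Sum>x\<in>D. g x * b x) = 0}"
  have sa: "(\<Sum>x\<in>D. matop D M f x * g x) = (\<Sum>x\<in>D. f x * matop D M g x)" for f g
    by (rule sum_matop_sym) (rule sym)
  have inv: "matop D M g \<in> ?U" if "g \<in> ?U" for g
  proof -
    have "(\<Sum>x\<in>D. matop D M g x * b x) = 0" if b: "b \<in> B" for b
    proof -
      have "(\<Sum>x\<in>D. matop D M g x * b x) = (\<Sum>x\<in>D. evl b * (g x * b x))"
        unfolding sa evl[OF b] by (simp add: mult.left_commute)
      also have "\<dots> = evl b * (\<Sum>x\<in>D. g x * b x)" by (simp add: sum_distrib_left)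
      also have "\<dots> = 0" using b \<open>g \<in> ?U\<close> by simp
      finally show ?thesis .
    qed
    then show ?thesis by (simp add: fsupp_def matop_def)
  qed
  have U0: "g = (\<lambda>_. 0)" if "g \<in> ?U" for g
  proof (rule ccontr)
    assume "g \<noteq> (\<lambda>_. 0)"
    from ex_eigenvector_orthogonal[of D M B, OF fin sym inv that this]
    obtain u c where u: "u \<in> ?U" "(\<Sum>x\<in>D. u x * u x) = 1" "matop D M u = (\<lambda>x. c * u x)" by blast
    have "u \<notin> B" using u by auto
    moreover have "(\<Sum>x\<in>D. b x * u x) = 0" "(\<Sum>x\<in>D. u x * b x) = 0" if "b \<in> B" for b
      using u(1) that by (simp_all only: mem_Collect_eq mult.commute)
    then have "P (insert u B)" using u B \<open>u \<notin> B\<close> by (auto simp: P_def orthonormal_on_def)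
    ultimately show False using max[of "insert u B"] finB by simp
  qed
  have complete: "(\<Sum>b\<in>B. b x * b y) = (if x = y then 1 else 0)" if "x \<in> D" "y \<in> D" for x y
  proof -
    \<comment> \<open>The part of the indicator of \<open>x\<close> that is left after projection;
      it is orthogonal to \<open>B\<close>, so \<open>U0\<close> kills it.\<close>
    define r where "r = (\<lambda>y. (if x = y then 1 else 0) - (\<Sum>b\<in>B. b x * b y))"
    have "(\<Sum>y\<in>D. r y * c y) = 0" if c: "c \<in> B" for c
    proof -
      have "(\<Sum>y\<in>D. r y * c y) = (\<Sum>y\<in>D. (if x = y then c y else 0)) - (\<Sum>y\<in>D. \<Sum>b\<in>B. b x * (b y * c y))"
        unfolding sum_subtractf[symmetric]
        by (intro sum.cong refl) (auto simp: r_def left_diff_distrib sum_distrib_right mult.assoc)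
      also have "(\<Sum>y\<in>D. \<Sum>b\<in>B. b x * (b y * c y)) = (\<Sum>b\<in>B. b x * (\<Sum>y\<in>D. b y * c y))"
        by (subst sum.swap) (simp add: sum_distrib_left)
      also have "\<dots> = c x" using c finB by (simp add: ip if_distrib sum.delta cong: sum.cong if_cong)
      finally show ?thesis using fin \<open>x \<in> D\<close> by (simp add: sum.delta)
    qed
    moreover have "r \<in> fsupp D" using on \<open>x \<in> D\<close>
      by (auto simp: r_def fsupp_def orthonormal_on_def subset_iff intro!: sum.neutral)
    ultimately have "r = (\<lambda>_. 0)" by (intro U0) auto
    then show ?thesis by (auto simp: r_def fun_eq_iff dest: spec[of _ y])
  qed
  have "real (card B) = (\<Sum>x\<in>D. \<Sum>b\<in>B. (b x)\<^sup>2)"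
    using norm[OF on] by (simp add: sum.swap[of _ D])
  also have "\<dots> = card D" using complete by (simp add: power2_eq_square)
  finally have "card B = card D" by simp
  then show ?thesis unfolding eigen_system_def
    by (intro exI[of _ B] exI[of _ evl] conjI ballI allI fin ne sym finB on evl complete)
qed

section \<open>Spectral distribution read off from an orthonormal eigenbasis\<close>

lemma sum_fun_apply: "(\<Sum>a\<in>A. F a) y = (\<Sum>a\<in>A. (F a y :: real))"
  by (induction A rule: infinite_finite_induct) auto

lemma orthonormal_on_independent:
  assumes "finite B" "orthonormal_on D B"
  shows "fun_space.independent B"
proof (rule fun_space.independent_if_scalars_zero)
  show "finite B" by fact
  fix f c assume 0: "(\<Sum>b\<in>B. (\<lambda>x. f b * b x)) = 0" and c: "c \<in> B"
  have "(\<Sum>b\<in>B. f b * b x) = 0" for x using fun_cong[OF 0, of x] by (simp add: sum_fun_apply)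
  then have "0 = (\<Sum>x\<in>D. (\<Sum>b\<in>B. f b * b x) * c x)" by simp
  also have "\<dots> = (\<Sum>b\<in>B. f b * (\<Sum>x\<in>D. b x * c x))"
    by (simp add: sum_distrib_left sum_distrib_right mult.assoc sum.swap[of _ B D])
  also have "\<dots> = (\<Sum>b\<in>B. if b = c then f b else 0)"
    using assms c by (intro sum.cong refl) (auto simp: orthonormal_on_def)
  also have "\<dots> = f c" using c assms by simp
  finally show "f c = 0" by simp
qed

context
  fixes D :: "'b set" and M B evl
  assumes es: "eigen_system D M B evl"
begin

private lemma fin: "finite D" "finite B" and ne: "D \<noteq> {}" and card_B: "card B = card D"
  and on: "orthonormal_on D B" and evl: "b \<in> B \<Longrightarrow> matop D M b = (\<lambda>x. evl b * b x)"
  and complete: "x \<in> D \<Longrightarrow> y \<in> D \<Longrightarrow> (\<Sum>b\<in>B. b x * b y) = (if x = y then 1 else 0)"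
  using es unfolding eigen_system_def by blast+

private lemma matop_sa: "(\<Sum>x\<in>D. matop D M f x * g x) = (\<Sum>x\<in>D. f x * matop D M g x)"
  by (rule sum_matop_sym) (use es in \<open>unfold eigen_system_def, blast\<close>)

lemma eigen_system_eigen: "b \<in> B \<Longrightarrow> x \<in> D \<Longrightarrow> (\<Sum>y\<in>D. M x y * b y) = evl b * b x"
  using fun_cong[OF evl, of b x] by (simp add: matop_def)

lemma eigenbasis_expand:
  assumes f: "f \<in> fsupp D"
  shows "f = (\<Sum>b\<in>B. (\<lambda>x. (\<Sum>y\<in>D. f y * b y) * b x))"
proof
  fix x
  show "f x = (\<Sum>b\<in>B. (\<lambda>x. (\<Sum>y\<in>D. f y * b y) * b x)) x"
  proof (cases "x \<in> D")
    case True
    have "(\<Sum>b\<in>B. (\<Sum>y\<in>D. f y * b y) * b x) = (\<Sum>y\<in>D. f y * (\<Sum>b\<in>B. b y * b x))"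
      by (simp add: sum_distrib_left sum_distrib_right mult.assoc sum.swap[of _ B D])
    also have "\<dots> = (\<Sum>y\<in>D. if y = x then f y else 0)"
      using True by (intro sum.cong refl) (simp add: complete)
    also have "\<dots> = f x" using True fin by simp
    finally show ?thesis by (simp add: sum_fun_apply)
  next
    case False
    then have "b x = 0" if "b \<in> B" for b using on that by (auto simp: fsupp_def orthonormal_on_def)
    then have "(\<Sum>b\<in>B. (\<Sum>y\<in>D. f y * b y) * b x) = 0" by (intro sum.neutral) simp
    then show ?thesis using f False by (simp add: sum_fun_apply fsupp_def)
  qed
qed

lemma eigenbasis_combination: "(\<Sum>b\<in>C. (\<lambda>x. u b * b x)) \<in> fun_space.span C"
  by (intro fun_space.span_sum fun_space.span_scale fun_space.span_base)

lemma dim_fsupp: "fun_space.dim (fsupp D) = card D"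
proof -
  have "fun_space.span B = fun_space.span (fsupp D)"
  proof (intro equalityI fun_space.span_minimal fun_space.subspace_span)
    show "B \<subseteq> fun_space.span (fsupp D)"
      using on fun_space.span_base by (auto simp: orthonormal_on_def)
    show "fsupp D \<subseteq> fun_space.span B"
    proof
      fix f assume "f \<in> fsupp D"
      then have "f = (\<Sum>b\<in>B. (\<lambda>x. (\<Sum>y\<in>D. f y * b y) * b x))" by (rule eigenbasis_expand)
      also have "\<dots> \<in> fun_space.span B" by (rule eigenbasis_combination)
      finally show "f \<in> fun_space.span B" .
    qed
  qed
  then show ?thesis
    using fun_space.dim_eq_card[OF _ orthonormal_on_independent[OF fin(2) on]] card_B by simp
qed

text \<open>Self-adjointness makes an eigenvector for \<open>c\<close> orthogonal to every basis
  vector with another eigenvalue, so only the basis vectors belonging to \<open>c\<close> occur in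
  its expansion.\<close>

lemma dim_eigenspace: "fun_space.dim (eigenspace (fsupp D) (matop D M) c) = card {b \<in> B. evl b = c}"
proof -
  let ?C = "{b \<in> B. evl b = c}" and ?E = "eigenspace (fsupp D) (matop D M) c"
  have "fun_space.span ?C = fun_space.span ?E"
  proof (intro equalityI fun_space.span_minimal fun_space.subspace_span)
    have "?C \<subseteq> ?E" using on evl by (auto simp: orthonormal_on_def eigenspace_def)
    then show "?C \<subseteq> fun_space.span ?E" using fun_space.span_superset by blast
    show "?E \<subseteq> fun_space.span ?C"
    proof
      fix f assume f: "f \<in> ?E"
      have z: "(\<Sum>y\<in>D. f y * b y) = 0" if "b \<in> B - ?C" for b
      proof -
        have "c * (\<Sum>y\<in>D. f y * b y) = evl b * (\<Sum>y\<in>D. f y * b y)"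
          using matop_sa[of f b] f that
          by (simp add: eigenspace_def evl sum_distrib_left ac_simps)
        then show ?thesis using that by auto
      qed
      have "f = (\<Sum>b\<in>B. (\<lambda>x. (\<Sum>y\<in>D. f y * b y) * b x))"
        using f by (intro eigenbasis_expand) (simp add: eigenspace_def)
      also have "\<dots> = (\<Sum>b\<in>?C. (\<lambda>x. (\<Sum>y\<in>D. f y * b y) * b x))"
        using fin z by (intro sum.mono_neutral_right) (auto simp: zero_fun_def)
      also have "\<dots> \<in> fun_space.span ?C" by (rule eigenbasis_combination)
      finally show "f \<in> fun_space.span ?C" .
    qed
  qed
  moreover have "fun_space.independent ?C"
    using orthonormal_on_independent[OF fin(2) on] by (rule fun_space.independent_mono) auto
  ultimately show ?thesis by (rule fun_space.dim_eq_card)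
qed

lemma eigenvalues_matop: "eigenvalues (fsupp D) (matop D M) = evl ` B"
proof (intro equalityI subsetI)
  fix c assume "c \<in> evl ` B"
  then obtain b where b: "b \<in> B" "c = evl b" by blast
  then have "(\<Sum>x\<in>D. b x * b x) = 1" using on by (auto simp: orthonormal_on_def)
  then have "b \<noteq> 0" by auto
  then show "c \<in> eigenvalues (fsupp D) (matop D M)"
    using b on evl by (auto simp: eigenvalues_def eigenspace_def orthonormal_on_def)
next
  fix c assume "c \<in> eigenvalues (fsupp D) (matop D M)"
  then obtain f where f: "f \<in> eigenspace (fsupp D) (matop D M) c" "f \<noteq> 0"
    by (auto simp: eigenvalues_def)
  then have "f \<in> fsupp D" by (simp add: eigenspace_def)
  have "\<exists>b\<in>B. (\<Sum>y\<in>D. f y * b y) \<noteq> 0"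
  proof (rule ccontr)
    assume "\<not> ?thesis"
    then have "f = 0" using eigenbasis_expand[OF \<open>f \<in> fsupp D\<close>] by (simp add: fun_eq_iff sum_fun_apply)
    with f show False by simp
  qed
  then obtain b where b: "b \<in> B" "(\<Sum>y\<in>D. f y * b y) \<noteq> 0" by blast
  have "c * (\<Sum>y\<in>D. f y * b y) = evl b * (\<Sum>y\<in>D. f y * b y)"
    using matop_sa[of f b] f b
    by (simp add: eigenspace_def evl sum_distrib_left ac_simps)
  then show "c \<in> evl ` B" using b by auto
qed

lemma esd_matop_sum:
  fixes f :: "real \<Rightarrow> real"
  shows "(\<Sum>c\<in>evl ` B. real (card {b \<in> B. evl b = c}) / real (card D) * f c) = (\<Sum>b\<in>B. f (evl b)) / real (card D)"
proof -
  have "(\<Sum>b\<in>B. f (evl b)) = (\<Sum>c\<in>evl ` B. \<Sum>b | b \<in> B \<and> evl b = c. f (evl b))"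
    by (rule sum.image_gen[OF fin(2)])
  also have "\<dots> = (\<Sum>c\<in>evl ` B. real (card {b \<in> B. evl b = c}) * f c)"
    by (intro sum.cong refl) simp
  finally show ?thesis by (simp add: sum_divide_distrib)
qed

lemma prob_esd_matop: "esd (fsupp D) (matop D M) \<in> space (prob_algebra borel)"
proof -
  let ?p = "\<lambda>c. real (card {b \<in> B. evl b = c}) / real (card D)"
  have "prob_space (point_measure (evl ` B) (\<lambda>c. ennreal (?p c)))"
  proof (rule prob_spaceI)
    have "emeasure (point_measure (evl ` B) (\<lambda>c. ennreal (?p c))) (evl ` B) = (\<Sum>c\<in>evl ` B. ennreal (?p c))"
      using fin by (subst emeasure_point_measure_finite) auto
    also have "\<dots> = ennreal (\<Sum>c\<in>evl ` B. ?p c)" by (rule sum_ennreal) auto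
    also have "(\<Sum>c\<in>evl ` B. ?p c) = 1"
      using esd_matop_sum[of "\<lambda>_. 1"] card_B ne fin by simp
    finally show "emeasure (point_measure (evl ` B) (\<lambda>c. ennreal (?p c)))
        (space (point_measure (evl ` B) (\<lambda>c. ennreal (?p c)))) = 1"
      by (simp add: space_point_measure)
  qed
  then show ?thesis
    by (auto simp: esd_def eigenvalues_matop dim_eigenspace dim_fsupp space_prob_algebra
        measurable_point_measure_eq1 intro!: prob_space.prob_space_distr)
qed

lemma integral_esd_matop:
  fixes f :: "real \<Rightarrow> real"
  assumes "f \<in> borel_measurable borel"
  shows "(\<integral>x. f x \<partial>esd (fsupp D) (matop D M)) = (\<Sum>b\<in>B. f (evl b)) / real (card D)"
proof -
  have "(\<integral>x. f x \<partial>esd (fsupp D) (matop D M)) =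
      (\<integral>x. f x \<partial>point_measure (evl ` B) (\<lambda>c. ennreal (real (card {b \<in> B. evl b = c}) / real (card D))))"
    using assms unfolding esd_def eigenvalues_matop dim_eigenspace dim_fsupp
    by (subst integral_distr) (auto simp: measurable_point_measure_eq1)
  also have "\<dots> = (\<Sum>c\<in>evl ` B. real (card {b \<in> B. evl b = c}) / real (card D) * f c)"
    using fin by (subst lebesgue_integral_point_measure_finite) auto
  also have "\<dots> = (\<Sum>b\<in>B. f (evl b)) / real (card D)" by (rule esd_matop_sum)
  finally show ?thesis .
qed

text \<open>Gershgorin's argument: read the eigenvalue equation at a coordinate where
  \<open>b\<close> is largest in modulus.\<close>

lemma abs_eigenvalue_le:
  assumes b: "b \<in> B" and C: "\<And>x. x \<in> D \<Longrightarrow> (\<Sum>y\<in>D. \<bar>M x y\<bar>) \<le> C"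
  shows "\<bar>evl b\<bar> \<le> C"
proof -
  obtain x where x: "x \<in> D" and max: "\<And>y. y \<in> D \<Longrightarrow> \<bar>b y\<bar> \<le> \<bar>b x\<bar>"
  proof -
    have "Max ((\<lambda>y. \<bar>b y\<bar>) ` D) \<in> (\<lambda>y. \<bar>b y\<bar>) ` D" using fin(1) ne by (intro Max_in) auto
    then obtain x where "x \<in> D" "\<bar>b x\<bar> = Max ((\<lambda>y. \<bar>b y\<bar>) ` D)" by auto
    then show ?thesis using that fin(1) by (metis Max_ge finite_imageI image_eqI)
  qed
  have "b x \<noteq> 0"
  proof
    assume "b x = 0"
    then have "\<forall>y\<in>D. b y = 0" using max by fastforce
    moreover have "(\<Sum>y\<in>D. b y * b y) = 1" using on b by (auto simp: orthonormal_on_def)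
    ultimately show False by simp
  qed
  have "\<bar>evl b\<bar> * \<bar>b x\<bar> = \<bar>\<Sum>y\<in>D. M x y * b y\<bar>"
    using fun_cong[OF evl[OF b], of x] x by (simp add: matop_def abs_mult)
  also have "\<dots> \<le> (\<Sum>y\<in>D. \<bar>M x y\<bar> * \<bar>b x\<bar>)"
    by (rule order_trans[OF sum_abs sum_mono]) (simp add: abs_mult max mult_left_mono)
  also have "\<dots> \<le> C * \<bar>b x\<bar>" using C[OF x] by (simp add: sum_distrib_right[symmetric] mult_right_mono)
  finally show ?thesis using \<open>b x \<noteq> 0\<close> by simp
qed

text \<open>Meant for polynomial expressions \<open>P\<close> in \<open>M\<close>, such as powers or
  sums of words: they share the eigenbasis, and \<open>\<mu>\<close> is the polynomial evaluated at
  \<open>evl\<close>.\<close>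

lemma trace_eq_sum_eigenvalues:
  assumes P: "\<And>b x. b \<in> B \<Longrightarrow> x \<in> D \<Longrightarrow> (\<Sum>y\<in>D. P x y * b y) = \<mu> b * b x"
  shows "(\<Sum>x\<in>D. P x x) = (\<Sum>b\<in>B. \<mu> b)"
proof -
  have "(\<Sum>x\<in>D. P x x) = (\<Sum>x\<in>D. \<Sum>y\<in>D. P x y * (\<Sum>b\<in>B. b y * b x))"
    using fin by (intro sum.cong refl) (simp add: complete if_distrib sum.delta cong: if_cong sum.cong)
  also have "\<dots> = (\<Sum>x\<in>D. \<Sum>b\<in>B. (\<Sum>y\<in>D. P x y * b y) * b x)"
    by (intro sum.cong refl) (simp add: sum_distrib_left sum_distrib_right mult.assoc sum.swap[of _ B D])
  also have "\<dots> = (\<Sum>b\<in>B. \<Sum>x\<in>D. \<mu> b * (b x * b x))"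
    by (subst sum.swap) (intro sum.cong refl, simp add: P)
  also have "\<dots> = (\<Sum>b\<in>B. \<mu> b)"
    using on by (intro sum.cong refl) (auto simp: sum_distrib_left[symmetric] orthonormal_on_def)
  finally show ?thesis .
qed

end

subsection \<open>Orientation signs\<close>

definition order_sign :: "nat \<Rightarrow> nat \<Rightarrow> int" where
  "order_sign a b = (if a < b then 1 else -1)"

text \<open>A product over all pairs of positions; for distinct entries it is the sign of the
  permutation that sorts the list.\<close>

fun list_sign :: "nat list \<Rightarrow> int" where
  "list_sign [] = 1"
| "list_sign (x # xs) = prod_list (map (order_sign x) xs) * list_sign xs"

lemma order_sign_swap: "a \<noteq> b \<Longrightarrow> order_sign b a = - order_sign a b"
  by (auto simp: order_sign_def)

lemma order_sign_sq: "order_sign a b * order_sign a b = 1"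
  by (auto simp: order_sign_def)

lemma prod_order_sign_sq: "prod_list (map (order_sign a) xs) * prod_list (map (order_sign a) xs) = 1"
proof (induction xs)
  case (Cons x xs)
  then show ?case using order_sign_sq[of a x] by (simp add: order_sign_def)
qed simp

lemma list_sign_sq: "list_sign vs * list_sign vs = 1"
proof (induction vs)
  case (Cons x xs)
  then show ?case using prod_order_sign_sq[of x xs] by (simp add: mult.assoc mult.left_commute)
qed simp

lemma prod_order_sign_swap:
  "x \<notin> set xs \<Longrightarrow> prod_list (map (\<lambda>u. order_sign u x) xs) = (-1) ^ length xs * prod_list (map (order_sign x) xs)"
  by (induction xs) (auto simp: order_sign_swap[of x])

lemma list_sign_append:
  "list_sign (us @ vs) = list_sign us * list_sign vs * prod_list (map (\<lambda>u. prod_list (map (order_sign u) vs)) us)"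
  by (induction us) auto

lemma prod_list_mult: "prod_list (map (\<lambda>x. f x * g x) xs) = prod_list (map f xs) * (prod_list (map g xs) :: int)"
  by (induction xs) auto

text \<open>Each of the two entries is compared once with every entry of \<open>us\<close>,
  \<open>ws\<close> and \<open>zs\<close>, and the total of these signs is symmetric in the two;
  only their mutual order changes.\<close>

lemma list_sign_swap:
  assumes "x \<notin> set ws" "y \<notin> set ws" "x \<noteq> y"
  shows "list_sign (us @ y # ws @ x # zs) = - list_sign (us @ x # ws @ y # zs)"
proof -
  define X where "X x = prod_list (map (order_sign x) ws)" for x
  define Z where "Z x = prod_list (map (order_sign x) zs)" for x
  define W where "W = list_sign (ws @ zs)"
  have 1: "list_sign (a # ws @ b # zs) = (-1) ^ length ws * (X a * X b * Z a * Z b * W) * order_sign a b"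
    if "b \<notin> set ws" for a b
  proof -
    have "list_sign (ws @ b # zs) = list_sign (ws @ zs) * ((-1) ^ length ws * X b) * Z b"
      using that
      by (simp add: list_sign_append prod_list_mult prod_order_sign_swap X_def Z_def mult.assoc mult.left_commute)
    then show ?thesis by (simp add: X_def Z_def W_def mult.assoc mult.left_commute mult.commute)
  qed
  have "list_sign (y # ws @ x # zs) = - list_sign (x # ws @ y # zs)"
    unfolding 1[OF assms(1)] 1[OF assms(2)] order_sign_swap[OF assms(3)] by (simp add: mult.commute mult.left_commute)
  moreover have "prod_list (map (\<lambda>u. prod_list (map (order_sign u) (y # ws @ x # zs))) us)
      = prod_list (map (\<lambda>u. prod_list (map (order_sign u) (x # ws @ y # zs))) us)"
    by (simp only: list.map map_append prod_list.Cons prod_list.append mult_ac)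
  ultimately show ?thesis by (simp only: list_sign_append mult_minus_left mult_minus_right)
qed

lemma list_split_two:
  assumes "a < b" "b < length vs"
  shows "vs = take a vs @ vs ! a # take (b - Suc a) (drop (Suc a) vs) @ vs ! b # drop (Suc b) vs"
proof -
  have "vs = take a vs @ vs ! a # drop (Suc a) vs" using assms by (simp add: id_take_nth_drop)
  moreover have "drop (Suc a) vs = take (b - Suc a) (drop (Suc a) vs) @ vs ! b # drop (Suc b) vs"
    using id_take_nth_drop[of "b - Suc a" "drop (Suc a) vs"] assms by simp
  ultimately show ?thesis by simp
qed

lemma permute_list_transpose:
  assumes "a < length vs" "b < length vs"
  shows "permute_list (Transposition.transpose a b) vs = vs[a := vs ! b, b := vs ! a]"
  using assms by (intro nth_equalityI)
    (auto simp: permute_list_nth permutes_swap_id Transposition.transpose_def nth_list_update)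

lemma list_sign_transpose:
  assumes "distinct vs" "a < length vs" "b < length vs" "a \<noteq> b"
  shows "list_sign (permute_list (Transposition.transpose a b) vs) = - list_sign vs"
proof -
  have main: "list_sign (vs[a := vs ! b, b := vs ! a]) = - list_sign vs"
    if ab: "a < b" "b < length vs" for a b
  proof -
    define us ws zs where d: "us = take a vs" "ws = take (b - Suc a) (drop (Suc a) vs)" "zs = drop (Suc b) vs"
    have vs: "vs = us @ vs ! a # ws @ vs ! b # zs" unfolding d by (rule list_split_two[OF ab])
    have len: "length us = a" "length ws = b - Suc a" using ab by (auto simp: d)
    have b: "b = Suc (a + length ws)" using ab len by simp
    have eq: "vs[a := vs ! b, b := vs ! a] = us @ vs ! b # ws @ vs ! a # zs"
    proof -
      have "(us @ x # ws @ y # zs)[a := y', b := x'] = us @ y' # ws @ x' # zs" for x y x' y'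
        using len(1) by (simp add: list_update_append b)
      then show ?thesis using vs by metis
    qed
    have "distinct (us @ vs ! a # ws @ vs ! b # zs)" using vs assms(1) by simp
    then have "list_sign (us @ vs ! b # ws @ vs ! a # zs) = - list_sign (us @ vs ! a # ws @ vs ! b # zs)"
      by (intro list_sign_swap) auto
    then show ?thesis using vs eq by simp
  qed
  show ?thesis
  proof (cases "a < b")
    case True
    then show ?thesis using main assms by (simp add: permute_list_transpose)
  next
    case False
    then have "b < a" using assms by simp
    from main[OF this assms(2)] show ?thesis
      using assms by (simp add: permute_list_transpose list_update_swap)
  qed
qed

lemma list_sign_permute:
  assumes "p permutes {..<length vs}" "distinct vs"
  shows "list_sign (permute_list p vs) = sign p * list_sign vs"
proof -
  have "finite {..<length vs}" by simp
  from this assms show ?thesis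
  proof (induction p arbitrary: rule: permutes_rev_induct)
    case id
    then show ?case by simp
  next
    case (swap a b p)
    have t: "Transposition.transpose a b permutes {..<length vs}" using swap by (intro permutes_swap_id) auto
    have "list_sign (permute_list (p \<circ> Transposition.transpose a b) vs)
      = list_sign (permute_list (Transposition.transpose a b) (permute_list p vs))"
      using permute_list_compose[OF t, of p] by simp
    also have "\<dots> = (if a = b then 1 else -1) * list_sign (permute_list p vs)"
      using swap by (auto simp: list_sign_transpose)
    also have "\<dots> = sign (p \<circ> Transposition.transpose a b) * list_sign vs"
      using swap t by (subst sign_compose) (auto simp: sign_swap_id intro: permutes_imp_permutation[of "{..<length vs}"])
    finally show ?case .
  qed
qed

lemma list_sign_sorted: "sorted_wrt (<) vs \<Longrightarrow> list_sign vs = 1"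
proof (induction vs)
  case (Cons x xs)
  have "prod_list (map (order_sign x) xs) = prod_list (map (\<lambda>_. 1) xs)"
    using Cons by (intro arg_cong[where f = prod_list] map_cong refl) (auto simp: order_sign_def)
  then show ?case using Cons by (simp add: map_replicate_const)
qed simp

text \<open>The exponent is the position of \<open>v\<close> in the increasing order of \<tau>,
  counted from 0, so this is the boundary sign for the increasing ordering.\<close>

definition facet_sign :: "nat set \<Rightarrow> nat \<Rightarrow> int" where
  "facet_sign \<tau> v = (-1) ^ card {u \<in> \<tau>. u < v}"

lemma facet_sign_sq: "facet_sign \<tau> v * facet_sign \<tau> v = 1"
  by (simp add: facet_sign_def power_mult_distrib[symmetric])

lemma facet_sign_prod:
  assumes "distinct xs" "x \<notin> set xs"
  shows "prod_list (map (order_sign x) xs) = facet_sign (insert x (set xs)) x"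
proof -
  have "{u \<in> insert x (set xs). u < x} = {u \<in> set xs. u < x}" by auto
  moreover have "prod_list (map (order_sign x) xs) = (-1) ^ card {u \<in> set xs. u < x}"
    using assms
  proof (induction xs)
    case (Cons y xs)
    have "{u \<in> set (y # xs). u < x} = (if y < x then insert y {u \<in> set xs. u < x} else {u \<in> set xs. u < x})"
      by auto
    then show ?case using Cons by (auto simp: order_sign_def)
  qed simp
  ultimately show ?thesis by (simp add: facet_sign_def)
qed

text \<open>Moving the deleted entry to the front passes \<open>i\<close> entries, and its sign
  against all the others depends only on the set. Hence the boundary sign of any ordering reduces to
  that of the increasing one.\<close>

lemma list_sign_delete:
  assumes "distinct vs" "i < length vs"
  shows "(-1) ^ i * list_sign (take i vs @ drop (Suc i) vs) = list_sign vs * facet_sign (set vs) (vs ! i)"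
proof -
  define us zs x where d: "us = take i vs" "zs = drop (Suc i) vs" "x = vs ! i"
  have vs: "vs = us @ x # zs" unfolding d using assms by (simp add: id_take_nth_drop)
  have len: "length us = i" using assms by (simp add: d)
  have dist: "distinct (us @ x # zs)" using vs assms by simp
  have "list_sign vs = list_sign (us @ zs) * prod_list (map (\<lambda>u. order_sign u x) us) * prod_list (map (order_sign x) zs)"
    unfolding vs by (simp add: list_sign_append prod_list_mult ac_simps)
  also have "\<dots> = (-1) ^ i * list_sign (us @ zs) * (prod_list (map (order_sign x) (us @ zs)))"
    using dist len by (simp add: prod_order_sign_swap)
  also have "prod_list (map (order_sign x) (us @ zs)) = facet_sign (set vs) x"
    using dist by (subst facet_sign_prod) (auto simp: vs)
  finally have "list_sign vs * facet_sign (set vs) x = (-1) ^ i * list_sign (us @ zs)"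
    by (simp add: mult.assoc facet_sign_sq)
  then show ?thesis by (simp add: d)
qed

subsection \<open>Oriented faces as signed sets\<close>

text \<open>The sign is relative to the increasing order, which gives an oriented face the
  coordinates vertex set and sign. For a single vertex these signs are the two formal
  opposites.\<close>

definition signed_face :: "nat set \<Rightarrow> int \<Rightarrow> oface" where
  "signed_face t e = {(s, vs). set vs = t \<and> distinct vs \<and> s * list_sign vs = e}"

lemma sign_sq: "sign p * sign p = (1 :: int)" by (simp add: sign_def)

text \<open>Distinct lists with the same entries differ by a permutation, whose sign is the quotient
  of their \<open>list_sign\<close> values; this shows that the class is exhausted.\<close>

lemma orient_eq_signed_face:
  assumes "distinct vs"
  shows "orient s vs = signed_face (set vs) (s * list_sign vs)"
proof (intro equalityI subsetI)
  fix x assume "x \<in> orient s vs"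
  then obtain p where p: "p permutes {..<length vs}" "x = (s * sign p, permute_list p vs)"
    by (auto simp: orient_def)
  have "s * sign p * list_sign (permute_list p vs) = s * list_sign vs"
    using list_sign_permute[OF p(1) assms] sign_sq[of p] by (simp add: mult.assoc mult.left_commute)
  then show "x \<in> signed_face (set vs) (s * list_sign vs)"
    using p assms by (simp add: signed_face_def)
next
  fix x assume "x \<in> signed_face (set vs) (s * list_sign vs)"
  then obtain s' vs' where x: "x = (s', vs')" "set vs' = set vs" "distinct vs'"
    and e: "s' * list_sign vs' = s * list_sign vs" by (auto simp: signed_face_def)
  have "mset vs' = mset vs" using x assms by (simp add: set_eq_iff_mset_eq_distinct)
  then obtain p where p: "p permutes {..<length vs}" "permute_list p vs = vs'"
    by (rule mset_eq_permutation)
  have "s' * sign p * list_sign vs = s * list_sign vs"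
    using e list_sign_permute[OF p(1) assms] p(2) by (simp add: mult.assoc)
  then have "s' * sign p * (list_sign vs * list_sign vs) = s * (list_sign vs * list_sign vs)"
    by (simp only: mult.assoc[symmetric])
  then have "s' * sign p = s" by (simp add: list_sign_sq)
  then have "s' = s * sign p" using sign_sq[of p] by (metis mult.assoc mult.right_neutral)
  then show "x \<in> orient s vs" using p x by (auto simp: orient_def)
qed

lemma sorted_in_signed_face:
  assumes "finite t" shows "(e, sorted_list_of_set t) \<in> signed_face t e"
  using assms by (simp add: signed_face_def list_sign_sorted)

lemma signed_face_inject:
  assumes "finite t"
  shows "signed_face t e = signed_face t' e' \<longleftrightarrow> t = t' \<and> e = e'"
proof
  assume "signed_face t e = signed_face t' e'"
  then have "(e, sorted_list_of_set t) \<in> signed_face t' e'" using sorted_in_signed_face[OF assms] by metis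
  then show "t = t' \<and> e = e'" using assms by (auto simp: signed_face_def list_sign_sorted)
qed simp

lemma opposite_signed_face: "opposite (signed_face t e) = signed_face t (- e)"
proof -
  have "(s, vs) \<in> opposite (signed_face t e)" if "(s, vs) \<in> signed_face t (- e)" for s vs
    unfolding opposite_def
    by (rule rev_image_eqI[of "(- s, vs)"]) (use that in \<open>auto simp: signed_face_def\<close>)
  then show ?thesis by (auto simp: opposite_def signed_face_def)
qed

lemma vertices_signed_face: "finite t \<Longrightarrow> vertices (signed_face t e) = t"
proof -
  assume "finite t"
  then have "set (sorted_list_of_set t) \<subseteq> vertices (signed_face t e)"
    unfolding vertices_def using sorted_in_signed_face[of t e] by blast
  then show ?thesis using \<open>finite t\<close> by (auto simp: vertices_def signed_face_def)
qed

lemma oriented_faces_eq: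
  "oriented_faces X l = {signed_face t e | t e. t \<in> X \<and> finite t \<and> card t = l + 1 \<and> e \<in> {1, -1}}"
proof (intro equalityI subsetI)
  fix x assume "x \<in> oriented_faces X l"
  then obtain s vs where "x = orient s vs" "s \<in> {1, -1}" "distinct vs" "length vs = l + 1" "set vs \<in> X"
    by (auto simp: oriented_faces_def)
  moreover have "list_sign vs \<in> {1, -1}" using list_sign_sq[of vs] by (auto simp: zmult_eq_1_iff)
  ultimately show "x \<in> {signed_face t e | t e. t \<in> X \<and> finite t \<and> card t = l + 1 \<and> e \<in> {1, -1}}"
    by (intro CollectI exI[of _ "set vs"] exI[of _ "s * list_sign vs"])
      (auto simp: orient_eq_signed_face distinct_card)
next
  fix x assume "x \<in> {signed_face t e | t e. t \<in> X \<and> finite t \<and> card t = l + 1 \<and> e \<in> {1, -1}}"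
  then obtain t e where "x = signed_face t e" "t \<in> X" "finite t" "card t = l + 1" "e \<in> {1, -1}" by blast
  moreover from this have "x = orient e (sorted_list_of_set t)"
    by (simp add: orient_eq_signed_face list_sign_sorted)
  moreover have "set (sorted_list_of_set t) \<in> X" "length (sorted_list_of_set t) = l + 1"
    using calculation by simp_all
  ultimately show "x \<in> oriented_faces X l" unfolding oriented_faces_def
    using distinct_sorted_list_of_set by blast
qed

lemma oriented_boundary_eq:
  assumes "finite \<tau>"
  shows "oriented_boundary (signed_face \<tau> e) = {signed_face (\<tau> - {v}) (e * facet_sign \<tau> v) | v. v \<in> \<tau>}"
proof -
  have *: "orient (s * (-1) ^ i) (take i vs @ drop (Suc i) vs) = signed_face (\<tau> - {vs ! i}) (e * facet_sign \<tau> (vs ! i))"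
    if "(s, vs) \<in> signed_face \<tau> e" "i < length vs" for s vs i
  proof -
    have vs: "set vs = \<tau>" "distinct vs" "s * list_sign vs = e" using that by (auto simp: signed_face_def)
    have dist: "distinct (take i vs @ vs ! i # drop (Suc i) vs)" using vs that id_take_nth_drop[of i vs] by simp
    have "set (take i vs @ drop (Suc i) vs) = \<tau> - {vs ! i}"
    proof -
      have "\<tau> = set (take i vs @ vs ! i # drop (Suc i) vs)" using vs that id_take_nth_drop[of i vs] by simp
      then show ?thesis using dist by auto
    qed
    then show ?thesis using dist list_sign_delete[OF vs(2) that(2)] vs
      by (subst orient_eq_signed_face) (auto simp: mult.assoc)
  qed
  show ?thesis
  proof (intro equalityI subsetI)
    fix x assume "x \<in> oriented_boundary (signed_face \<tau> e)"
    then obtain s vs i where x: "x = orient (s * (-1) ^ i) (take i vs @ drop (Suc i) vs)"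
        "(s, vs) \<in> signed_face \<tau> e" "i < length vs"
      unfolding oriented_boundary_def by blast
    moreover have "vs ! i \<in> \<tau>" using x nth_mem[of i vs] by (auto simp: signed_face_def)
    ultimately show "x \<in> {signed_face (\<tau> - {v}) (e * facet_sign \<tau> v) | v. v \<in> \<tau>}"
      using *[of s vs i] by blast
  next
    fix x assume "x \<in> {signed_face (\<tau> - {v}) (e * facet_sign \<tau> v) | v. v \<in> \<tau>}"
    then obtain v where v: "v \<in> \<tau>" "x = signed_face (\<tau> - {v}) (e * facet_sign \<tau> v)" by blast
    let ?vs = "sorted_list_of_set \<tau>"
    have "v \<in> set ?vs" using v assms by simp
    then obtain i where i: "i < length ?vs" "?vs ! i = v" unfolding in_set_conv_nth by blast
    show "x \<in> oriented_boundary (signed_face \<tau> e)"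
      unfolding oriented_boundary_def using *[OF sorted_in_signed_face[OF assms] i(1)] i v
        sorted_in_signed_face[OF assms, of e]
      by blast
  qed
qed

subsection \<open>Matrices of the operators\<close>

definition dsets :: "nat \<Rightarrow> nat \<Rightarrow> nat set set" where
  "dsets n d = {t. t \<subseteq> {1..n} \<and> card t = d}"

text \<open>The incidence number of the facet \<open>t\<close> in \<tau>, an entry of the boundary
  matrix. If \<tau> - t is not a single vertex, \<open>the_elem\<close> is unspecified, but the
  value is still a sign.\<close>

definition facet_inc :: "nat set \<Rightarrow> nat set \<Rightarrow> int" where
  "facet_inc \<tau> t = facet_sign \<tau> (the_elem (\<tau> - t))"

text \<open>The off-diagonal part of the boundary matrix of the cells in \<open>Y\<close> times its
  transpose, on sets of size d. It serves both for a single Steiner system and for the union of all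
  of them.\<close>

definition block_matrix :: "nat set set \<Rightarrow> nat set \<Rightarrow> nat set \<Rightarrow> real" where
  "block_matrix Y t t' = (if t \<noteq> t' \<and> t \<union> t' \<in> Y
     then real_of_int (facet_inc (t \<union> t') t * facet_inc (t \<union> t') t') else 0)"

text \<open>The basis cochain of a set is the indicator of its increasing orientation minus that of
  the opposite one. On \<open>fsupp\<close> this is an isomorphism onto the cochains.\<close>

definition cochain_of :: "nat set set \<Rightarrow> (nat set \<Rightarrow> real) \<Rightarrow> oface \<Rightarrow> real" where
  "cochain_of D g \<sigma> =
     (\<Sum>t\<in>D. g t * (if \<sigma> = signed_face t 1 then 1 else if \<sigma> = signed_face t (-1) then -1 else 0))"

definition steiner_complex :: "nat \<Rightarrow> nat \<Rightarrow> nat set set \<Rightarrow> nat set set" where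
  "steiner_complex n d Y = {s. s \<subseteq> {1..n} \<and> card s \<le> d} \<union> Y"

lemma finite_dsets [simp]: "finite (dsets n d)"
  by (rule finite_subset[of _ "Pow {1..n}"]) (auto simp: dsets_def)

lemma finite_dsetsD: "t \<in> dsets n d \<Longrightarrow> finite t"
  by (auto simp: dsets_def intro: finite_subset[OF _ finite_atLeastAtMost])

lemma facet_inc_sq: "facet_inc \<tau> t * facet_inc \<tau> t = 1"
  by (simp add: facet_inc_def facet_sign_sq)

lemma facet_inc_cases: "facet_inc \<tau> t \<in> {1, -1}"
  by (simp add: facet_inc_def facet_sign_def minus_one_power_iff)

lemma facet_inc_remove: "v \<in> \<tau> \<Longrightarrow> facet_inc \<tau> (\<tau> - {v}) = facet_sign \<tau> v"
proof -
  assume "v \<in> \<tau>"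
  then have "\<tau> - (\<tau> - {v}) = {v}" by auto
  then show ?thesis by (simp add: facet_inc_def)
qed

lemma block_matrix_sym: "block_matrix Y t t' = block_matrix Y t' t"
  by (auto simp: block_matrix_def Un_commute)

lemma abs_block_matrix_le: "\<bar>block_matrix Y t t'\<bar> \<le> 1"
  using facet_inc_cases[of "t \<union> t'" t] facet_inc_cases[of "t \<union> t'" t'] by (auto simp: block_matrix_def)

lemma cochain_of_signed_face:
  assumes "t \<in> dsets n d" "e \<in> {1,-1}"
  shows "cochain_of (dsets n d) g (signed_face t e) = of_int e * g t"
proof -
  have "cochain_of (dsets n d) g (signed_face t e) = (\<Sum>s\<in>dsets n d. if s = t then of_int e * g t else 0)"
    unfolding cochain_of_def using assms
    by (intro sum.cong refl) (auto simp: signed_face_inject finite_dsetsD)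
  then show ?thesis using assms by simp
qed

context
  fixes n d :: nat and Y :: "nat set set"
  assumes d: "1 \<le> d" and Y: "\<And>s. s \<in> Y \<Longrightarrow> s \<subseteq> {1..n} \<and> card s = d + 1"
begin

lemma oriented_facets_iff:
  "\<sigma> \<in> oriented_faces (steiner_complex n d Y) (d - 1) \<longleftrightarrow> (\<exists>t\<in>dsets n d. \<exists>e\<in>{1,-1}. \<sigma> = signed_face t e)"
proof -
  have "t \<in> steiner_complex n d Y \<and> finite t \<and> card t = d - 1 + 1 \<longleftrightarrow> t \<in> dsets n d" for t
    using d Y[of t] by (auto simp: steiner_complex_def dsets_def intro: finite_subset[OF _ finite_atLeastAtMost])
  then show ?thesis unfolding oriented_faces_eq by blast
qed

lemma oriented_cells_iff:
  "\<sigma> \<in> oriented_faces (steiner_complex n d Y) d \<longleftrightarrow> (\<exists>t\<in>Y. \<exists>e\<in>{1,-1}. \<sigma> = signed_face t e)"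
proof -
  have "t \<in> steiner_complex n d Y \<and> finite t \<and> card t = d + 1 \<longleftrightarrow> t \<in> Y" for t
    using Y[of t] by (auto simp: steiner_complex_def intro: finite_subset[OF _ finite_atLeastAtMost])
  then show ?thesis unfolding oriented_faces_eq by blast
qed

text \<open>Both faces inherit their signs from one orientation \<open>f\<close> of the cell.
  Eliminating \<open>f\<close> from the two boundary conditions fixes the sign of the neighbour, and
  the minus sign comes from \<open>opposite\<close>; it is the reason why adjacency is minus the
  block matrix.\<close>

lemma neighbours_eq:
  assumes t: "t \<in> dsets n d" and e: "e \<in> {1,-1}"
  shows "neighbours (steiner_complex n d Y) d (signed_face t e) =
    (\<lambda>t'. signed_face t' (- e * facet_inc (t \<union> t') t * facet_inc (t \<union> t') t')) `
      {t' \<in> dsets n d. t \<noteq> t' \<and> t \<union> t' \<in> Y}" (is "?L = ?R")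
proof (intro equalityI subsetI)
  fix \<sigma> assume "\<sigma> \<in> ?L"
  then have "\<sigma> \<in> oriented_faces (steiner_complex n d Y) (d - 1)"
    and ne: "opposite \<sigma> \<noteq> signed_face t e"
    and "\<exists>\<tau>\<in>oriented_faces (steiner_complex n d Y) d.
      signed_face t e \<in> oriented_boundary \<tau> \<and> opposite \<sigma> \<in> oriented_boundary \<tau>"
    by (simp_all add: neighbours_def)
  then obtain t' e' \<tau> where \<sigma>: "\<sigma> = signed_face t' e'" "t' \<in> dsets n d" "e' \<in> {1,-1}"
    and \<tau>: "\<tau> \<in> oriented_faces (steiner_complex n d Y) d"
      "signed_face t e \<in> oriented_boundary \<tau>" "opposite \<sigma> \<in> oriented_boundary \<tau>"
    unfolding oriented_facets_iff by blast
  then obtain T f where T: "T \<in> Y" "f \<in> {1,-1}"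
    and b: "signed_face t e \<in> oriented_boundary (signed_face T f)"
      "opposite \<sigma> \<in> oriented_boundary (signed_face T f)"
    unfolding oriented_cells_iff by blast
  have finT: "finite T" using T Y finite_subset by blast
  from b obtain v w where v: "v \<in> T" "t = T - {v}" "e = f * facet_sign T v"
    and w: "w \<in> T" "t' = T - {w}" "- e' = f * facet_sign T w"
    unfolding \<sigma> opposite_signed_face oriented_boundary_eq[OF finT]
    by (auto simp: signed_face_inject finite_dsetsD[OF t] finite_dsetsD[OF \<sigma>(2)])
  \<comment> \<open>Here the distinctness built into \<open>neighbours\<close> enters:
    \<open>v = w\<close> would make the opposite of \<sigma> equal to the given face.\<close>
  have "v \<noteq> w" using ne v w \<sigma> by (auto simp: opposite_signed_face)
  then have U: "t \<union> t' = T" "t \<noteq> t'" using v w by auto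
  have "f = e * facet_sign T v" using v(3) by (simp add: mult.assoc facet_sign_sq)
  then have "e' = - e * facet_inc T t * facet_inc T t'"
    using w(3) unfolding v(2) w(2) facet_inc_remove[OF v(1)] facet_inc_remove[OF w(1)] by simp
  then show "\<sigma> \<in> ?R" using \<sigma> U T by auto
next
  fix \<sigma> assume "\<sigma> \<in> ?R"
  then obtain t' where t': "t' \<in> dsets n d" "t \<noteq> t'" "t \<union> t' \<in> Y"
    and \<sigma>: "\<sigma> = signed_face t' (- e * facet_inc (t \<union> t') t * facet_inc (t \<union> t') t')" by blast
  let ?T = "t \<union> t'"
  have finT: "finite ?T" and cT: "card ?T = d + 1" using t' Y finite_subset by blast+
  have "\<exists>v\<in>?T. s = ?T - {v}" if "s \<in> {t, t'}" for s
  proof -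
    have s: "s \<in> dsets n d" "s \<subseteq> ?T" using that t t'(1) by auto
    have "card (?T - s) = card ?T - card s" by (rule card_Diff_subset[OF finite_dsetsD[OF s(1)] s(2)])
    also have "\<dots> = 1" using s(1) cT by (simp add: dsets_def)
    finally obtain v where v: "?T - s = {v}" by (rule card_1_singletonE)
    then have "v \<in> ?T \<and> s = ?T - {v}" using s(2) by blast
    then show ?thesis by blast
  qed
  then obtain v w where v: "v \<in> ?T" "t = ?T - {v}" and w: "w \<in> ?T" "t' = ?T - {w}" by (meson insertCI)
  \<comment> \<open>The orientation of the cell that induces \<open>e\<close> on
    \<open>t\<close>.\<close>
  define f where "f = e * facet_sign ?T v"
  have fv: "facet_inc ?T t = facet_sign ?T v" using facet_inc_remove[OF v(1)] v(2) by simp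
  have fw: "facet_inc ?T t' = facet_sign ?T w" using facet_inc_remove[OF w(1)] w(2) by simp
  have f: "f \<in> {1,-1}" using e facet_inc_cases[of ?T t] by (auto simp: f_def fv)
  have "signed_face t e = signed_face (?T - {v}) (f * facet_sign ?T v)"
    using v(2) by (simp add: f_def mult.assoc facet_sign_sq)
  then have 1: "signed_face t e \<in> oriented_boundary (signed_face ?T f)"
    unfolding oriented_boundary_eq[OF finT] using v(1) by blast
  have "opposite \<sigma> = signed_face (?T - {w}) (f * facet_sign ?T w)"
    using w(2) by (simp add: f_def \<sigma> opposite_signed_face fv fw)
  then have 2: "opposite \<sigma> \<in> oriented_boundary (signed_face ?T f)"
    unfolding oriented_boundary_eq[OF finT] using w(1) by blast
  have 3: "\<sigma> \<in> oriented_faces (steiner_complex n d Y) (d - 1)"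
    unfolding oriented_facets_iff
  proof (intro bexI)
    show "\<sigma> = signed_face t' (- e * facet_inc (t \<union> t') t * facet_inc (t \<union> t') t')" by (rule \<sigma>)
    show "- e * facet_inc (t \<union> t') t * facet_inc (t \<union> t') t' \<in> {1,-1}"
      using e facet_inc_cases[of ?T t] facet_inc_cases[of ?T t'] by auto
  qed (rule t')
  have 4: "opposite \<sigma> \<noteq> signed_face t e"
    using t'(2) finite_dsetsD[OF t'(1)] by (simp add: \<sigma> opposite_signed_face signed_face_inject)
  have 5: "signed_face ?T f \<in> oriented_faces (steiner_complex n d Y) d"
    unfolding oriented_cells_iff using t'(3) f by blast
  show "\<sigma> \<in> ?L" unfolding neighbours_def using 1 2 3 4 5 by blast
qed

lemma cochain_of_outside:
  assumes "\<sigma> \<notin> oriented_faces (steiner_complex n d Y) (d - 1)"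
  shows "cochain_of (dsets n d) g \<sigma> = 0"
  unfolding cochain_of_def
proof (rule sum.neutral, rule ballI)
  fix t assume "t \<in> dsets n d"
  then have "\<sigma> \<noteq> signed_face t 1" "\<sigma> \<noteq> signed_face t (-1)"
    using assms unfolding oriented_facets_iff by blast+
  then show "g t * (if \<sigma> = signed_face t 1 then 1 else if \<sigma> = signed_face t (-1) then -1 else 0) = 0"
    by simp
qed

lemma cochains_eq: "cochains (steiner_complex n d Y) (d - 1) = cochain_of (dsets n d) ` fsupp (dsets n d)"
proof (intro equalityI subsetI)
  fix f assume f: "f \<in> cochains (steiner_complex n d Y) (d - 1)"
  define g where "g = (\<lambda>t. if t \<in> dsets n d then f (signed_face t 1) else 0)"
  have "f = cochain_of (dsets n d) g"
  proof
    fix \<sigma>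
    show "f \<sigma> = cochain_of (dsets n d) g \<sigma>"
    proof (cases "\<sigma> \<in> oriented_faces (steiner_complex n d Y) (d - 1)")
      case True
      then obtain t e where \<sigma>: "t \<in> dsets n d" "e \<in> {1,-1}" "\<sigma> = signed_face t e"
        unfolding oriented_facets_iff by blast
      have "signed_face t 1 \<in> oriented_faces (steiner_complex n d Y) (d - 1)"
        unfolding oriented_facets_iff using \<sigma> by blast
      then have "f (opposite (signed_face t 1)) = - f (signed_face t 1)" using f by (auto simp: cochains_def)
      then show ?thesis using \<sigma> by (auto simp: cochain_of_signed_face g_def opposite_signed_face)
    next
      case False
      then show ?thesis using f cochain_of_outside[OF False] by (simp add: cochains_def)
    qed
  qed
  moreover have "g \<in> fsupp (dsets n d)" by (simp add: g_def fsupp_def)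
  ultimately show "f \<in> cochain_of (dsets n d) ` fsupp (dsets n d)" by blast
next
  fix f assume "f \<in> cochain_of (dsets n d) ` fsupp (dsets n d)"
  then obtain g where f: "f = cochain_of (dsets n d) g" by blast
  have "f (opposite \<sigma>) = - f \<sigma>" if "\<sigma> \<in> oriented_faces (steiner_complex n d Y) (d - 1)" for \<sigma>
    using that unfolding oriented_facets_iff f
    by (auto simp: opposite_signed_face cochain_of_signed_face)
  moreover have "f \<sigma> = 0" if "\<sigma> \<notin> oriented_faces (steiner_complex n d Y) (d - 1)" for \<sigma>
    using cochain_of_outside[OF that] by (simp add: f)
  ultimately show "f \<in> cochains (steiner_complex n d Y) (d - 1)" by (simp add: cochains_def)
qed

lemma sum_neighbours:
  assumes t: "t \<in> dsets n d" and e: "e \<in> {1,-1}"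
  shows "(\<Sum>\<sigma>\<in>neighbours (steiner_complex n d Y) d (signed_face t e). cochain_of (dsets n d) g \<sigma>)
    = of_int e * (\<Sum>t'\<in>dsets n d. - block_matrix Y t t' * g t')"
proof -
  let ?A = "{t' \<in> dsets n d. t \<noteq> t' \<and> t \<union> t' \<in> Y}"
  let ?e = "\<lambda>t'. - e * facet_inc (t \<union> t') t * facet_inc (t \<union> t') t'"
  have e': "?e t' \<in> {1,-1}" for t'
    using e facet_inc_cases[of "t \<union> t'" t] facet_inc_cases[of "t \<union> t'" t'] by auto
  have "inj_on (\<lambda>t'. signed_face t' (?e t')) ?A"
    by (rule inj_onI) (auto simp: signed_face_inject finite_dsetsD)
  then have "(\<Sum>\<sigma>\<in>neighbours (steiner_complex n d Y) d (signed_face t e). cochain_of (dsets n d) g \<sigma>)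
    = (\<Sum>t'\<in>?A. cochain_of (dsets n d) g (signed_face t' (?e t')))"
    unfolding neighbours_eq[OF t e] by (subst sum.reindex) auto
  also have "\<dots> = (\<Sum>t'\<in>?A. of_int (?e t') * g t')"
    by (intro sum.cong refl cochain_of_signed_face e') simp
  also have "\<dots> = (\<Sum>t'\<in>?A. of_int e * (- block_matrix Y t t' * g t'))"
    by (intro sum.cong refl) (auto simp: block_matrix_def)
  also have "\<dots> = (\<Sum>t'\<in>dsets n d. of_int e * (- block_matrix Y t t' * g t'))"
    by (intro sum.mono_neutral_left) (auto simp: block_matrix_def)
  finally show ?thesis by (simp add: sum_distrib_left)
qed

lemma adjacency_op_cochain_of:
  "adjacency_op (steiner_complex n d Y) d (cochain_of (dsets n d) g) =
    cochain_of (dsets n d) (matop (dsets n d) (\<lambda>t t'. - block_matrix Y t t') g)"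
proof
  fix \<sigma>
  show "adjacency_op (steiner_complex n d Y) d (cochain_of (dsets n d) g) \<sigma> =
    cochain_of (dsets n d) (matop (dsets n d) (\<lambda>t t'. - block_matrix Y t t') g) \<sigma>"
  proof (cases "\<sigma> \<in> oriented_faces (steiner_complex n d Y) (d - 1)")
    case True
    then obtain t e where \<sigma>: "t \<in> dsets n d" "e \<in> {1,-1}" "\<sigma> = signed_face t e"
      unfolding oriented_facets_iff by blast
    then show ?thesis using True
      by (simp add: adjacency_op_def sum_neighbours cochain_of_signed_face matop_def)
  qed (simp add: adjacency_op_def cochain_of_outside)
qed

lemma face_degree_signed_face:
  "t \<in> dsets n d \<Longrightarrow> face_degree (steiner_complex n d Y) d (signed_face t e) = card {s \<in> Y. t \<subseteq> s}"
  unfolding face_degree_def vertices_signed_face[OF finite_dsetsD]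
  by (rule arg_cong[where f = card]) (auto simp: steiner_complex_def dest: Y)

lemma upper_laplacian_cochain_of:
  "upper_laplacian (steiner_complex n d Y) d (cochain_of (dsets n d) g) =
    cochain_of (dsets n d) (matop (dsets n d)
      (\<lambda>t t'. (if t = t' then real (card {s \<in> Y. t \<subseteq> s}) else 0) + block_matrix Y t t') g)"
proof
  fix \<sigma>
  show "upper_laplacian (steiner_complex n d Y) d (cochain_of (dsets n d) g) \<sigma> =
    cochain_of (dsets n d) (matop (dsets n d)
      (\<lambda>t t'. (if t = t' then real (card {s \<in> Y. t \<subseteq> s}) else 0) + block_matrix Y t t') g) \<sigma>"
  proof (cases "\<sigma> \<in> oriented_faces (steiner_complex n d Y) (d - 1)")
    case True
    then obtain t e where \<sigma>: "t \<in> dsets n d" "e \<in> {1,-1}" "\<sigma> = signed_face t e"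
      unfolding oriented_facets_iff by blast
    have "matop (dsets n d) (\<lambda>t t'. (if t = t' then real (card {s \<in> Y. t \<subseteq> s}) else 0) + block_matrix Y t t') g t
      = (\<Sum>t'\<in>dsets n d. (if t = t' then real (card {s \<in> Y. t \<subseteq> s}) * g t' else 0) + block_matrix Y t t' * g t')"
      using \<sigma> unfolding matop_def by (auto intro!: sum.cong simp: distrib_right)
    also have "\<dots> = real (card {s \<in> Y. t \<subseteq> s}) * g t + (\<Sum>t'\<in>dsets n d. block_matrix Y t t' * g t')"
      using \<sigma> by (simp add: sum.distrib)
    finally have *: "matop (dsets n d) (\<lambda>t t'. (if t = t' then real (card {s \<in> Y. t \<subseteq> s}) else 0) + block_matrix Y t t') g t
      = real (card {s \<in> Y. t \<subseteq> s}) * g t + (\<Sum>t'\<in>dsets n d. block_matrix Y t t' * g t')" .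
    show ?thesis using True \<sigma>
      by (simp add: upper_laplacian_def sum_neighbours cochain_of_signed_face face_degree_signed_face * sum_negf distrib_left)
  qed (simp add: upper_laplacian_def cochain_of_outside)
qed

end

section \<open>Spectral distributions under injective linear maps\<close>

lemma dim_image_linear:
  fixes \<Phi> :: "('b \<Rightarrow> real) \<Rightarrow> 'c \<Rightarrow> real"
  assumes add: "\<And>f g. \<Phi> (f + g) = \<Phi> f + \<Phi> g" and scale: "\<And>c f. \<Phi> (\<lambda>x. c * f x) = (\<lambda>x. c * \<Phi> f x)"
    and U: "fun_space.subspace U" "inj_on \<Phi> U" and S: "S \<subseteq> U"
  shows "fun_space.dim (\<Phi> ` S) = fun_space.dim S"
proof -
  interpret P: vector_space_pair "\<lambda>c f x. c * f x :: real" "\<lambda>c f x. c * f x :: real"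
    by unfold_locales
  have "Vector_Spaces.linear (\<lambda>(c::real) (f :: 'b \<Rightarrow> real) x. c * f x) (\<lambda>(c::real) (f :: 'c \<Rightarrow> real) x. c * f x) \<Phi>"
    by unfold_locales (use add scale in auto)
  note lin = this
  obtain B where B: "B \<subseteq> S" "fun_space.independent B" "S \<subseteq> fun_space.span B" "card B = fun_space.dim S"
    using fun_space.basis_exists by blast
  have "fun_space.span B \<subseteq> U" using B(1) S U(1) by (intro fun_space.span_minimal) auto
  then have inj: "inj_on \<Phi> (fun_space.span B)" using U(2) inj_on_subset by blast
  have "fun_space.span (\<Phi> ` B) = \<Phi> ` fun_space.span B" by (rule P.linear_span_image[OF lin])
  moreover have "fun_space.independent (\<Phi> ` B)"
    by (rule P.linear_independent_injective_image[OF lin B(2) inj])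
  moreover have "card (\<Phi> ` B) = card B"
    by (rule card_image) (rule inj_on_subset[OF inj fun_space.span_superset])
  ultimately show ?thesis using B by (intro fun_space.dim_unique[of "\<Phi> ` B"]) auto
qed

text \<open>The intertwining injection carries each eigenspace onto the corresponding one and
  preserves dimensions. This passes from cochains on oriented faces to functions on sets.\<close>

lemma esd_transfer:
  fixes \<Phi> :: "('b \<Rightarrow> real) \<Rightarrow> 'c \<Rightarrow> real"
  assumes add: "\<And>f g. \<Phi> (f + g) = \<Phi> f + \<Phi> g" and scale: "\<And>c f. \<Phi> (\<lambda>x. c * f x) = (\<lambda>x. c * \<Phi> f x)"
    and U: "fun_space.subspace U" "inj_on \<Phi> U" and V: "V = \<Phi> ` U"
    and T: "\<And>g. g \<in> U \<Longrightarrow> T' (\<Phi> g) = \<Phi> (T g)" "\<And>g. g \<in> U \<Longrightarrow> T g \<in> U"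
  shows "esd V T' = esd U T"
proof -
  have E: "eigenspace V T' c = \<Phi> ` eigenspace U T c" for c
  proof -
    have "T' (\<Phi> g) = (\<lambda>x. c * \<Phi> g x) \<longleftrightarrow> T g = (\<lambda>x. c * g x)" if g: "g \<in> U" for g
    proof -
      have "(\<lambda>x. c * g x) \<in> U" using fun_space.subspace_scale[OF U(1) g] .
      then show ?thesis
        using inj_on_eq_iff[OF U(2) T(2)[OF g]] by (simp add: T(1)[OF g] scale[symmetric])
    qed
    then show ?thesis by (auto simp: eigenspace_def V)
  qed
  have sub: "eigenspace U T c \<subseteq> U" for c by (auto simp: eigenspace_def)
  have z: "\<Phi> 0 = 0" using scale[of 0 0] by (simp add: zero_fun_def)
  have "\<Phi> f \<noteq> 0 \<longleftrightarrow> f \<noteq> 0" if "f \<in> U" for f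
    using inj_onD[OF U(2), of f 0] that fun_space.subspace_0[OF U(1)] z by auto
  then have "eigenvalues V T' = eigenvalues U T"
    using sub by (force simp: eigenvalues_def E)
  moreover have "fun_space.dim (eigenspace V T' c) = fun_space.dim (eigenspace U T c)" for c
    unfolding E by (rule dim_image_linear[OF add scale U sub])
  moreover have "fun_space.dim V = fun_space.dim U"
    unfolding V by (rule dim_image_linear[OF add scale U order_refl])
  ultimately show ?thesis by (simp add: esd_def)
qed

lemma subspace_fsupp: "fun_space.subspace (fsupp D)"
  unfolding fun_space.subspace_def fsupp_def by simp

lemma esd_cochains:
  assumes d: "1 \<le> d" and Y: "\<And>s. s \<in> Y \<Longrightarrow> s \<subseteq> {1..n} \<and> card s = d + 1"
    and T: "\<And>g. T (cochain_of (dsets n d) g) = cochain_of (dsets n d) (matop (dsets n d) M g)"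
  shows "esd (cochains (steiner_complex n d Y) (d - 1)) T = esd (fsupp (dsets n d)) (matop (dsets n d) M)"
proof -
  have inj: "inj_on (cochain_of (dsets n d)) (fsupp (dsets n d))"
  proof (rule inj_onI)
    fix f g assume f: "f \<in> fsupp (dsets n d)" and g: "g \<in> fsupp (dsets n d)"
      and eq: "cochain_of (dsets n d) f = cochain_of (dsets n d) g"
    show "f = g"
    proof
      fix t
      show "f t = g t"
      proof (cases "t \<in> dsets n d")
        case True
        have "cochain_of (dsets n d) f (signed_face t 1) = cochain_of (dsets n d) g (signed_face t 1)"
          by (simp add: eq)
        then show ?thesis by (simp add: cochain_of_signed_face[OF True])
      qed (use f g in \<open>simp add: fsupp_def\<close>)
    qed
  qed
  have V: "cochains (steiner_complex n d Y) (d - 1) = cochain_of (dsets n d) ` fsupp (dsets n d)"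
    by (rule cochains_eq[OF d Y])
  have mat: "matop (dsets n d) M g \<in> fsupp (dsets n d)" for g by (simp add: matop_def fsupp_def)
  have add: "cochain_of (dsets n d) (f + g) = cochain_of (dsets n d) f + cochain_of (dsets n d) g" for f g
    by (rule ext) (simp only: cochain_of_def plus_fun_apply distrib_right sum.distrib)
  have scale: "cochain_of (dsets n d) (\<lambda>x. c * f x) = (\<lambda>x. c * cochain_of (dsets n d) f x)" for c f
    by (rule ext) (simp only: cochain_of_def sum_distrib_left mult.assoc)
  show ?thesis
    by (rule esd_transfer[of "cochain_of (dsets n d)" "fsupp (dsets n d)" _ T "matop (dsets n d) M"])
      (rule add scale subspace_fsupp inj V T mat)+
qed

subsection \<open>Steiner systems\<close>

lemma finite_steiner_systems [simp]: "finite (steiner_systems n d)"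
  by (rule finite_subset[of _ "Pow (Pow {1..n})"]) (auto simp: steiner_systems_def)

lemma steiner_systemD:
  assumes "T \<in> steiner_systems n d" "s \<in> T"
  shows "s \<subseteq> {1..n}" "card s = d + 1" "finite s"
proof -
  have "s \<subseteq> {1..n} \<and> card s = d + 1" using assms unfolding steiner_systems_def by blast
  then show "s \<subseteq> {1..n}" "card s = d + 1" "finite s" using finite_subset[of s "{1..n}"] by simp_all
qed

definition cell :: "nat set set \<Rightarrow> nat set \<Rightarrow> nat set" where
  "cell T t = (THE s. s \<in> T \<and> t \<subseteq> s)"

lemma cell_ex1:
  assumes "T \<in> steiner_systems n d" "t \<in> dsets n d"
  shows "\<exists>!s. s \<in> T \<and> t \<subseteq> s"
proof -
  have "\<forall>t. t \<subseteq> {1..n} \<and> card t = d \<longrightarrow> (\<exists>!s. s \<in> T \<and> t \<subseteq> s)"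
    using assms(1) unfolding steiner_systems_def mem_Collect_eq by (rule conjunct2)
  from this[THEN spec, of t] show ?thesis
    using assms(2) unfolding dsets_def mem_Collect_eq by (rule mp)
qed

lemma cell_in:
  assumes "T \<in> steiner_systems n d" "t \<in> dsets n d"
  shows "cell T t \<in> T" "t \<subseteq> cell T t"
  using theI'[OF cell_ex1[OF assms]] by (auto simp: cell_def)

lemma cell_eq:
  assumes "T \<in> steiner_systems n d" "t \<in> dsets n d" "s \<in> T" "t \<subseteq> s"
  shows "cell T t = s"
  unfolding cell_def using the1_equality[OF cell_ex1[OF assms(1,2)]] assms(3,4) by blast

lemma dsets_remove:
  assumes "T \<in> steiner_systems n d" "s \<in> T" "t \<in> dsets n d" "t \<subseteq> s"
  obtains v where "s - t = {v}" "t = s - {v}"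
proof -
  have "card (s - t) = card s - card t"
    using assms finite_dsetsD by (intro card_Diff_subset) auto
  then have "card (s - t) = 1" using steiner_systemD(2)[OF assms(1,2)] assms(3) by (simp add: dsets_def)
  then obtain v where v: "s - t = {v}" by (rule card_1_singletonE)
  moreover have "t = s - {v}" using v assms(4) by blast
  ultimately show ?thesis by (rule that)
qed

text \<open>A step stays inside the unique cell over \<open>x\<close> and is determined by the
  vertex of \<open>x\<close> that it drops.\<close>

lemma card_steps_le:
  assumes T: "T \<in> steiner_systems n d" and x: "x \<in> dsets n d"
  shows "card {y \<in> dsets n d. x \<noteq> y \<and> x \<union> y \<in> T} \<le> d"
proof -
  have "{y \<in> dsets n d. x \<noteq> y \<and> x \<union> y \<in> T} \<subseteq> (\<lambda>u. cell T x - {u}) ` x"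
  proof
    fix y assume "y \<in> {y \<in> dsets n d. x \<noteq> y \<and> x \<union> y \<in> T}"
    then have y: "y \<in> dsets n d" "x \<noteq> y" "x \<union> y \<in> T" by auto
    have c: "cell T x = x \<union> y" by (rule cell_eq[OF T x y(3)]) blast
    obtain u where u: "x \<union> y - y = {u}" "y = x \<union> y - {u}"
      by (rule dsets_remove[OF T y(3,1)]) auto
    then have "u \<in> x" by blast
    then show "y \<in> (\<lambda>u. cell T x - {u}) ` x" using u(2) c by blast
  qed
  then have "card {y \<in> dsets n d. x \<noteq> y \<and> x \<union> y \<in> T} \<le> card ((\<lambda>u. cell T x - {u}) ` x)"
    using finite_dsetsD[OF x] by (intro card_mono) auto
  also have "\<dots> \<le> card x" by (rule card_image_le[OF finite_dsetsD[OF x]])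
  finally show ?thesis using x by (simp add: dsets_def)
qed

text \<open>The symmetry behind the switching in \<open>card_bad_le\<close>. Existence and
  uniqueness of cells are pulled back along \<open>inv p\<close>.\<close>

lemma steiner_systems_permute:
  assumes T: "T \<in> steiner_systems n d" and p: "p permutes {1..n}"
  shows "(`) p ` T \<in> steiner_systems n d"
proof -
  have inj: "inj p" using p by (rule permutes_inj)
  have 1: "s \<subseteq> {1..n} \<and> card s = d + 1" if s: "s \<in> (`) p ` T" for s
  proof -
    obtain s' where s': "s = p ` s'" "s' \<in> T" using s by blast
    have "p ` s' \<subseteq> p ` {1..n}" using steiner_systemD(1)[OF T s'(2)] by (rule image_mono)
    then show ?thesis using s' steiner_systemD(2)[OF T s'(2)] permutes_image[OF p]
      by (simp add: card_image[OF inj_on_subset[OF inj]])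
  qed
  have 2: "\<exists>!s. s \<in> (`) p ` T \<and> t \<subseteq> s" if t: "t \<subseteq> {1..n}" "card t = d" for t
  proof -
    let ?q = "inv p"
    have q: "?q permutes {1..n}" by (rule permutes_inv[OF p])
    have "?q ` t \<subseteq> ?q ` {1..n}" using t(1) by (rule image_mono)
    then have qt: "?q ` t \<in> dsets n d" using t permutes_image[OF q]
      by (simp add: dsets_def card_image[OF inj_on_subset[OF permutes_inj[OF q]]])
    define s where "s = cell T (?q ` t)"
    have s: "s \<in> T" "?q ` t \<subseteq> s" using cell_in[OF T qt] by (auto simp: s_def)
    have uni: "s' = s" if "s' \<in> T" "?q ` t \<subseteq> s'" for s'
      using cell_eq[OF T qt that] by (simp add: s_def)
    have sub: "t \<subseteq> p ` s' \<longleftrightarrow> ?q ` t \<subseteq> s'" for s'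
    proof -
      have "?q ` t \<subseteq> s' \<longleftrightarrow> p ` ?q ` t \<subseteq> p ` s'" by (rule inj_image_subset_iff[OF inj, symmetric])
      also have "p ` ?q ` t = t" by (simp add: image_comp permutes_inv_o[OF p])
      finally show ?thesis by simp
    qed
    show ?thesis
    proof (rule ex1I[of _ "p ` s"])
      show "p ` s \<in> (`) p ` T \<and> t \<subseteq> p ` s" using s sub by blast
      fix r assume r: "r \<in> (`) p ` T \<and> t \<subseteq> r"
      then obtain s' where s': "r = p ` s'" "s' \<in> T" by blast
      then have "s' = s" using r sub[of s'] uni by simp
      then show "r = p ` s" using s' by simp
    qed
  qed
  show ?thesis unfolding steiner_systems_def mem_Collect_eq
  proof (intro conjI ballI allI impI)
    fix s assume "s \<in> (`) p ` T"
    from 1[OF this] show "s \<subseteq> {1..n}" "card s = d + 1" by simp_all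
  next
    fix t assume "t \<subseteq> {1..n} \<and> card t = d"
    then show "\<exists>!s. s \<in> (`) p ` T \<and> t \<subseteq> s" by (intro 2) simp_all
  qed
qed

subsection \<open>Closed walks\<close>

definition steiner_tuples :: "nat \<Rightarrow> nat \<Rightarrow> nat \<Rightarrow> (nat \<Rightarrow> nat set set) set" where
  "steiner_tuples n d k = (\<Pi>\<^sub>E j\<in>{1..k}. steiner_systems n d)"

text \<open>Words and walks are listed backwards: the last step and the endpoint come first.\<close>

fun is_walk :: "nat set set \<Rightarrow> (nat \<Rightarrow> nat set set) \<Rightarrow> nat list \<Rightarrow> nat set list \<Rightarrow> bool" where
  "is_walk V S [] [x] = (x \<in> V)"
| "is_walk V S (j # js) (y # x # hs) = (y \<in> V \<and> x \<noteq> y \<and> x \<union> y \<in> S j \<and> is_walk V S js (x # hs))"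
| "is_walk V S _ _ = False"

text \<open>Every face brings a vertex contained in no earlier face. For the starting face this only
  says that it is nonempty, which holds on \<open>dsets n d\<close> for d >= 1.\<close>

fun is_fresh :: "nat set list \<Rightarrow> bool" where
  "is_fresh [] = True"
| "is_fresh (y # hs) = (is_fresh hs \<and> \<not> y \<subseteq> \<Union>(set hs))"

definition walks :: "nat \<Rightarrow> nat \<Rightarrow> nat \<Rightarrow> nat list \<Rightarrow> ((nat \<Rightarrow> nat set set) \<times> nat set list) set" where
  "walks n d k js = {(S, hs). S \<in> steiner_tuples n d k \<and> is_walk (dsets n d) S js hs}"

lemma finite_steiner_tuples [simp]: "finite (steiner_tuples n d k)"
  by (simp add: steiner_tuples_def finite_PiE)

lemma is_walkD:
  "is_walk V S js hs \<Longrightarrow> length hs = Suc (length js) \<and> set hs \<subseteq> V"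
  by (induction V S js hs rule: is_walk.induct) auto

lemma is_walk_ConsE:
  assumes "is_walk V S (j # js) hs"
  obtains y x gs where "hs = y # x # gs"
proof (cases hs)
  case Nil
  then show ?thesis using assms by simp
next
  case (Cons y t)
  then show ?thesis using assms that by (cases t) simp_all
qed

lemma is_walk_NilE:
  assumes "is_walk V S [] hs"
  obtains x where "hs = [x]" "x \<in> V"
proof (cases hs)
  case Nil
  then show ?thesis using assms by simp
next
  case (Cons y t)
  then show ?thesis using assms that by (cases t) simp_all
qed

lemma finite_walks [simp]: "finite (walks n d k js)"
proof (rule finite_subset)
  show "walks n d k js \<subseteq> steiner_tuples n d k \<times> {hs. set hs \<subseteq> dsets n d \<and> length hs = Suc (length js)}"
    using is_walkD by (force simp: walks_def)
qed (simp add: finite_lists_length_eq)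

section \<open>Counting walks by extension and by switching\<close>

lemma card_fibres_le:
  assumes "finite A" "finite B" "f ` A \<subseteq> B" "\<And>b. b \<in> B \<Longrightarrow> card {a \<in> A. f a = b} \<le> m"
  shows "card A \<le> m * card B"
proof -
  have "card A = (\<Sum>b\<in>f ` A. card {a \<in> A. f a = b})"
    using sum.image_gen[OF assms(1), of "\<lambda>_. 1::nat" f] by simp
  also have "\<dots> \<le> (\<Sum>b\<in>B. card {a \<in> A. f a = b})"
    by (rule sum_mono2) (use assms in auto)
  also have "\<dots> \<le> (\<Sum>b\<in>B. m)" by (rule sum_mono) (use assms in auto)
  finally show ?thesis by (simp add: mult.commute)
qed

context
  fixes n d k :: nat
  assumes d: "1 \<le> d"
begin

lemma steiner_tupleD: "S \<in> steiner_tuples n d k \<Longrightarrow> j \<in> {1..k} \<Longrightarrow> S j \<in> steiner_systems n d"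
  unfolding steiner_tuples_def by (rule PiE_mem)

text \<open>The systems are part of the counted pair, so extending a walk leaves only the new face
  to choose, in at most \<open>d\<close> ways.\<close>

lemma card_extend_walks_le:
  assumes j: "j \<in> {1..k}" and A: "A \<subseteq> walks n d k js"
  shows "card {(S, hs) \<in> walks n d k (j # js). (S, tl hs) \<in> A} \<le> d * card A"
proof (rule card_fibres_le[where f = "\<lambda>(S, hs). (S, tl hs)"])
  show "finite {(S, hs) \<in> walks n d k (j # js). (S, tl hs) \<in> A}"
    by (rule finite_subset[of _ "walks n d k (j # js)"]) auto
  show "finite A" by (rule finite_subset[OF A finite_walks])
  fix b assume b: "b \<in> A"
  obtain S gs where bb: "b = (S, gs)" by (cases b)
  then have "(S, gs) \<in> walks n d k js" using b A by blast
  then have S: "S \<in> steiner_tuples n d k" and w: "is_walk (dsets n d) S js gs" by (auto simp: walks_def)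
  then obtain x hs where gs: "gs = x # hs" by (cases gs) auto
  have x: "x \<in> dsets n d" using is_walkD[OF w] gs by auto
  have "{a \<in> {(S, hs) \<in> walks n d k (j # js). (S, tl hs) \<in> A}. (case a of (S, hs) \<Rightarrow> (S, tl hs)) = b}
    \<subseteq> (\<lambda>y. (S, y # gs)) ` {y \<in> dsets n d. x \<noteq> y \<and> x \<union> y \<in> S j}"
  proof
    fix a assume a: "a \<in> {a \<in> {(S, hs) \<in> walks n d k (j # js). (S, tl hs) \<in> A}. (case a of (S, hs) \<Rightarrow> (S, tl hs)) = b}"
    obtain S' hs' where aa: "a = (S', hs')" by (cases a)
    have "S' = S" "tl hs' = gs" "is_walk (dsets n d) S (j # js) hs'" using a aa bb by (auto simp: walks_def)
    moreover from this obtain y where "hs' = y # gs" by (cases hs') auto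
    ultimately show "a \<in> (\<lambda>y. (S, y # gs)) ` {y \<in> dsets n d. x \<noteq> y \<and> x \<union> y \<in> S j}"
      using aa gs by auto
  qed
  then have "card {a \<in> {(S, hs) \<in> walks n d k (j # js). (S, tl hs) \<in> A}. (case a of (S, hs) \<Rightarrow> (S, tl hs)) = b}
    \<le> card {y \<in> dsets n d. x \<noteq> y \<and> x \<union> y \<in> S j}"
    by (intro surj_card_le) auto
  also have "\<dots> \<le> d" by (rule card_steps_le[OF steiner_tupleD[OF S j] x])
  finally show "card {a \<in> {(S, hs) \<in> walks n d k (j # js). (S, tl hs) \<in> A}. (case a of (S, hs) \<Rightarrow> (S, tl hs)) = b} \<le> d" .
qed auto

lemma walks_tl:
  assumes "(S, hs) \<in> walks n d k (j # js)"
  shows "(S, tl hs) \<in> walks n d k js"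
proof -
  have w: "is_walk (dsets n d) S (j # js) hs" using assms by (simp add: walks_def)
  then obtain y x gs where "hs = y # x # gs" by (rule is_walk_ConsE)
  then show ?thesis using w assms by (simp add: walks_def)
qed

lemma card_walks_le:
  assumes "set js \<subseteq> {1..k}"
  shows "card (walks n d k js) \<le> d ^ length js * (card (steiner_tuples n d k) * card (dsets n d))"
  using assms
proof (induction js)
  case Nil
  have "walks n d k [] \<subseteq> (\<lambda>(S, x). (S, [x])) ` (steiner_tuples n d k \<times> dsets n d)"
    by (auto simp: walks_def elim!: is_walk_NilE)
  then have "card (walks n d k []) \<le> card (steiner_tuples n d k \<times> dsets n d)"
    by (intro surj_card_le) auto
  then show ?case by (simp add: card_cartesian_product)
next
  case (Cons j js)
  have "walks n d k (j # js) = {(S, hs) \<in> walks n d k (j # js). (S, tl hs) \<in> walks n d k js}"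
    using walks_tl by blast
  then have "card (walks n d k (j # js)) \<le> d * card (walks n d k js)"
    using card_extend_walks_le[of j "walks n d k js" js] Cons.prems by simp
  also have "\<dots> \<le> d * (d ^ length js * (card (steiner_tuples n d k) * card (dsets n d)))"
    using Cons by (intro mult_left_mono) auto
  finally show ?case by (simp add: mult.assoc)
qed

lemma card_Union_le:
  assumes "set hs \<subseteq> dsets n d"
  shows "finite (\<Union>(set hs)) \<and> card (\<Union>(set hs)) \<le> d * length hs"
  using assms
proof (induction hs)
  case (Cons x hs)
  then have "card (x \<union> \<Union>(set hs)) \<le> card x + card (\<Union>(set hs))" by (intro card_Un_le)
  then show ?case using Cons finite_dsetsD[of x n d] by (auto simp: dsets_def)
qed simp

text \<open>A permutation fixing all vertices of the walk maps each of its cells to itself, so these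
  cells survive in the relabelled system.\<close>

lemma is_walk_permute:
  assumes "is_walk V S js hs" "\<And>a. a \<in> \<Union>(set hs) \<Longrightarrow> p a = a"
  shows "is_walk V (S(j := (`) p ` S j)) js hs"
  using assms
proof (induction V S js hs rule: is_walk.induct)
  case (2 V S i js y x hs)
  have "p ` (x \<union> y) = x \<union> y" using 2(3) by (force simp: image_iff)
  then have "x \<union> y \<in> (S(j := (`) p ` S j)) i" using 2(2) by (cases "i = j") (auto intro: rev_image_eqI[of "x \<union> y"])
  then show ?case using 2 by auto
qed auto

text \<open>The walks in \<open>bad\<close> are fresh, but their next cell, taken in the system \<open>j\<close>, contains
  no new vertex. The newest vertex \<open>v\<close> comes from the system \<open>j'\<close>; swapping it with any other
  vertex \<open>y\<close> in the system \<open>j'\<close> yields a walk again, and \<open>v\<close> is recovered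
  from \<open>y\<close> and the next vertex \<open>w\<close> by means of the system \<open>j\<close>.\<close>

lemma card_bad_le:
  assumes j: "j \<in> {1..k}" "j' \<in> {1..k}" "j \<noteq> j'" and L: "length js < L"
  defines "bad \<equiv> {(S, hs) \<in> walks n d k (j' # js). is_fresh hs \<and> cell (S j) (hd hs) \<subseteq> \<Union>(set hs)}"
  shows "card bad * (n - d * L) \<le> d * L * card (walks n d k (j' # js))"
proof -
  \<comment> \<open>\<open>W\<close> collects the vertices before the last step, \<open>v\<close> is
    the vertex that this step adds, and \<open>w\<close> is the vertex that completes the next cell,
    in the system \<open>j\<close>.\<close>
  define W :: "(nat \<Rightarrow> nat set set) \<times> nat set list \<Rightarrow> nat set" where "W = (\<lambda>(S, hs). \<Union>(set (tl hs)))"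
  define v where "v = (\<lambda>(S :: nat \<Rightarrow> nat set set, hs :: nat set list). the_elem (hd hs - \<Union>(set (tl hs))))"
  define w where "w = (\<lambda>(S :: nat \<Rightarrow> nat set set, hs :: nat set list). the_elem (cell (S j) (hd hs) - hd hs))"
  \<comment> \<open>The switching: \<open>v\<close> and \<open>y\<close> are exchanged in the system
    \<open>j'\<close> and in the last face. The value \<open>w p\<close> is kept as the extra
    information needed to undo this.\<close>
  define \<Psi> where "\<Psi> = (\<lambda>(p, y). ((\<lambda>(S, hs). (S(j' := (`) (Transposition.transpose (v p) y) ` S j'),
      insert y (hd hs - {v p}) # tl hs)) p, w p))"
  have Wc: "finite (W p) \<and> card (W p) \<le> d * L \<and> W p \<subseteq> {1..n}" if "p \<in> walks n d k (j' # js)" for p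
  proof -
    obtain S hs where p: "p = (S, hs)" by (cases p)
    have "(S, tl hs) \<in> walks n d k js" using walks_tl that p by blast
    then have hs: "length (tl hs) = Suc (length js)" "set (tl hs) \<subseteq> dsets n d"
      using is_walkD by (force simp: walks_def)+
    have "card (W p) \<le> d * Suc (length js)" "finite (W p)"
      using card_Union_le[OF hs(2)] hs(1) by (auto simp: W_def p)
    moreover have "d * Suc (length js) \<le> d * L" using L by (intro mult_left_mono) auto
    moreover have "W p \<subseteq> {1..n}" using hs(2) by (force simp: W_def p dsets_def)
    ultimately show ?thesis by auto
  qed
  \<comment> \<open>The last step adds exactly one vertex, because \<open>z \<union> x\<close>
    exceeds \<open>z\<close> by one; badness says that \<open>w\<close> is old.\<close>
  have key: "\<exists>x hs. gs = x # hs \<and> S \<in> steiner_tuples n d k \<and> is_walk (dsets n d) S js hs \<and> x \<in> dsets n d \<and>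
      hs \<noteq> [] \<and> hd hs \<noteq> x \<and> hd hs \<union> x \<in> S j' \<and> v (S, gs) \<in> {1..n} \<and>
      W (S, gs) = \<Union>(set hs) \<and> x - W (S, gs) = {v (S, gs)} \<and> cell (S j) x = insert (w (S, gs)) x \<and>
      w (S, gs) \<in> W (S, gs) \<and> w (S, gs) \<notin> x"
    if "(S, gs) \<in> bad" for S gs
  proof -
    have S: "S \<in> steiner_tuples n d k" and wk: "is_walk (dsets n d) S (j' # js) gs"
      and fr: "is_fresh gs" and cell: "cell (S j) (hd gs) \<subseteq> \<Union>(set gs)"
      using that by (auto simp: bad_def walks_def)
    obtain x z hs where gs: "gs = x # z # hs" using wk by (rule is_walk_ConsE)
    have x: "x \<in> dsets n d" "z \<noteq> x" "z \<union> x \<in> S j'" "is_walk (dsets n d) S js (z # hs)"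
      using wk gs by auto
    have z: "z \<in> dsets n d" using is_walkD[OF x(4)] by auto
    have W: "W (S, gs) = \<Union>(set (z # hs))" by (simp add: W_def gs)
    obtain u where u: "z \<union> x - z = {u}" by (rule dsets_remove[OF steiner_tupleD[OF S j(2)] x(3) z]) auto
    have "x - W (S, gs) \<subseteq> {u}" using u W by auto
    moreover have "x - W (S, gs) \<noteq> {}" using fr gs W by auto
    ultimately have xu: "x - W (S, gs) = {u}" by blast
    then have v: "v (S, gs) = u" using W by (simp add: v_def gs)
    have C: "cell (S j) x \<in> S j" "x \<subseteq> cell (S j) x" using cell_in[OF steiner_tupleD[OF S j(1)] x(1)] by auto
    obtain u' where u': "cell (S j) x - x = {u'}" by (rule dsets_remove[OF steiner_tupleD[OF S j(1)] C(1) x(1) C(2)])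
    then have w: "w (S, gs) = u'" by (simp add: w_def gs)
    have "u' \<in> W (S, gs)" using cell u' W gs by auto
    moreover have "u \<in> {1..n}" using xu x(1) by (auto simp: dsets_def)
    moreover have "cell (S j) x = insert u' x" "u' \<notin> x" using u' C(2) by blast+
    ultimately show ?thesis
      using S x W xu unfolding v w
      by (intro exI[of _ x] exI[of _ "z # hs"] conjI) (simp_all only: gs list.sel not_False_eq_True list.distinct)
  qed
  have bad: "bad \<subseteq> walks n d k (j' # js)" by (auto simp: bad_def)
  have finb: "finite bad" by (rule finite_subset[OF bad finite_walks])
  have inj: "inj_on \<Psi> (SIGMA p:bad. {1..n} - W p)"
  proof (rule inj_onI)
    fix a b assume a: "a \<in> (SIGMA p:bad. {1..n} - W p)" and b: "b \<in> (SIGMA p:bad. {1..n} - W p)"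
      and eq: "\<Psi> a = \<Psi> b"
    obtain S gs y where a': "a = ((S, gs), y)" by (metis surj_pair)
    obtain S' gs' y' where b': "b = ((S', gs'), y')" by (metis surj_pair)
    have ab: "(S, gs) \<in> bad" "y \<notin> W (S, gs)" "(S', gs') \<in> bad" "y' \<notin> W (S', gs')"
      using a b a' b' by auto
    obtain x hs where k1: "gs = x # hs" "S \<in> steiner_tuples n d k"
      "W (S, gs) = \<Union>(set hs)" "x - W (S, gs) = {v (S, gs)}" "cell (S j) x = insert (w (S, gs)) x"
      "w (S, gs) \<in> W (S, gs)" "w (S, gs) \<notin> x" "x \<in> dsets n d" using key[OF ab(1)] by blast
    obtain x' hs' where k2: "gs' = x' # hs'" "S' \<in> steiner_tuples n d k"
      "W (S', gs') = \<Union>(set hs')" "x' - W (S', gs') = {v (S', gs')}" "cell (S' j) x' = insert (w (S', gs')) x'"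
      "w (S', gs') \<in> W (S', gs')" "w (S', gs') \<notin> x'" "x' \<in> dsets n d" using key[OF ab(3)] by blast
    define v1 v2 where vd: "v1 = v (S, gs)" "v2 = v (S', gs')"
    define w0 where "w0 = w (S, gs)"
    have e: "S(j' := (`) (Transposition.transpose v1 y) ` S j') = S'(j' := (`) (Transposition.transpose v2 y') ` S' j')"
      "insert y (x - {v1}) = insert y' (x' - {v2})" "hs = hs'" "w (S', gs') = w0"
    proof -
      note eq[unfolded a' b' \<Psi>_def case_prod_conv prod.inject k1(1) k2(1) list.sel list.inject]
      then show "S(j' := (`) (Transposition.transpose v1 y) ` S j') = S'(j' := (`) (Transposition.transpose v2 y') ` S' j')"
        "insert y (x - {v1}) = insert y' (x' - {v2})" "hs = hs'" "w (S', gs') = w0"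
        unfolding vd w0_def k1(1) k2(1) by - (elim conjE, (assumption | erule sym))+
    qed
    define V where "V = \<Union>(set hs)"
    have VV: "W (S, gs) = V" "W (S', gs') = V" using k1(3) k2(3) e(3) by (auto simp: V_def)
    have x1: "x - V = {v1}" and x2: "x' - V = {v2}" using k1(4) k2(4) by (auto simp: VV vd)
    have yV: "y \<notin> V" "y' \<notin> V" using ab by (auto simp: VV)
    have wV: "w0 \<in> V" using k1(6) by (simp add: VV w0_def)
    \<comment> \<open>\<open>y\<close> is the only vertex of the switched face outside
      \<open>V\<close>, so both \<open>y\<close> and \<open>x - {v1}\<close> can be read off from
      the image.\<close>
    have "insert y (x - {v1}) - V = {y}" using x1 yV by blast
    moreover have "insert y' (x' - {v2}) - V = {y'}" using x2 yV by blast
    ultimately have y: "y = y'" using e(2) by auto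
    have "insert y (x - {v1}) - {y} = x - {v1}" using x1 yV by blast
    moreover have "insert y' (x' - {v2}) - {y'} = x' - {v2}" using x2 yV by blast
    ultimately have \<rho>: "x - {v1} = x' - {v2}" by (metis e(2) y)
    \<comment> \<open>The switching leaves the system \<open>j\<close> alone because
      \<open>j \<noteq> j'\<close>; this is the use of the condition on adjacent letters.\<close>
    have Sj: "S j = S' j" using fun_cong[OF e(1), of j] j(3) by simp
    have T: "S j \<in> steiner_systems n d" by (rule steiner_tupleD[OF k1(2) j(1)])
    \<comment> \<open>A set of size \<open>d\<close> that is known from the image and is contained
      in the next cells of both walks. Uniqueness of cells in the system \<open>j\<close> then
      identifies the two faces.\<close>
    let ?t = "insert w0 (x - {v1})"
    have w0x: "w0 \<notin> x" "w0 \<notin> x'" using k1(7) k2(7) e(4) by (auto simp: w0_def)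
    have "v1 \<in> x" "w0 \<noteq> v1" using x1 wV by auto
    have C1: "cell (S j) x \<in> S j" by (rule cell_in(1)[OF T k1(8)])
    have C2: "cell (S j) x' \<in> S j" by (rule cell_in(1)[OF T k2(8)])
    have t: "?t \<in> dsets n d"
    proof -
      have "card ?t = d" using w0x(1) \<open>v1 \<in> x\<close> k1(8) finite_dsetsD[OF k1(8)] d
        by (simp add: dsets_def)
      moreover have "?t \<subseteq> {1..n}"
        using steiner_systemD(1)[OF T C1] k1(5) by (auto simp: w0_def)
      ultimately show ?thesis by (simp add: dsets_def)
    qed
    have "cell (S j) ?t = cell (S j) x" by (rule cell_eq[OF T t C1]) (use k1(5) in \<open>auto simp: w0_def\<close>)
    moreover have "cell (S j) ?t = cell (S j) x'" by (rule cell_eq[OF T t C2]) (use k2(5) e(4) Sj \<rho> in auto)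
    ultimately have "insert w0 x = insert w0 x'" using k1(5) k2(5) Sj e(4) by (simp add: w0_def)
    then have xx: "x = x'" using insert_ident[OF w0x] by simp
    have v12: "v1 = v2" using x1 x2 xx by simp
    have "S i = S' i" for i
    proof (cases "i = j'")
      case True
      have inv: "(`) (Transposition.transpose v1 y) ` (`) (Transposition.transpose v1 y) ` A = A" for A :: "nat set set"
        by (simp add: image_comp comp_def)
      have "(`) (Transposition.transpose v1 y) ` S j' = (`) (Transposition.transpose v1 y) ` S' j'"
        using fun_cong[OF e(1), of j'] v12 y by simp
      then show ?thesis using inv True by metis
    next
      case False
      then show ?thesis using fun_cong[OF e(1), of i] by simp
    qed
    then show "a = b" using a' b' k1(1) k2(1) xx e(3) y by auto
  qed
  have sub: "\<Psi> ` (SIGMA p:bad. {1..n} - W p) \<subseteq> (SIGMA p:walks n d k (j' # js). W p)"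
  proof (rule image_subsetI)
    fix a assume a: "a \<in> (SIGMA p:bad. {1..n} - W p)"
    obtain S gs y where a': "a = ((S, gs), y)" by (metis surj_pair)
    have ab: "(S, gs) \<in> bad" "y \<in> {1..n}" "y \<notin> W (S, gs)" using a a' by auto
    obtain x hs where k1: "gs = x # hs" "S \<in> steiner_tuples n d k" "is_walk (dsets n d) S js hs" "x \<in> dsets n d"
      "hs \<noteq> []" "hd hs \<noteq> x" "hd hs \<union> x \<in> S j'" "v (S, gs) \<in> {1..n}"
      "W (S, gs) = \<Union>(set hs)" "x - W (S, gs) = {v (S, gs)}" "w (S, gs) \<in> W (S, gs)" using key[OF ab(1)] by blast
    define v1 where "v1 = v (S, gs)"
    define p where "p = Transposition.transpose v1 y"
    define x' where "x' = insert y (x - {v1})"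
    define S' where "S' = S(j' := (`) p ` S j')"
    obtain z hs' where z: "hs = z # hs'" using k1(5) by (cases hs) auto
    have pp: "p permutes {1..n}" unfolding p_def using k1(8) ab(2) by (intro permutes_swap_id) (auto simp: v1_def)
    have fix_p: "p b = b" if "b \<in> \<Union>(set hs)" for b
      using that ab(3) k1(9,10) by (auto simp: p_def v1_def Transposition.transpose_def)
    have v1x: "v1 \<in> x" "v1 \<notin> \<Union>(set hs)" using k1(9,10) by (auto simp: v1_def)
    \<comment> \<open>The choice \<open>y = v1\<close> is allowed; the switching is then
      trivial.\<close>
    have xy: "y \<in> x \<Longrightarrow> y = v1" using k1(9,10) ab(3) by (auto simp: v1_def)
    have px: "p ` x = x'"
    proof -
      have "p b = b" if "b \<in> x - {v1}" for b using that xy by (auto simp: p_def Transposition.transpose_def)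
      then have "p ` (x - {v1}) = x - {v1}" by (force simp: image_iff)
      moreover have "x = insert v1 (x - {v1})" using v1x by auto
      ultimately have "p ` x = insert (p v1) (x - {v1})" by (metis image_insert)
      then show ?thesis by (simp add: x'_def p_def)
    qed
    have pz: "p ` z = z" using fix_p z by (force simp: image_iff)
    have S': "S' \<in> steiner_tuples n d k"
      using steiner_systems_permute[OF steiner_tupleD[OF k1(2) j(2)] pp] k1(2) j(2)
      unfolding S'_def steiner_tuples_def by (auto simp: PiE_iff extensional_def)
    have x': "x' \<in> dsets n d"
    proof -
      have "card x' = d" using k1(4) card_image[OF inj_on_subset[OF permutes_inj[OF pp]], of x] px
        by (simp add: dsets_def)
      moreover have "x' \<subseteq> {1..n}" using k1(4) ab(2) by (auto simp: x'_def dsets_def)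
      ultimately show ?thesis by (simp add: dsets_def)
    qed
    have "z \<noteq> x'" using ab(3) k1(9) z by (auto simp: x'_def)
    moreover have "z \<union> x' \<in> S' j'"
      using k1(7) z px pz by (auto simp: S'_def image_Un[symmetric] intro!: rev_image_eqI[of "z \<union> x"])
    moreover have "is_walk (dsets n d) S' js hs" unfolding S'_def
      by (rule is_walk_permute[OF k1(3) fix_p])
    ultimately have "(S', x' # hs) \<in> walks n d k (j' # js)" using S' x' z by (simp add: walks_def)
    moreover have "\<Psi> a = ((S', x' # hs), w (S, gs))"
      unfolding a' \<Psi>_def by (simp add: k1(1) S'_def x'_def p_def v1_def)
    moreover have "w (S, gs) \<in> W (S', x' # hs)" using k1(9,11) by (simp add: W_def)
    ultimately show "\<Psi> a \<in> (SIGMA p:walks n d k (j' # js). W p)" by simp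
  qed
  \<comment> \<open>Double count: each bad walk has at least \<open>n - d * L\<close> choices of
    \<open>y\<close>, and each walk in the image carries at most \<open>d * L\<close> values of
    \<open>w\<close>.\<close>
  have "card bad * (n - d * L) = (\<Sum>p\<in>bad. n - d * L)" by simp
  also have "\<dots> \<le> (\<Sum>p\<in>bad. card ({1..n} - W p))"
  proof (rule sum_mono)
    fix p assume "p \<in> bad"
    then have "finite (W p)" "card (W p) \<le> d * L" "W p \<subseteq> {1..n}" using Wc bad by blast+
    then show "n - d * L \<le> card ({1..n} - W p)" by (subst card_Diff_subset) auto
  qed
  also have "\<dots> = card (SIGMA p:bad. {1..n} - W p)" using finb by simp
  also have "\<dots> \<le> card (SIGMA p:walks n d k (j' # js). W p)"
    using card_mono[OF _ sub] card_image[OF inj] Wc by (metis finite_SigmaI finite_walks)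
  also have "\<dots> = (\<Sum>p\<in>walks n d k (j' # js). card (W p))" using Wc by (intro card_SigmaI) auto
  also have "\<dots> \<le> (\<Sum>p\<in>walks n d k (j' # js). d * L)" by (rule sum_mono) (use Wc in blast)
  finally show ?thesis by (simp add: mult.commute)
qed

text \<open>The first step that adds no vertex is charged to a bad cell: the cell over the old face
  is the union with the new one, so it adds no vertex either. Keeping \<open>L\<close> fixed in the
  induction gives the same error factor at every step.\<close>

lemma card_not_fresh_le:
  assumes "set js \<subseteq> {1..k}" "distinct_adj js" "length js \<le> L" "d * L < n"
  shows "real (card {(S, hs) \<in> walks n d k js. \<not> is_fresh hs}) \<le>
    real (length js) * real d ^ length js * (real (d * L) / real (n - d * L)) *
      (real (card (steiner_tuples n d k)) * real (card (dsets n d)))"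
  using assms(1,2,3)
proof (induction js)
  case Nil
  have "{(S, hs) \<in> walks n d k []. \<not> is_fresh hs} = {}"
    using d by (auto simp: walks_def dsets_def elim!: is_walk_NilE)
  then show ?case by (simp only: card.empty) simp
next
  case (Cons j js)
  let ?N = "real (card (steiner_tuples n d k)) * real (card (dsets n d))"
  let ?\<delta> = "real (d * L) / real (n - d * L)"
  let ?NF = "\<lambda>js. {(S, hs) \<in> walks n d k js. \<not> is_fresh hs}"
  let ?E = "\<lambda>A. {(S, hs) \<in> walks n d k (j # js). (S, tl hs) \<in> A}"
  define bad where "bad = {(S, hs) \<in> walks n d k js. is_fresh hs \<and> cell (S j) (hd hs) \<subseteq> \<Union>(set hs)}"
  have j: "j \<in> {1..k}" using Cons.prems by simp
  have bad_le: "real (card bad) \<le> real d ^ length js * ?\<delta> * ?N"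
  proof (cases js)
    case Nil
    \<comment> \<open>Here there is no earlier step to switch, but a cell with d + 1 vertices does
      not fit into a single face.\<close>
    have "bad = {}"
    proof -
      have False if "(S, hs) \<in> bad" for S hs
      proof -
        have S: "S \<in> steiner_tuples n d k" and "is_walk (dsets n d) S [] hs" "cell (S j) (hd hs) \<subseteq> \<Union>(set hs)"
          using that by (auto simp: bad_def walks_def Nil)
        then obtain x where x: "x \<in> dsets n d" "cell (S j) x \<subseteq> x" by (auto elim!: is_walk_NilE)
        have "card (cell (S j) x) = d + 1"
          using steiner_systemD(2) cell_in(1) steiner_tupleD[OF S j] x(1) by blast
        moreover have "card (cell (S j) x) \<le> card x" by (rule card_mono[OF finite_dsetsD[OF x(1)] x(2)])
        ultimately show False using x(1) by (simp add: dsets_def)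
      qed
      then show ?thesis by auto
    qed
    then show ?thesis by simp
  next
    case (Cons j' js')
    have "j \<noteq> j'" "j' \<in> {1..k}" "length js' < L"
      using Cons.prems Cons by simp_all
    from card_bad_le[OF j this(2,1,3)] have "card bad * (n - d * L) \<le> d * L * card (walks n d k js)"
      by (simp add: bad_def Cons)
    then have "real (card bad) * real (n - d * L) \<le> real (d * L) * real (card (walks n d k js))"
      by (metis of_nat_le_iff of_nat_mult)
    then have "real (card bad) \<le> real (d * L) * real (card (walks n d k js)) / real (n - d * L)"
      using assms(4) by (simp only: pos_le_divide_eq zero_less_diff of_nat_0_less_iff)
    then have "real (card bad) \<le> ?\<delta> * real (card (walks n d k js))" by simp
    also have "\<dots> \<le> ?\<delta> * real (d ^ length js * (card (steiner_tuples n d k) * card (dsets n d)))"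
      using Cons.prems(1) by (intro mult_left_mono of_nat_mono card_walks_le) auto
    finally show ?thesis by (simp add: mult_ac)
  qed
  have "?NF (j # js) \<subseteq> ?E (?NF js) \<union> ?E bad"
  proof
    fix a assume a: "a \<in> ?NF (j # js)"
    obtain S hs where aa: "a = (S, hs)" by (cases a)
    have w: "(S, hs) \<in> walks n d k (j # js)" "\<not> is_fresh hs" using a aa by auto
    have "is_walk (dsets n d) S (j # js) hs" using w by (simp add: walks_def)
    then obtain y x gs where hs: "hs = y # x # gs" by (rule is_walk_ConsE)
    have tl: "(S, x # gs) \<in> walks n d k js" using walks_tl[OF w(1)] hs by simp
    have S: "S \<in> steiner_tuples n d k" and xy: "x \<union> y \<in> S j" and x: "x \<in> dsets n d"
      using w(1) tl is_walkD by (fastforce simp: walks_def hs)+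
    have "cell (S j) x = x \<union> y" by (rule cell_eq[OF steiner_tupleD[OF S j] x xy]) blast
    then show "a \<in> ?E (?NF js) \<union> ?E bad" using w tl by (auto simp: aa hs bad_def)
  qed
  then have "card (?NF (j # js)) \<le> card (?E (?NF js) \<union> ?E bad)"
    by (intro card_mono finite_subset[OF _ finite_walks[of n d k "j # js"]]) auto
  also have "\<dots> \<le> card (?E (?NF js)) + card (?E bad)" by (rule card_Un_le)
  also have "\<dots> \<le> d * card (?NF js) + d * card bad"
    by (intro add_mono card_extend_walks_le j) (auto simp: bad_def)
  finally have "card (?NF (j # js)) \<le> d * card (?NF js) + d * card bad" .
  then have "real (card (?NF (j # js))) \<le> real (d * card (?NF js) + d * card bad)" by (rule of_nat_mono)
  also have "\<dots> = real d * real (card (?NF js)) + real d * real (card bad)" by simp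
  also have "\<dots> \<le> real d * (real (length js) * real d ^ length js * ?\<delta> * ?N) + real d * (real d ^ length js * ?\<delta> * ?N)"
    using Cons.IH Cons.prems bad_le by (intro add_mono mult_left_mono) (auto simp: distinct_adj_Cons)
  finally show ?case by (simp add: algebra_simps)
qed

text \<open>The last face of a nontrivial closed walk has occurred before, so it adds no
  vertex.\<close>

lemma card_closed_walks_le:
  assumes "set js \<subseteq> {1..k}" "distinct_adj js" "js \<noteq> []" "d * length js < n"
  shows "real (card {(S, hs) \<in> walks n d k js. hd hs = last hs}) \<le>
    real (length js) * real d ^ length js * (real (d * length js) / real (n - d * length js)) *
      (real (card (steiner_tuples n d k)) * real (card (dsets n d)))"
proof -
  have "{(S, hs) \<in> walks n d k js. hd hs = last hs} \<subseteq> {(S, hs) \<in> walks n d k js. \<not> is_fresh hs}"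
  proof clarify
    fix S hs assume w: "(S, hs) \<in> walks n d k js" and eq: "hd hs = last hs" and fr: "is_fresh hs"
    obtain j js' where js: "js = j # js'" using assms(3) by (cases js) auto
    then have "is_walk (dsets n d) S (j # js') hs" using w by (simp add: walks_def)
    then obtain y x gs where hs: "hs = y # x # gs" by (rule is_walk_ConsE)
    have "y \<in> set (x # gs)" using eq hs last_in_set[of "x # gs"] by simp
    then have "y \<subseteq> \<Union>(set (x # gs))" by blast
    then show False using fr hs by simp
  qed
  then have "card {(S, hs) \<in> walks n d k js. hd hs = last hs} \<le> card {(S, hs) \<in> walks n d k js. \<not> is_fresh hs}"
    by (intro card_mono finite_subset[OF _ finite_walks[of n d k js]]) auto
  then have "real (card {(S, hs) \<in> walks n d k js. hd hs = last hs})
      \<le> real (card {(S, hs) \<in> walks n d k js. \<not> is_fresh hs})" by (rule of_nat_mono)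
  also note card_not_fresh_le[OF assms(1,2) order_refl assms(4)]
  finally show ?thesis .
qed

end

subsection \<open>The limit measure\<close>

text \<open>If \<open>B\<^sup>2 = (d - 1) B + d\<close> for each of \<open>k\<close> operators \<open>B\<close>, then the sum of their words of
  length \<open>m\<close> without repeated adjacent letters is \<open>word_poly d k m\<close> of their sum.\<close>

fun word_poly :: "real \<Rightarrow> real \<Rightarrow> nat \<Rightarrow> real \<Rightarrow> real" where
  "word_poly d k 0 y = 1"
| "word_poly d k (Suc 0) y = y"
| "word_poly d k (Suc (Suc m)) y = (y - (d - 1)) * word_poly d k (Suc m) y
     - (if m = 0 then d * k else d * (k - 1)) * word_poly d k m y"

lemma continuous_word_poly: "continuous_on UNIV (word_poly d k m)"
proof (induction m rule: less_induct)
  case (less m)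
  consider "m = 0" | "m = 1" | j where "m = Suc (Suc j)" by (metis One_nat_def not0_implies_Suc)
  then show ?case
  proof cases
    case 3
    then have "continuous_on UNIV (word_poly d k (Suc j))" "continuous_on UNIV (word_poly d k j)" using less by auto
    then show ?thesis unfolding 3 word_poly.simps(3)[abs_def] by (intro continuous_intros)
  qed (simp_all add: word_poly.simps(1,2)[abs_def])
qed

lemma word_poly_measurable: "word_poly d k m \<in> borel_measurable borel"
  by (rule borel_measurable_continuous_onI[OF continuous_word_poly])

section \<open>The sine kernel and its bounds\<close>

definition trig_num :: "real \<Rightarrow> real \<Rightarrow> nat \<Rightarrow> real \<Rightarrow> real" where
  "trig_num r s m \<theta> = sin ((real m + 1) * \<theta>) + (r - s) * sin (real m * \<theta>) - r * s * sin ((real m - 1) * \<theta>)"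

text \<open>With \<open>\<zeta> = exp (i \<theta>)\<close> this is the squared modulus of (1 - s
  \<zeta>) (1 + r \<zeta>), and \<open>trig_num\<close> is the imaginary part of \<zeta>^(m+1) times
  the conjugate of that product. The real subtraction in \<open>trig_num\<close> matters at m = 0,
  where its last term is \<open>r * s * sin \<theta>\<close>.\<close>

definition trig_den :: "real \<Rightarrow> real \<Rightarrow> real \<Rightarrow> real" where
  "trig_den r s \<theta> = (1 - 2 * s * cos \<theta> + s\<^sup>2) * (1 + 2 * r * cos \<theta> + r\<^sup>2)"

text \<open>With \<open>\<zeta> = exp (i \<theta>)\<close> this is
  \<open>sin \<theta> * Im (\<zeta>\<^sup>m\<^sup>+\<^sup>1 / ((1 - s \<zeta>) (1 + r \<zeta>)))\<close>.\<close>

definition trig_kernel :: "real \<Rightarrow> real \<Rightarrow> nat \<Rightarrow> real \<Rightarrow> real" where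
  "trig_kernel r s m \<theta> = sin \<theta> * trig_num r s m \<theta> / trig_den r s \<theta>"

lemma sin_add_sub: "sin (a + b) + sin (a - b) = 2 * cos b * sin (a :: real)"
  by (simp add: sin_add sin_diff)

lemma trig_num_Suc:
  "trig_num r s (Suc m) \<theta> = sin ((real m + 2) * \<theta>) + (r - s) * sin ((real m + 1) * \<theta>) - r * s * sin (real m * \<theta>)"
  "trig_num r s (Suc (Suc m)) \<theta> = sin ((real m + 3) * \<theta>) + (r - s) * sin ((real m + 2) * \<theta>)
    - r * s * sin ((real m + 1) * \<theta>)"
  by (simp_all add: trig_num_def add.commute)

lemma trig_num_rec: "trig_num r s (Suc (Suc m)) \<theta> = 2 * cos \<theta> * trig_num r s (Suc m) \<theta> - trig_num r s m \<theta>"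
proof -
  have 1: "sin ((real m + 3) * \<theta>) = 2 * cos \<theta> * sin ((real m + 2) * \<theta>) - sin ((real m + 1) * \<theta>)"
    using sin_add_sub[of "(real m + 2) * \<theta>" \<theta>] by (simp add: algebra_simps)
  have 2: "sin ((real m + 2) * \<theta>) = 2 * cos \<theta> * sin ((real m + 1) * \<theta>) - sin (real m * \<theta>)"
    using sin_add_sub[of "(real m + 1) * \<theta>" \<theta>] by (simp add: algebra_simps)
  have 3: "sin ((real m + 1) * \<theta>) = 2 * cos \<theta> * sin (real m * \<theta>) - sin ((real m - 1) * \<theta>)"
    using sin_add_sub[of "real m * \<theta>" \<theta>] by (simp add: algebra_simps)
  show ?thesis unfolding trig_num_Suc[of r s m] trig_num_def[of r s m] using 1 2 3 by algebra
qed

text \<open>Multiplication of \<zeta>^(m+1) / ((1 - s \<zeta>) (1 + r \<zeta>)) by 1 + (r - s)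
  \<zeta> - r s \<zeta>^2 cancels the denominator; this is the imaginary part of that
  identity.\<close>

lemma trig_num_comb:
  "trig_num r s m \<theta> + (r - s) * trig_num r s (Suc m) \<theta> - r * s * trig_num r s (Suc (Suc m)) \<theta>
    = trig_den r s \<theta> * sin ((real m + 1) * \<theta>)"
proof -
  define S where "S = sin ((real m + 1) * \<theta>)"
  define c where "c = cos \<theta>"
  have 1: "sin ((real m + 2) * \<theta>) = 2 * c * S - sin (real m * \<theta>)"
    using sin_add_sub[of "(real m + 1) * \<theta>" \<theta>] by (simp add: algebra_simps S_def c_def)
  have 2: "sin ((real m + 3) * \<theta>) = 2 * (2 * c\<^sup>2 - 1) * S - sin ((real m - 1) * \<theta>)"
    using sin_add_sub[of "(real m + 1) * \<theta>" "2 * \<theta>", unfolded cos_double_cos]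
    by (simp add: algebra_simps S_def c_def)
  show ?thesis
    unfolding trig_num_Suc[of r s m] trig_num_def[of r s m] 1 2 trig_den_def S_def[symmetric] c_def[symmetric] by algebra
qed

text \<open>Each factor equals \<open>(sin \<theta>)^2\<close> plus a square, and depending on the
  sign of \<open>cos \<theta>\<close> one of the two factors is at least 1.\<close>

lemma trig_den_ge:
  assumes "0 \<le> r" "0 \<le> s"
  shows "(sin \<theta>)\<^sup>2 \<le> trig_den r s \<theta>"
proof -
  define c where "c = cos \<theta>"
  define P Q where "P = 1 - 2 * s * c + s\<^sup>2" and "Q = 1 + 2 * r * c + r\<^sup>2"
  have s: "(sin \<theta>)\<^sup>2 = 1 - c\<^sup>2" by (simp add: c_def sin_squared_eq)
  have P: "1 - c\<^sup>2 \<le> P" using zero_le_power2[of "s - c"] by (simp add: P_def power2_diff)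
  have Q: "1 - c\<^sup>2 \<le> Q" using zero_le_power2[of "r + c"] by (simp add: Q_def power2_sum)
  have c1: "0 \<le> 1 - c\<^sup>2" using s zero_le_power2[of "sin \<theta>"] by simp
  have "1 - c\<^sup>2 \<le> P * Q"
  proof (cases "0 \<le> c")
    case True
    then have "1 \<le> Q" using assms by (simp add: Q_def)
    then have "P * 1 \<le> P * Q" using P c1 by (intro mult_left_mono) auto
    then show ?thesis using P by simp
  next
    case False
    then have "s * c \<le> 0" using assms by (simp add: mult_nonneg_nonpos)
    moreover have "2 * s * c = 2 * (s * c)" by simp
    ultimately have "1 \<le> P" unfolding P_def using zero_le_power2[of s] by linarith
    then have "1 * Q \<le> P * Q" using Q c1 by (intro mult_right_mono) auto
    then show ?thesis using Q by simp
  qed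
  then show ?thesis by (simp add: s trig_den_def P_def Q_def c_def)
qed

text \<open>An imaginary part is bounded by the modulus. \<open>A\<close> and \<open>B\<close> are
  the real and imaginary part of the conjugate of (1 - s \<zeta>) (1 + r \<zeta>).\<close>

lemma trig_num_sq_le: "(trig_num r s m \<theta>)\<^sup>2 \<le> trig_den r s \<theta>"
proof -
  define c t where "c = cos \<theta>" and "t = sin \<theta>"
  define S C where "S = sin ((real m + 1) * \<theta>)" and "C = cos ((real m + 1) * \<theta>)"
  define A B where "A = 1 + (r - s) * c - r * s * (2 * c\<^sup>2 - 1)" and "B = - (r - s) * t + r * s * (2 * t * c)"
  have ct: "t\<^sup>2 = 1 - c\<^sup>2" by (simp add: t_def c_def sin_squared_eq)
  have SC: "S\<^sup>2 + C\<^sup>2 = 1" by (simp add: S_def C_def)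
  have e1: "sin (real m * \<theta>) = S * c - C * t"
    using sin_diff[of "(real m + 1) * \<theta>" \<theta>] by (simp add: S_def C_def c_def t_def algebra_simps)
  have e2: "sin ((real m - 1) * \<theta>) = S * (2 * c\<^sup>2 - 1) - C * (2 * t * c)"
    using sin_diff[of "(real m + 1) * \<theta>" "2 * \<theta>", unfolded cos_double_cos sin_double]
    by (simp add: S_def C_def c_def t_def algebra_simps)
  have num: "trig_num r s m \<theta> = A * S + B * C"
    unfolding trig_num_def S_def[symmetric] e1 e2 A_def B_def by algebra
  have "A\<^sup>2 + B\<^sup>2 = trig_den r s \<theta>"
    using ct unfolding A_def B_def trig_den_def c_def[symmetric] by algebra
  moreover have "(A * S + B * C)\<^sup>2 + (A * C - B * S)\<^sup>2 = (A\<^sup>2 + B\<^sup>2) * (S\<^sup>2 + C\<^sup>2)" by algebra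
  ultimately have "(A * S + B * C)\<^sup>2 + (A * C - B * S)\<^sup>2 = trig_den r s \<theta>" using SC by simp
  then show ?thesis unfolding num using zero_le_power2[of "A * C - B * S"] by linarith
qed

text \<open>The bound is uniform in the radii. It survives at zeros of the denominator, where the
  quotient is 0 by convention, and so provides a dominating function up to radius 1.\<close>

lemma trig_kernel_le:
  assumes "0 \<le> r" "0 \<le> s"
  shows "\<bar>trig_kernel r s m \<theta>\<bar> \<le> 1"
proof -
  have d0: "0 \<le> trig_den r s \<theta>" using trig_den_ge[OF assms, of \<theta>] zero_le_power2[of "sin \<theta>"] by linarith
  have "(sin \<theta>)\<^sup>2 * (trig_num r s m \<theta>)\<^sup>2 \<le> trig_den r s \<theta> * trig_den r s \<theta>"
    by (intro mult_mono trig_den_ge trig_num_sq_le assms d0) auto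
  then have "(sin \<theta> * trig_num r s m \<theta>)\<^sup>2 \<le> (trig_den r s \<theta>)\<^sup>2"
    by (simp add: power_mult_distrib power2_eq_square[of "trig_den r s \<theta>"])
  then have "\<bar>sin \<theta> * trig_num r s m \<theta>\<bar> \<le> trig_den r s \<theta>"
    using d0 abs_le_square_iff[of "sin \<theta> * trig_num r s m \<theta>" "trig_den r s \<theta>"] by simp
  then show ?thesis using d0 unfolding trig_kernel_def abs_divide
    by (auto simp: divide_le_eq_1)
qed

lemma trig_kernel_measurable [measurable]: "trig_kernel r s m \<in> borel_measurable borel"
  unfolding trig_kernel_def[abs_def] trig_num_def[abs_def] trig_den_def[abs_def] by measurable

section \<open>Integrals of the kernel over the half circle\<close>

definition kernel_int :: "real \<Rightarrow> real \<Rightarrow> nat \<Rightarrow> real" where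
  "kernel_int r s m = (\<integral>\<theta>. indicator {0..pi} \<theta> * trig_kernel r s m \<theta> \<partial>lborel)"

lemma integrable_indicator_pi: "integrable lborel (\<lambda>\<theta>. indicator {0..pi} \<theta> :: real)"
  by (rule integrable_real_indicator) auto

lemma integrable_bounded_pi:
  fixes f :: "real \<Rightarrow> real"
  assumes "f \<in> borel_measurable borel" "\<And>x. x \<in> {0..pi} \<Longrightarrow> \<bar>f x\<bar> \<le> C"
  shows "integrable lborel (\<lambda>\<theta>. indicator {0..pi} \<theta> * f \<theta>)"
proof (rule Bochner_Integration.integrable_bound[where f = "\<lambda>\<theta>. C * indicator {0..pi} \<theta>"])
  show "integrable lborel (\<lambda>\<theta>. C * indicator {0..pi} \<theta>)" using integrable_indicator_pi by simp
  show "(\<lambda>\<theta>. indicator {0..pi} \<theta> * f \<theta>) \<in> borel_measurable lborel" using assms(1) by measurable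
  show "AE x in lborel. norm (indicator {0..pi} x * f x) \<le> norm (C * indicator {0..pi} x)"
    using assms(2) by (intro AE_I2) (force simp: indicator_def)
qed

lemma integrable_trig_kernel:
  "0 \<le> r \<Longrightarrow> 0 \<le> s \<Longrightarrow> integrable lborel (\<lambda>\<theta>. indicator {0..pi} \<theta> * trig_kernel r s m \<theta>)"
  by (rule integrable_bounded_pi[where C = 1]) (auto simp: trig_kernel_le)

lemma abs_kernel_int_le:
  assumes "0 \<le> r" "0 \<le> s"
  shows "\<bar>kernel_int r s m\<bar> \<le> pi"
proof -
  have "\<bar>kernel_int r s m\<bar> \<le> (\<integral>\<theta>. \<bar>indicator {0..pi} \<theta> * trig_kernel r s m \<theta>\<bar> \<partial>lborel)"
    unfolding kernel_int_def by (rule integral_abs_bound)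
  also have "\<dots> \<le> (\<integral>\<theta>. indicator {0..pi} \<theta> \<partial>lborel)"
    using integrable_trig_kernel[OF assms, of m] trig_kernel_le[OF assms, of m]
    by (intro integral_mono integrable_abs integrable_indicator_pi) (auto simp: indicator_def abs_mult)
  also have "\<dots> = pi" by simp
  finally show ?thesis .
qed

lemma integral_sin_sin:
  "(\<integral>\<theta>. indicator {0..pi} \<theta> * (sin \<theta> * sin ((real m + 1) * \<theta>)) \<partial>lborel) = (if m = 0 then pi / 2 else 0)"
proof -
  define F where "F = (\<lambda>\<theta>. ((if m = 0 then \<theta> else sin (real m * \<theta>) / real m) - sin ((real m + 2) * \<theta>) / (real m + 2)) / 2)"
  have eq: "sin \<theta> * sin ((real m + 1) * \<theta>) = (cos (real m * \<theta>) - cos ((real m + 2) * \<theta>)) / 2" for \<theta>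
    using cos_diff[of "(real m + 1) * \<theta>" \<theta>] cos_add[of "(real m + 1) * \<theta>" \<theta>] by (simp add: algebra_simps)
  have s: "((\<lambda>\<theta>. sin (a * \<theta>) / a) has_real_derivative cos (a * \<theta>)) (at \<theta>)" if "a \<noteq> 0" for a \<theta> :: real
    using that by (auto intro!: derivative_eq_intros)
  have der: "(F has_real_derivative sin \<theta> * sin ((real m + 1) * \<theta>)) (at \<theta>)" for \<theta>
  proof (cases "m = 0")
    case True
    then show ?thesis unfolding F_def eq by (auto intro!: derivative_eq_intros)
  next
    case False
    show ?thesis unfolding F_def eq using False
      by (simp only: if_False) (intro DERIV_cdivide DERIV_diff s; simp)
  qed
  have "(F has_vector_derivative sin \<theta> * sin ((real m + 1) * \<theta>)) (at \<theta> within {0..pi})" for \<theta>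
    by (rule has_vector_derivative_at_within, rule has_real_derivative_iff_has_vector_derivative[THEN iffD1], rule der)
  then have "(\<integral>\<theta>. indicator {0..pi} \<theta> *\<^sub>R (sin \<theta> * sin ((real m + 1) * \<theta>)) \<partial>lborel) = F pi - F 0"
    by (intro integral_FTC_atLeastAtMost continuous_intros) auto
  moreover have "sin (real m * pi) = 0" "sin ((real m + 2) * pi) = 0"
    using sin_npi[of m] sin_npi[of "m + 2"] by (simp_all add: add.commute)
  ultimately show ?thesis by (simp add: F_def)
qed

text \<open>The recurrence runs backwards: a nonzero value would force geometric growth of the later
  ones.\<close>

lemma bounded_geometric_zero:
  fixes a :: "nat \<Rightarrow> real"
  assumes rec: "\<And>m. m \<ge> M \<Longrightarrow> a m = c * a (Suc m)" and c: "\<bar>c\<bar> < 1" and b: "\<And>m. \<bar>a m\<bar> \<le> C" and m: "m \<ge> M"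
  shows "a m = 0"
proof -
  have eq: "a m = c ^ j * a (m + j)" for j
  proof (induction j)
    case (Suc j)
    have "a (m + j) = c * a (Suc (m + j))" by (rule rec) (use m in simp)
    then show ?case using Suc by (simp add: mult.left_commute)
  qed simp
  have le: "\<bar>a m\<bar> \<le> \<bar>c\<bar> ^ j * C" for j
  proof -
    have "\<bar>a m\<bar> = \<bar>c\<bar> ^ j * \<bar>a (m + j)\<bar>" by (subst eq[of j]) (simp add: abs_mult power_abs)
    also have "\<dots> \<le> \<bar>c\<bar> ^ j * C" by (intro mult_left_mono b) auto
    finally show ?thesis .
  qed
  have "(\<lambda>j. \<bar>c\<bar> ^ j * C) \<longlonglongrightarrow> 0 * C"
    using c by (intro tendsto_mult LIMSEQ_power_zero tendsto_const) auto
  then have "\<bar>a m\<bar> \<le> 0 * C" by (rule LIMSEQ_le_const) (use le in blast)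
  then show ?thesis by simp
qed

text \<open>Integrating \<open>trig_num_comb\<close> gives a linear recurrence for the integrals,
  with inhomogeneity only at m = 0. Its symbol factors as (1 - s E) (1 + r E) with the shift
  \<open>E\<close>, and boundedness removes the homogeneous solution of each factor.\<close>

lemma kernel_int_interior:
  assumes r: "0 \<le> r" "r < 1" and s: "0 \<le> s" "s < 1"
  shows "kernel_int r s m = (if m = 0 then pi / 2 else 0)"
proof -
  let ?I = "kernel_int r s"
  have den: "trig_den r s \<theta> \<noteq> 0" for \<theta>
  proof -
    have "s * cos \<theta> \<le> s * 1" "r * (-1) \<le> r * cos \<theta>" by (intro mult_left_mono r s cos_le_one cos_ge_minus_one)+
    then have "(1 - s)\<^sup>2 \<le> 1 - 2 * s * cos \<theta> + s\<^sup>2" "(1 - r)\<^sup>2 \<le> 1 + 2 * r * cos \<theta> + r\<^sup>2"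
      by (simp_all add: power2_diff)
    moreover have "0 < (1 - s)\<^sup>2" "0 < (1 - r)\<^sup>2" using r s by auto
    ultimately show ?thesis unfolding trig_den_def by (metis less_irrefl less_le_trans mult_pos_pos)
  qed
  have rec: "?I m + (r - s) * ?I (Suc m) - r * s * ?I (Suc (Suc m)) = (if m = 0 then pi / 2 else 0)" for m
  proof -
    have "?I m + (r - s) * ?I (Suc m) - r * s * ?I (Suc (Suc m)) =
      (\<integral>\<theta>. indicator {0..pi} \<theta> * trig_kernel r s m \<theta> + (r - s) * (indicator {0..pi} \<theta> * trig_kernel r s (Suc m) \<theta>)
        - r * s * (indicator {0..pi} \<theta> * trig_kernel r s (Suc (Suc m)) \<theta>) \<partial>lborel)"
      unfolding kernel_int_def using integrable_trig_kernel[OF r(1) s(1)] by simp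
    also have "\<dots> = (\<integral>\<theta>. indicator {0..pi} \<theta> * (sin \<theta> * sin ((real m + 1) * \<theta>)) \<partial>lborel)"
    proof (rule Bochner_Integration.integral_cong)
      fix \<theta>
      have "trig_kernel r s m \<theta> + (r - s) * trig_kernel r s (Suc m) \<theta> - r * s * trig_kernel r s (Suc (Suc m)) \<theta>
        = sin \<theta> * (trig_num r s m \<theta> + (r - s) * trig_num r s (Suc m) \<theta> - r * s * trig_num r s (Suc (Suc m)) \<theta>) / trig_den r s \<theta>"
        by (simp add: trig_kernel_def add_divide_distrib diff_divide_distrib distrib_left right_diff_distrib mult.left_commute mult.assoc)
      also have "\<dots> = sin \<theta> * sin ((real m + 1) * \<theta>)" unfolding trig_num_comb using den[of \<theta>] by simp
      finally show "indicator {0..pi} \<theta> * trig_kernel r s m \<theta> + (r - s) * (indicator {0..pi} \<theta> * trig_kernel r s (Suc m) \<theta>)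
        - r * s * (indicator {0..pi} \<theta> * trig_kernel r s (Suc (Suc m)) \<theta>) = indicator {0..pi} \<theta> * (sin \<theta> * sin ((real m + 1) * \<theta>))"
        by (simp add: indicator_def)
    qed simp
    also have "\<dots> = (if m = 0 then pi / 2 else 0)" by (rule integral_sin_sin)
    finally show ?thesis .
  qed
  \<comment> \<open>The factor 1 + r E applied to the integrals; the recurrence becomes first order
    in \<open>L\<close>.\<close>
  define L where "L m = ?I m + r * ?I (Suc m)" for m
  have L: "L m - s * L (Suc m) = (if m = 0 then pi / 2 else 0)" for m
    using rec[of m] by (simp add: L_def algebra_simps)
  have Lb: "\<bar>L m\<bar> \<le> pi + 1 * pi" for m
  proof -
    have "\<bar>L m\<bar> \<le> \<bar>?I m\<bar> + \<bar>r\<bar> * \<bar>?I (Suc m)\<bar>" unfolding L_def abs_mult[symmetric] by (rule abs_triangle_ineq)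
    also have "\<dots> \<le> pi + 1 * pi"
      using r s by (intro add_mono mult_mono abs_kernel_int_le) auto
    finally show ?thesis .
  qed
  have L0: "L m = 0" if "m \<ge> 1" for m
  proof (rule bounded_geometric_zero[of 1 L s "pi + 1 * pi" m])
    show "L m = s * L (Suc m)" if "m \<ge> 1" for m using L[of m] that by simp
  qed (use Lb s that in auto)
  have I0: "?I m = 0" if "m \<ge> 1" for m
  proof (rule bounded_geometric_zero[of 1 ?I "- r" pi m])
    show "?I m = - r * ?I (Suc m)" if "m \<ge> 1" for m using L0[OF that] by (simp add: L_def)
  qed (use r s that in \<open>auto intro: abs_kernel_int_le\<close>)
  show ?thesis using rec[of 0] I0 by (cases "m = 0") auto
qed

text \<open>At radius 1 the ratio in the recurrence is no longer below 1 and the denominator may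
  vanish, so this case is a limit along shrunken radii. It occurs for \<open>nu d k\<close> when k =
  d + 1.\<close>

lemma kernel_int_eq:
  assumes r: "0 \<le> r" "r \<le> 1" and s: "0 \<le> s" "s \<le> 1"
  shows "kernel_int r s m = (if m = 0 then pi / 2 else 0)"
proof -
  define t where "t = (\<lambda>i::nat. 1 - 1 / (real i + 2))"
  have t: "0 \<le> t i" "t i < 1" for i by (auto simp: t_def)
  have tlim: "t \<longlonglongrightarrow> 1" unfolding t_def by real_asymp
  have "(\<lambda>i. kernel_int (t i * r) (t i * s) m) \<longlonglongrightarrow> kernel_int r s m"
    unfolding kernel_int_def
  proof (rule integral_dominated_convergence[where w = "\<lambda>\<theta>. indicator {0..pi} \<theta>"])
    show "AE \<theta> in lborel. (\<lambda>i. indicator {0..pi} \<theta> * trig_kernel (t i * r) (t i * s) m \<theta>)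
        \<longlonglongrightarrow> indicator {0..pi} \<theta> * trig_kernel r s m \<theta>"
    proof (rule AE_I2)
      fix \<theta>
      show "(\<lambda>i. indicator {0..pi} \<theta> * trig_kernel (t i * r) (t i * s) m \<theta>)
        \<longlonglongrightarrow> indicator {0..pi} \<theta> * trig_kernel r s m \<theta>"
      \<comment> \<open>The kernels are 0 where the sine vanishes; elsewhere
        \<open>trig_den_ge\<close> keeps the limiting denominator positive.\<close>
      proof (cases "sin \<theta> = 0")
        case True
        then show ?thesis by (simp add: trig_kernel_def)
      next
        case False
        then have "trig_den r s \<theta> \<noteq> 0"
          using trig_den_ge[OF r(1) s(1), of \<theta>] by (metis not_less zero_less_power2)
        then have d: "trig_den (1 * r) (1 * s) \<theta> \<noteq> 0" by simp
        have "(\<lambda>i. indicator {0..pi} \<theta> * trig_kernel (t i * r) (t i * s) m \<theta>)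
          \<longlonglongrightarrow> indicator {0..pi} \<theta> * trig_kernel (1 * r) (1 * s) m \<theta>"
          using d unfolding trig_kernel_def trig_num_def trig_den_def
          by (intro tendsto_intros tlim)
        then show ?thesis by simp
      qed
    qed
    show "AE \<theta> in lborel. norm (indicator {0..pi} \<theta> * trig_kernel (t i * r) (t i * s) m \<theta>) \<le> indicator {0..pi} \<theta>" for i
      using trig_kernel_le[of "t i * r" "t i * s" m] t[of i] r s by (auto simp: indicator_def)
  qed (auto intro: integrable_indicator_pi)
  moreover have "kernel_int (t i * r) (t i * s) m = (if m = 0 then pi / 2 else 0)" for i
  proof (rule kernel_int_interior)
    show "t i * r < 1" "t i * s < 1" using t[of i] r s
      by (metis le_less_trans mult.right_neutral mult_left_mono)+
  qed (use t[of i] r s in auto)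
  ultimately show ?thesis by (simp add: LIMSEQ_const_iff)
qed

section \<open>The limit density in the angle variable\<close>

context
  fixes d k :: nat
  assumes d: "1 \<le> d" and k: "d + 1 \<le> k"
begin

definition rad :: real where "rad = sqrt (real d * (real k - 1))"

text \<open>Runs through \<open>I_int d k\<close> as \<theta> goes from 0 to pi. The sign of the
  cosine term makes it increasing there, which the substitution rule requires.\<close>

definition angle_map :: "real \<Rightarrow> real" where "angle_map \<theta> = real k - 1 + real d - 2 * rad * cos \<theta>"

text \<open>The density of \<open>nu d k\<close> including the Jacobian
  \<open>2 * rad * sin \<theta>\<close>. The radii come from the denominator: with \<zeta> = exp (i
  \<theta>), \<open>x\<close> is k - 1 times the squared modulus of 1 - (d / rad) \<zeta>, and (d +
  1) k - x is rad^2 times that of 1 + \<zeta> / rad.\<close>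

definition angle_density :: "real \<Rightarrow> real" where
  "angle_density \<theta> = 2 * real k / (pi * (real k - 1)) * ((sin \<theta>)\<^sup>2 / trig_den (1 / rad) (real d / rad) \<theta>)"

lemma rad_facts: "rad > 0" "rad * rad = real d * (real k - 1)" "real k > 1" "1 \<le> rad" "real d \<le> rad"
proof -
  show k1: "real k > 1" using d k by simp
  have p: "real d * (real k - 1) \<ge> real d * real d" using k by (intro mult_left_mono) auto
  also have "real d * real d \<ge> 1" using d by (metis mult_mono of_nat_1 of_nat_le_iff mult_1 zero_le_one of_nat_0_le_iff)
  finally have "1 \<le> real d * (real k - 1)" .
  then show "rad > 0" "rad * rad = real d * (real k - 1)" "1 \<le> rad" by (auto simp: rad_def)
  show "real d \<le> rad" unfolding rad_def using p by (intro real_le_rsqrt) (simp add: power2_eq_square)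
qed

text \<open>The product of the two radii is 1 / (k - 1). So \<open>angle_density\<close> is itself a
  multiple of the kernel with m = 0, whose integral gives the total mass.\<close>

lemma trig_num_0: "trig_num (1 / rad) (real d / rad) 0 \<theta> = real k / (real k - 1) * sin \<theta>"
proof -
  have "1 / rad * (real d / rad) = real d / (rad * rad)" by simp
  also have "\<dots> = 1 / (real k - 1)" unfolding rad_facts(2) using d by simp
  finally have rs: "1 / rad * (real d / rad) = 1 / (real k - 1)" .
  have "trig_num (1 / rad) (real d / rad) 0 \<theta> = (1 + 1 / rad * (real d / rad)) * sin \<theta>"
    by (simp add: trig_num_def algebra_simps)
  also have "1 + 1 / rad * (real d / rad) = real k / (real k - 1)" unfolding rs using rad_facts(3) by (simp add: field_simps)
  finally show ?thesis .
qed

text \<open>Both sides obey the same three-term recurrence. The formula would fail for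
  \<open>word_poly d k 0\<close>, where \<open>trig_num_0\<close> has the factor k / (k - 1); the
  exceptional coefficient d k of the recurrence absorbs exactly this factor.\<close>

lemma word_poly_angle_map:
  "word_poly (real d) (real k) (Suc m) (angle_map \<theta> - real k) * sin \<theta> = (- rad) ^ Suc m * trig_num (1 / rad) (real d / rad) (Suc m) \<theta>"
proof (induction m rule: less_induct)
  case (less m)
  let ?y = "angle_map \<theta> - real k" and ?e = "\<lambda>m. trig_num (1 / rad) (real d / rad) m \<theta>"
  have y: "?y - (real d - 1) = - 2 * rad * cos \<theta>" by (simp add: angle_map_def)
  have e1: "- rad * ?e 1 = (- 2 * rad * cos \<theta> + (real d - 1)) * sin \<theta>"
    using rad_facts(1) sin_double[of \<theta>] by (simp add: trig_num_def field_simps)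
  have ye: "?y = - 2 * rad * cos \<theta> + (real d - 1)" by (simp add: angle_map_def)
  have rec: "(- rad) ^ Suc (Suc m) * ?e (Suc (Suc m)) = - 2 * rad * cos \<theta> * ((- rad) ^ Suc m * ?e (Suc m)) - rad * rad * ((- rad) ^ m * ?e m)" for m
    unfolding trig_num_rec power_Suc by algebra
  consider "m = 0" | "m = 1" | j where "m = Suc (Suc j)" by (metis One_nat_def not0_implies_Suc)
  then show ?case
  proof cases
    case 1
    then show ?thesis using e1 unfolding ye by simp
  next
    case 2
    have "(- rad) ^ Suc (Suc 0) * ?e (Suc (Suc 0)) = - 2 * rad * cos \<theta> * (- rad * ?e 1) - rad * rad * ?e 0"
      using rec[of 0] by simp
    also have "rad * rad * ?e 0 = real d * real k * sin \<theta>"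
      unfolding trig_num_0 rad_facts(2) using rad_facts(3) by simp
    also have "- rad * ?e 1 = ?y * sin \<theta>" unfolding e1 ye ..
    also have "- 2 * rad * cos \<theta> * (?y * sin \<theta>) - real d * real k * sin \<theta>
      = ((?y - (real d - 1)) * ?y - real d * real k) * sin \<theta>"
      unfolding y by (simp only: left_diff_distrib mult.assoc)
    finally show ?thesis using 2 by simp
  next
    case 3
    have "(- rad) ^ Suc m * ?e (Suc m) = - 2 * rad * cos \<theta> * ((- rad) ^ m * ?e m) - rad * rad * ((- rad) ^ Suc j * ?e (Suc j))"
      using rec[of "Suc j"] 3 by simp
    also have "(- rad) ^ m * ?e m = word_poly (real d) (real k) m ?y * sin \<theta>" using less[of "Suc j"] 3 by simp
    also have "(- rad) ^ Suc j * ?e (Suc j) = word_poly (real d) (real k) (Suc j) ?y * sin \<theta>" using less[of j] 3 by simp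
    also have "- 2 * rad * cos \<theta> * (word_poly (real d) (real k) m ?y * sin \<theta>) - rad * rad * (word_poly (real d) (real k) (Suc j) ?y * sin \<theta>)
      = ((?y - (real d - 1)) * word_poly (real d) (real k) m ?y - real d * (real k - 1) * word_poly (real d) (real k) (Suc j) ?y) * sin \<theta>"
      unfolding y rad_facts(2) by (simp only: left_diff_distrib mult.assoc)
    finally show ?thesis using 3 by simp
  qed
qed

lemma angle_density_word_poly:
  "angle_density \<theta> * word_poly (real d) (real k) (Suc m) (angle_map \<theta> - real k) =
    2 * real k / (pi * (real k - 1)) * (- rad) ^ Suc m * trig_kernel (1 / rad) (real d / rad) (Suc m) \<theta>"
proof -
  have "angle_density \<theta> * word_poly (real d) (real k) (Suc m) (angle_map \<theta> - real k) =
    2 * real k / (pi * (real k - 1)) * (sin \<theta> * (word_poly (real d) (real k) (Suc m) (angle_map \<theta> - real k) * sin \<theta>) / trig_den (1 / rad) (real d / rad) \<theta>)"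
    by (simp add: angle_density_def power2_eq_square)
  then show ?thesis unfolding word_poly_angle_map by (simp add: trig_kernel_def mult_ac)
qed

lemma angle_density_eq: "angle_density \<theta> = 2 / pi * trig_kernel (1 / rad) (real d / rad) 0 \<theta>"
  using rad_facts(3) by (simp add: angle_density_def trig_kernel_def trig_num_0 power2_eq_square mult_ac)

lemma angle_density_measurable [measurable]: "angle_density \<in> borel_measurable borel"
  unfolding angle_density_def[abs_def] trig_den_def[abs_def] by measurable

lemma angle_map_measurable [measurable]: "angle_map \<in> borel_measurable borel"
  unfolding angle_map_def[abs_def] by measurable

lemma angle_density_nonneg: "0 \<le> angle_density \<theta>"
proof -
  have "0 \<le> trig_den (1 / rad) (real d / rad) \<theta>"
    by (rule order_trans[OF zero_le_power2 trig_den_ge]) (use rad_facts(1) in auto)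
  then show ?thesis using rad_facts(3) by (simp add: angle_density_def)
qed

lemma nu_density_angle_map:
  assumes "\<theta> \<in> {0..pi}"
  shows "real k * sqrt (4 * (real k - 1) * real d - (real k - 1 + real d - angle_map \<theta>)\<^sup>2) /
       (2 * pi * angle_map \<theta> * ((real d + 1) * real k - angle_map \<theta>)) * (2 * rad * sin \<theta>) = angle_density \<theta>"
proof -
  have sn: "0 \<le> sin \<theta>" using assms by (auto intro: sin_ge_zero)
  define P Q where "P = 1 - 2 * (real d / rad) * cos \<theta> + (real d / rad)\<^sup>2" and "Q = 1 + 2 * (1 / rad) * cos \<theta> + (1 / rad)\<^sup>2"
  have s2: "(real d / rad)\<^sup>2 = real d / (real k - 1)" using d by (simp add: power2_eq_square times_divide_times_eq rad_facts(2))
  have "(real k - 1) * (real d / rad) = real d * (real k - 1) / rad" by simp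
  also have "\<dots> = rad" unfolding rad_facts(2)[symmetric] using rad_facts(1) by simp
  finally have dq: "(real k - 1) * (real d / rad) = rad" .
  have "(real k - 1) * P = real k - 1 - 2 * ((real k - 1) * (real d / rad)) * cos \<theta> + (real k - 1) * (real d / (real k - 1))"
    unfolding P_def s2 by (simp add: algebra_simps)
  also have "\<dots> = angle_map \<theta>" unfolding dq using rad_facts(3) by (simp add: angle_map_def)
  finally have x: "angle_map \<theta> = (real k - 1) * P" by simp
  have "rad * rad * Q = rad * rad + 2 * rad * cos \<theta> + 1"
    using rad_facts(1) unfolding Q_def by (simp add: field_simps power2_eq_square)
  then have x': "(real d + 1) * real k - angle_map \<theta> = rad * rad * Q"
    unfolding rad_facts(2) by (simp add: angle_map_def algebra_simps)
  have "4 * (real k - 1) * real d - (real k - 1 + real d - angle_map \<theta>)\<^sup>2 = 4 * (rad * rad) - (2 * rad * cos \<theta>)\<^sup>2"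
    unfolding rad_facts(2) by (simp add: angle_map_def)
  also have "\<dots> = (2 * rad * sin \<theta>)\<^sup>2" using sin_cos_squared_add[of \<theta>] by algebra
  finally have sq: "sqrt (4 * (real k - 1) * real d - (real k - 1 + real d - angle_map \<theta>)\<^sup>2) = 2 * rad * sin \<theta>"
    using sn rad_facts(1) by simp
  have den: "trig_den (1 / rad) (real d / rad) \<theta> = P * Q" by (simp add: trig_den_def P_def Q_def)
  \<comment> \<open>If a factor of the denominator vanishes, both sides are 0 by the convention for
    division. For k = d + 1 this happens at \<theta> = 0.\<close>
  have aux: "K * (2 * q * S) / (2 * pi * (a * P) * (q * q * Q)) * (2 * q * S) = 2 * K / (pi * a) * (S\<^sup>2 / (P * Q))"
    if "q \<noteq> 0" for K q S a :: real
    using that by (cases "a = 0"; cases "P = 0"; cases "Q = 0") (simp_all add: field_simps power2_eq_square)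
  show ?thesis unfolding sq x' angle_density_def den unfolding x using rad_facts(1) by (intro aux) simp
qed

lemma nu_eq_distr:
  "nu d k = distr (density lborel (\<lambda>\<theta>. ennreal (indicator {0..pi} \<theta> * angle_density \<theta>))) borel angle_map"
proof (rule measure_eqI)
  fix B assume "B \<in> sets (nu d k)"
  then have B [measurable]: "B \<in> sets borel" by (simp add: nu_def)
  define f where "f x = real k * sqrt (4 * (real k - 1) * real d - (real k - 1 + real d - x)\<^sup>2) /
       (2 * pi * x * ((real d + 1) * real k - x))" for x
  have [measurable]: "f \<in> borel_measurable borel" unfolding f_def[abs_def] by measurable
  have sk: "sqrt (real k - 1) * sqrt (real d) = rad" "sqrt (real k - 1) ^ 2 = real k - 1" "sqrt (real d) ^ 2 = real d"
    using rad_facts(3) by (simp_all add: rad_def real_sqrt_mult mult.commute)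
  have I: "I_int d k = {angle_map 0..angle_map pi}"
    unfolding I_int_def power2_diff power2_sum sk angle_map_def using sk(1) by (simp add: algebra_simps)
  have "emeasure (nu d k) B = (\<integral>\<^sup>+x. ennreal (indicator (I_int d k) x * f x) * indicator B x \<partial>lborel)"
    unfolding nu_def f_def[symmetric] by (subst emeasure_density) (auto simp: I_int_def)
  also have "\<dots> = (\<integral>\<^sup>+x. ennreal (f x * indicator B x * indicator {angle_map 0..angle_map pi} x) \<partial>lborel)"
    by (intro nn_integral_cong) (simp add: I indicator_def)
  also have "\<dots> = (\<integral>\<^sup>+\<theta>. ennreal (f (angle_map \<theta>) * indicator B (angle_map \<theta>) * (2 * rad * sin \<theta>) * indicator {0..pi} \<theta>) \<partial>lborel)"
  proof (rule nn_integral_substitution)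
    show "set_borel_measurable borel {angle_map 0..angle_map pi} (\<lambda>x. f x * indicator B x)"
      unfolding set_borel_measurable_def by measurable
    show "(angle_map has_real_derivative 2 * rad * sin \<theta>) (at \<theta>)" for \<theta>
      unfolding angle_map_def[abs_def] by (auto intro!: derivative_eq_intros)
    show "0 \<le> 2 * rad * sin \<theta>" if "\<theta> \<in> {0..pi}" for \<theta>
      using rad_facts(1) that by (auto intro!: mult_nonneg_nonneg sin_ge_zero)
  qed (auto intro!: continuous_intros)
  also have "\<dots> = (\<integral>\<^sup>+\<theta>. ennreal (indicator {0..pi} \<theta> * angle_density \<theta>) * indicator (angle_map -` B) \<theta> \<partial>lborel)"
  proof (rule nn_integral_cong)
    fix \<theta>
    have "f (angle_map \<theta>) * (2 * rad * sin \<theta>) = angle_density \<theta>" if "\<theta> \<in> {0..pi}"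
      unfolding f_def by (rule nu_density_angle_map[OF that])
    then show "ennreal (f (angle_map \<theta>) * indicator B (angle_map \<theta>) * (2 * rad * sin \<theta>) * indicator {0..pi} \<theta>)
      = ennreal (indicator {0..pi} \<theta> * angle_density \<theta>) * indicator (angle_map -` B) \<theta>"
      by (simp add: indicator_def)
  qed
  also have "\<dots> = emeasure (distr (density lborel (\<lambda>\<theta>. ennreal (indicator {0..pi} \<theta> * angle_density \<theta>))) borel angle_map) B"
    by (subst emeasure_distr) (auto simp: emeasure_density measurable_sets_borel[OF angle_map_measurable])
  finally show "emeasure (nu d k) B = emeasure (distr (density lborel (\<lambda>\<theta>. ennreal (indicator {0..pi} \<theta> * angle_density \<theta>))) borel angle_map) B" .
qed (simp add: nu_def)

lemma integral_nu:
  assumes [measurable]: "f \<in> borel_measurable borel"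
  shows "(\<integral>x. f x \<partial>nu d k) = (\<integral>\<theta>. indicator {0..pi} \<theta> * (angle_density \<theta> * f (angle_map \<theta>)) \<partial>lborel)"
proof -
  have "(\<integral>x. f x \<partial>nu d k) = (\<integral>\<theta>. f (angle_map \<theta>) \<partial>density lborel (\<lambda>\<theta>. ennreal (indicator {0..pi} \<theta> * angle_density \<theta>)))"
    unfolding nu_eq_distr by (subst integral_distr) auto
  also have "\<dots> = (\<integral>\<theta>. (indicator {0..pi} \<theta> * angle_density \<theta>) *\<^sub>R f (angle_map \<theta>) \<partial>lborel)"
    by (subst integral_density) (auto simp: angle_density_nonneg)
  finally show ?thesis by (simp add: mult.assoc)
qed

lemma radii_bounds: "0 \<le> 1 / rad" "1 / rad \<le> 1" "0 \<le> real d / rad" "real d / rad \<le> 1"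
  using rad_facts by auto

lemma prob_space_nu: "prob_space (nu d k)"
proof (rule prob_spaceI)
  have "emeasure (nu d k) (space (nu d k)) = (\<integral>\<^sup>+\<theta>. ennreal (indicator {0..pi} \<theta> * angle_density \<theta>) \<partial>lborel)"
    unfolding nu_eq_distr by (subst emeasure_distr) (auto simp: emeasure_density)
  also have "\<dots> = ennreal (\<integral>\<theta>. indicator {0..pi} \<theta> * angle_density \<theta> \<partial>lborel)"
  proof (rule nn_integral_eq_integral)
    show "integrable lborel (\<lambda>\<theta>. indicator {0..pi} \<theta> * angle_density \<theta>)"
      unfolding angle_density_eq using integrable_mult_right[OF integrable_trig_kernel[OF radii_bounds(1,3)], of "2 / pi" 0]
      by (simp add: mult_ac)
  qed (simp add: angle_density_nonneg)
  also have "(\<integral>\<theta>. indicator {0..pi} \<theta> * angle_density \<theta> \<partial>lborel) = 2 / pi * kernel_int (1 / rad) (real d / rad) 0"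
    unfolding angle_density_eq kernel_int_def integral_mult_right_zero[symmetric] by (simp add: mult_ac)
  also have "\<dots> = 1" using kernel_int_eq[OF radii_bounds, of 0] by simp
  finally show "emeasure (nu d k) (space (nu d k)) = 1" by simp
qed

lemma integral_nu_word_poly: "(\<integral>x. word_poly (real d) (real k) (Suc m) (x - real k) \<partial>nu d k) = 0"
proof -
  note [measurable] = word_poly_measurable
  have "(\<integral>x. word_poly (real d) (real k) (Suc m) (x - real k) \<partial>nu d k) =
    (\<integral>\<theta>. 2 * real k / (pi * (real k - 1)) * (- rad) ^ Suc m * (indicator {0..pi} \<theta> * trig_kernel (1 / rad) (real d / rad) (Suc m) \<theta>) \<partial>lborel)"
    by (subst integral_nu) (simp_all only: angle_density_word_poly mult.left_commute mult.assoc, measurable)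
  also have "\<dots> = 2 * real k / (pi * (real k - 1)) * (- rad) ^ Suc m * kernel_int (1 / rad) (real d / rad) (Suc m)"
    unfolding kernel_int_def by (rule integral_mult_right_zero)
  also have "\<dots> = 0" using kernel_int_eq[OF radii_bounds, of "Suc m"] by simp
  finally show ?thesis .
qed

end

lemma mu_eq_distr:
  assumes k: "1 \<le> k"
  shows "mu d k = distr (nu d k) borel (\<lambda>x. real k - x)"
proof (rule measure_eqI)
  fix B assume "B \<in> sets (mu d k)"
  then have B [measurable]: "B \<in> sets borel" by (simp add: mu_def)
  define f where "f x = indicator (I_int d k) x * (real k * sqrt (4 * (real k - 1) * real d - (real k - 1 + real d - x)\<^sup>2) /
       (2 * pi * x * ((real d + 1) * real k - x)))" for x
  define g where "g x = indicator (J_int d k) x * (real k * sqrt (4 * (real k - 1) * real d - (x - 1 + real d)\<^sup>2) /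
       (2 * pi * (real k - x) * (real d * real k + x)))" for x
  have [measurable]: "I_int d k \<in> sets borel" "J_int d k \<in> sets borel" by (auto simp: I_int_def J_int_def)
  have [measurable]: "f \<in> borel_measurable borel" "g \<in> borel_measurable borel"
    unfolding f_def[abs_def] g_def[abs_def] by measurable
  have fg: "f (real k - x) = g x" if "1 \<le> k" for x
  proof -
    have "sqrt (real k - 1) ^ 2 = real k - 1" "sqrt (real d) ^ 2 = real d" using that by simp_all
    then have e1: "real k - x \<in> I_int d k \<longleftrightarrow> x \<in> J_int d k"
      unfolding I_int_def J_int_def power2_diff power2_sum real_sqrt_mult by auto
    have e2: "real k - 1 + real d - (real k - x) = x - 1 + real d"
      "(real d + 1) * real k - (real k - x) = real d * real k + x" by (simp_all add: algebra_simps)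
    show ?thesis unfolding f_def g_def e2 indicator_def e1 ..
  qed
  have "emeasure (distr (nu d k) borel (\<lambda>x. real k - x)) B = (\<integral>\<^sup>+x. ennreal (f x) * indicator B (real k - x) \<partial>lborel)"
  proof -
    have m: "(\<lambda>x. real k - x) \<in> borel_measurable borel" by measurable
    have "emeasure (distr (nu d k) borel (\<lambda>x. real k - x)) B = emeasure (density lborel (\<lambda>x. ennreal (f x))) ((\<lambda>x. real k - x) -` B)"
      unfolding nu_def f_def[symmetric] by (subst emeasure_distr) auto
    also have "\<dots> = (\<integral>\<^sup>+x. ennreal (f x) * indicator ((\<lambda>x. real k - x) -` B) x \<partial>lborel)"
      using measurable_sets_borel[OF m B] by (subst emeasure_density) auto
    also have "\<dots> = (\<integral>\<^sup>+x. ennreal (f x) * indicator B (real k - x) \<partial>lborel)"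
      by (intro nn_integral_cong) (simp add: indicator_def)
    finally show ?thesis .
  qed
  also have "\<dots> = (\<integral>\<^sup>+x. ennreal (f (real k + (-1) * x)) * indicator B (real k - (real k + (-1) * x)) \<partial>lborel)"
    by (subst nn_integral_real_affine[where t = "real k" and c = "-1"]) auto
  also have "\<dots> = (\<integral>\<^sup>+x. ennreal (g x) * indicator B x \<partial>lborel)"
    by (simp add: fg[OF k, symmetric])
  also have "\<dots> = emeasure (mu d k) B"
    unfolding mu_def g_def[symmetric] by (subst emeasure_density) auto
  finally show "emeasure (mu d k) B = emeasure (distr (nu d k) borel (\<lambda>x. real k - x)) B" by simp
qed (simp add: mu_def)

subsection \<open>The block matrix of a Steiner system\<close>

lemma union_in_system_iff:
  assumes T: "T \<in> steiner_systems n d" and x: "x \<in> dsets n d" and y: "y \<in> dsets n d" and ne: "x \<noteq> y"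
  shows "x \<union> y \<in> T \<longleftrightarrow> y \<subseteq> cell T x"
proof
  assume "x \<union> y \<in> T"
  then have "cell T x = x \<union> y" by (rule cell_eq[OF T x]) blast
  then show "y \<subseteq> cell T x" by blast
next
  assume sub: "y \<subseteq> cell T x"
  have c: "cell T x \<in> T" "x \<subseteq> cell T x" using cell_in[OF T x] by auto
  obtain v where v: "cell T x - x = {v}" "x = cell T x - {v}" by (rule dsets_remove[OF T c(1) x c(2)])
  have "\<not> y \<subseteq> x"
  proof
    assume "y \<subseteq> x"
    then have "y = x" using card_subset_eq[OF finite_dsetsD[OF x], of y] x y by (simp add: dsets_def)
    then show False using ne by simp
  qed
  then have "x \<union> y = cell T x" using sub v by blast
  then show "x \<union> y \<in> T" using c(1) by simp
qed

lemma block_matrix_cell: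
  assumes T: "T \<in> steiner_systems n d" and x: "x \<in> dsets n d" and y: "y \<in> dsets n d"
  shows "block_matrix T x y = (if x \<noteq> y \<and> y \<subseteq> cell T x
    then real_of_int (facet_inc (cell T x) x) * real_of_int (facet_inc (cell T x) y) else 0)"
proof (cases "x \<noteq> y \<and> y \<subseteq> cell T x")
  case True
  then have "x \<union> y \<in> T" using union_in_system_iff[OF T x y] by simp
  then have "cell T x = x \<union> y" by (intro cell_eq[OF T x]) auto
  then show ?thesis using True \<open>x \<union> y \<in> T\<close> by (simp add: block_matrix_def)
next
  case False
  then show ?thesis using union_in_system_iff[OF T x y] by (auto simp: block_matrix_def)
qed

lemma card_facets:
  assumes T: "T \<in> steiner_systems n d" and s: "s \<in> T"
  shows "card {z \<in> dsets n d. z \<subseteq> s} = d + 1"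
proof -
  have "{z \<in> dsets n d. z \<subseteq> s} = (\<lambda>v. s - {v}) ` s"
  proof (intro equalityI subsetI)
    fix z assume "z \<in> {z \<in> dsets n d. z \<subseteq> s}"
    then have z: "z \<in> dsets n d" "z \<subseteq> s" by auto
    obtain v where "s - z = {v}" "z = s - {v}" by (rule dsets_remove[OF T s z])
    then show "z \<in> (\<lambda>v. s - {v}) ` s" by blast
  next
    fix z assume "z \<in> (\<lambda>v. s - {v}) ` s"
    then show "z \<in> {z \<in> dsets n d. z \<subseteq> s}" using steiner_systemD[OF T s] by (auto simp: dsets_def)
  qed
  moreover have "inj_on (\<lambda>v. s - {v}) s" by (rule inj_onI) blast
  ultimately show ?thesis using steiner_systemD[OF T s] by (simp add: card_image)
qed

text \<open>Different cells do not interact because each d-set lies in one cell. On the d + 1 facets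
  of a cell the matrix is \<open>c c^T - 1\<close> with signs \<open>c\<close>, and the squared
  length d + 1 of \<open>c\<close> gives the relation.\<close>

lemma block_matrix_square:
  assumes T: "T \<in> steiner_systems n d" and d: "1 \<le> d" and x: "x \<in> dsets n d" and y: "y \<in> dsets n d"
  shows "(\<Sum>z\<in>dsets n d. block_matrix T x z * block_matrix T z y)
    = (real d - 1) * block_matrix T x y + (if x = y then real d else 0)"
proof -
  let ?s = "cell T x"
  let ?F = "{z \<in> dsets n d. z \<subseteq> ?s}"
  let ?c = "\<lambda>z. real_of_int (facet_inc ?s z)"
  have s: "?s \<in> T" "x \<subseteq> ?s" using cell_in[OF T x] by auto
  have c: "?c z * ?c z = 1" for z using facet_inc_sq[of ?s z] by (metis of_int_1 of_int_mult)
  have B: "block_matrix T z w = (if z \<noteq> w \<and> w \<in> ?F then ?c z * ?c w else 0)" if "z \<in> ?F" "w \<in> dsets n d" for z w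
  proof -
    have z: "z \<in> dsets n d" "z \<subseteq> ?s" using that by auto
    have "cell T z = ?s" by (rule cell_eq[OF T z(1) s(1) z(2)])
    then show ?thesis using block_matrix_cell[OF T z(1) that(2)] that(2) by simp
  qed
  have xF: "x \<in> ?F" using x s by simp
  have finF: "finite ?F" by simp
  have "(\<Sum>z\<in>dsets n d. block_matrix T x z * block_matrix T z y) = (\<Sum>z\<in>?F. block_matrix T x z * block_matrix T z y)"
    by (rule sum.mono_neutral_right) (auto simp: B[OF xF])
  also have "\<dots> = (\<Sum>z\<in>?F. if z \<noteq> x \<and> z \<noteq> y \<and> y \<in> ?F then ?c x * ?c y else 0)"
  proof (rule sum.cong[OF refl])
    fix z assume z: "z \<in> ?F"
    then have "z \<in> dsets n d" by simp
    then show "block_matrix T x z * block_matrix T z y = (if z \<noteq> x \<and> z \<noteq> y \<and> y \<in> ?F then ?c x * ?c y else 0)"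
      using B[OF xF, of z] B[OF z y] z c[of z] by (auto simp: mult.assoc)
  qed
  also have "\<dots> = (if y \<in> ?F then real (card (?F - {x, y})) * (?c x * ?c y) else 0)"
  proof -
    have "(\<Sum>z\<in>?F. if z \<noteq> x \<and> z \<noteq> y then ?c x * ?c y else 0) = (\<Sum>z\<in>?F - {x, y}. ?c x * ?c y)"
      using finF by (intro sum.mono_neutral_cong_right) auto
    also have "\<dots> = real (card (?F - {x, y})) * (?c x * ?c y)" by simp
    finally show ?thesis
      by (cases "y \<in> ?F") (simp_all only: simp_thms if_True if_False sum.neutral_const)
  qed
  also have "\<dots> = (real d - 1) * block_matrix T x y + (if x = y then real d else 0)"
  proof (cases "y \<in> ?F")
    case True
    have cF: "card ?F = d + 1" by (rule card_facets[OF T s(1)])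
    show ?thesis
    proof (cases "x = y")
      case True
      have "card (?F - {x}) = d" using cF xF by simp
      then show ?thesis using True xF c[of x] y by (simp add: block_matrix_def)
    next
      case False
      have "card (?F - {x, y}) = card ?F - card {x, y}"
        using True xF by (intro card_Diff_subset) auto
      then have "real (card (?F - {x, y})) = real d - 1" using False cF d by simp
      then show ?thesis using True False B[OF xF y] by simp
    qed
  next
    case False
    then have "x \<noteq> y" using xF by auto
    then show ?thesis using False B[OF xF y] by auto
  qed
  finally show ?thesis .
qed

subsection \<open>Words\<close>

fun word_matrix :: "nat set set \<Rightarrow> (nat \<Rightarrow> nat set set) \<Rightarrow> nat list \<Rightarrow> nat set \<Rightarrow> nat set \<Rightarrow> real" where
  "word_matrix V S [] x y = (if x = y then 1 else 0)"
| "word_matrix V S (j # js) x y = (\<Sum>z\<in>V. block_matrix (S j) x z * word_matrix V S js z y)"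

definition alt_words :: "nat \<Rightarrow> nat \<Rightarrow> nat list set" where
  "alt_words k m = {w. length w = m \<and> set w \<subseteq> {1..k} \<and> distinct_adj w}"

definition sum_matrix :: "nat \<Rightarrow> (nat \<Rightarrow> nat set set) \<Rightarrow> nat set \<Rightarrow> nat set \<Rightarrow> real" where
  "sum_matrix k S x y = (\<Sum>j\<in>{1..k}. block_matrix (S j) x y)"

definition closed_count :: "nat set set \<Rightarrow> (nat \<Rightarrow> nat set set) \<Rightarrow> nat list \<Rightarrow> nat" where
  "closed_count V S w = card {hs. is_walk V S w hs \<and> hd hs = last hs}"

lemma finite_alt_words [simp]: "finite (alt_words k m)"
  by (rule finite_subset[OF _ finite_lists_length_eq[of "{1..k}" m]]) (auto simp: alt_words_def)

lemma alt_words_0: "alt_words k 0 = {[]}"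
  by (auto simp: alt_words_def)

text \<open>A set, so that the empty word forbids no letter.\<close>

definition first_letter :: "nat list \<Rightarrow> nat set" where
  "first_letter w = (if w = [] then {} else {hd w})"

lemma sum_alt_words_Suc:
  fixes f :: "nat list \<Rightarrow> real"
  shows "(\<Sum>w\<in>alt_words k (Suc m). f w) = (\<Sum>w\<in>alt_words k m. \<Sum>j\<in>{1..k} - first_letter w. f (j # w))"
proof -
  have "(\<Sum>w\<in>alt_words k m. \<Sum>j\<in>{1..k} - first_letter w. f (j # w))
    = (\<Sum>p\<in>(SIGMA w:alt_words k m. {1..k} - first_letter w). f (snd p # fst p))"
    by (subst sum.Sigma) (auto simp: case_prod_beta)
  also have "\<dots> = (\<Sum>w\<in>alt_words k (Suc m). f w)"
  proof (rule sum.reindex_bij_witness[where i = "\<lambda>w. (tl w, hd w)" and j = "\<lambda>p. snd p # fst p"])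
    fix p assume "p \<in> (SIGMA w:alt_words k m. {1..k} - first_letter w)"
    then show "snd p # fst p \<in> alt_words k (Suc m)"
      by (cases p) (auto simp: alt_words_def first_letter_def distinct_adj_Cons split: if_splits)
  next
    fix w assume w: "w \<in> alt_words k (Suc m)"
    then obtain j v where "w = j # v" by (cases w) (auto simp: alt_words_def)
    then show "(tl w, hd w) \<in> (SIGMA w:alt_words k m. {1..k} - first_letter w)" "snd (tl w, hd w) # fst (tl w, hd w) = w"
      using w by (auto simp: alt_words_def first_letter_def distinct_adj_Cons)
  qed auto
  finally show ?thesis by simp
qed

lemma alt_words_hd: "w \<in> alt_words k m \<Longrightarrow> w \<noteq> [] \<Longrightarrow> hd w \<in> {1..k}"
  using hd_in_set[of w] unfolding alt_words_def by blast

lemma sum_split_first_letter: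
  fixes g :: "nat \<Rightarrow> real"
  assumes "w \<in> alt_words k (Suc m)"
  shows "(\<Sum>j\<in>{1..k}. g j) = (\<Sum>j\<in>{1..k} - first_letter w. g j) + g (hd w)"
proof -
  have "w \<noteq> []" using assms by (auto simp: alt_words_def)
  moreover from this have "hd w \<in> {1..k}" by (rule alt_words_hd[OF assms(1)])
  then have "(\<Sum>j\<in>{1..k}. g j) = g (hd w) + (\<Sum>j\<in>{1..k} - {hd w}. g j)" by (intro sum.remove) simp
  ultimately show ?thesis by (simp only: first_letter_def if_False add.commute)
qed

text \<open>The source of the case distinction in \<open>word_poly\<close>: the empty word has
  \<open>k\<close> extensions, every other word one fewer.\<close>

lemma card_minus_first_letter:
  assumes "w \<in> alt_words k m" "1 \<le> k"
  shows "real (card ({1..k} - first_letter w)) = (if m = 0 then real k else real k - 1)"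
proof (cases m)
  case 0
  then show ?thesis using assms by (simp add: alt_words_0 first_letter_def)
next
  case (Suc l)
  then have "w \<noteq> []" using assms by (auto simp: alt_words_def)
  moreover from this have "hd w \<in> {1..k}" by (rule alt_words_hd[OF assms(1)])
  ultimately show ?thesis using Suc assms(2) by (simp add: first_letter_def of_nat_diff)
qed

section \<open>Words applied to eigenvectors, and their traces\<close>

context
  fixes n d k :: nat and S :: "nat \<Rightarrow> nat set set"
  assumes d: "1 \<le> d" and k: "1 \<le> k" and S: "S \<in> steiner_tuples n d k"
begin

lemma tuple_system: "j \<in> {1..k} \<Longrightarrow> S j \<in> steiner_systems n d"
  by (rule steiner_tupleD[OF d S])

lemma sum_matrix_sym: "sum_matrix k S x y = sum_matrix k S y x"
  unfolding sum_matrix_def by (intro sum.cong refl block_matrix_sym)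

text \<open>A letter put in front of an alternating word either gives a longer alternating word or
  repeats the first letter, and then the quadratic relation returns the word itself with weight d -
  1 and its tail with weight d. Collecting terms yields the recurrence of \<open>word_poly\<close>;
  on an eigenvector it is an identity between numbers.\<close>

lemma sum_words_eigenvector:
  assumes b: "\<And>x. x \<in> dsets n d \<Longrightarrow> (\<Sum>y\<in>dsets n d. sum_matrix k S x y * b y) = l * b x"
    and x: "x \<in> dsets n d"
  shows "(\<Sum>y\<in>dsets n d. (\<Sum>w\<in>alt_words k m. word_matrix (dsets n d) S w x y) * b y) = word_poly (real d) (real k) m l * b x"
proof -
  let ?V = "dsets n d"
  define u where "u w x = (\<Sum>y\<in>?V. word_matrix ?V S w x y * b y)" for w x
  define U where "U m x = (\<Sum>w\<in>alt_words k m. u w x)" for m x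
  have u_Nil: "u [] x = b x" if "x \<in> ?V" for x
  proof -
    have "u [] x = (\<Sum>y\<in>?V. if y = x then b y else 0)" unfolding u_def by (intro sum.cong refl) auto
    then show ?thesis using that by simp
  qed
  have u_Cons: "u (j # w) x = (\<Sum>z\<in>?V. block_matrix (S j) x z * u w z)" for j w x
  proof -
    have "u (j # w) x = (\<Sum>y\<in>?V. \<Sum>z\<in>?V. block_matrix (S j) x z * (word_matrix ?V S w z y * b y))"
      unfolding u_def by (simp add: sum_distrib_right mult.assoc)
    also have "\<dots> = (\<Sum>z\<in>?V. \<Sum>y\<in>?V. block_matrix (S j) x z * (word_matrix ?V S w z y * b y))" by (rule sum.swap)
    finally show ?thesis by (simp add: u_def sum_distrib_left)
  qed
  have u_sq: "u (j # j # w) x = (real d - 1) * u (j # w) x + real d * u w x" if j: "j \<in> {1..k}" and x: "x \<in> ?V" for j w x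
  proof -
    have "u (j # j # w) x = (\<Sum>z\<in>?V. \<Sum>y\<in>?V. block_matrix (S j) x z * block_matrix (S j) z y * u w y)"
      unfolding u_Cons by (simp add: sum_distrib_left mult.assoc)
    also have "\<dots> = (\<Sum>y\<in>?V. \<Sum>z\<in>?V. block_matrix (S j) x z * block_matrix (S j) z y * u w y)" by (rule sum.swap)
    also have "\<dots> = (\<Sum>y\<in>?V. ((real d - 1) * block_matrix (S j) x y + (if x = y then real d else 0)) * u w y)"
      by (intro sum.cong refl) (simp only: sum_distrib_right[symmetric] block_matrix_square[OF tuple_system[OF j] d x])
    also have "\<dots> = (\<Sum>y\<in>?V. (real d - 1) * (block_matrix (S j) x y * u w y) + (if y = x then real d * u w y else 0))"
      by (intro sum.cong refl) (simp add: distrib_right)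
    also have "\<dots> = (real d - 1) * u (j # w) x + real d * u w x"
      using x unfolding u_Cons by (simp add: sum.distrib sum_distrib_left)
    finally show ?thesis .
  qed
  have aU: "(\<Sum>z\<in>?V. sum_matrix k S x z * U m z) = (\<Sum>w\<in>alt_words k m. \<Sum>j\<in>{1..k}. u (j # w) x)" for m x
  proof -
    have "(\<Sum>z\<in>?V. sum_matrix k S x z * U m z) = (\<Sum>z\<in>?V. \<Sum>w\<in>alt_words k m. \<Sum>j\<in>{1..k}. block_matrix (S j) x z * u w z)"
      unfolding sum_matrix_def U_def sum_product by (intro sum.cong refl sum.swap)
    also have "\<dots> = (\<Sum>w\<in>alt_words k m. \<Sum>z\<in>?V. \<Sum>j\<in>{1..k}. block_matrix (S j) x z * u w z)" by (rule sum.swap)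
    also have "\<dots> = (\<Sum>w\<in>alt_words k m. \<Sum>j\<in>{1..k}. \<Sum>z\<in>?V. block_matrix (S j) x z * u w z)"
      by (intro sum.cong refl sum.swap)
    finally show ?thesis by (simp add: u_Cons)
  qed
  have U1: "U (Suc 0) x = (\<Sum>z\<in>?V. sum_matrix k S x z * U 0 z)" for x
  proof -
    have "U (Suc 0) x = (\<Sum>w\<in>alt_words k 0. \<Sum>j\<in>{1..k}. u (j # w) x)"
      unfolding U_def sum_alt_words_Suc by (simp add: alt_words_0 first_letter_def)
    then show ?thesis by (simp only: aU)
  qed
  have U2: "(\<Sum>z\<in>?V. sum_matrix k S x z * U (Suc m) z) = U (Suc (Suc m)) x + (real d - 1) * U (Suc m) x
      + (if m = 0 then real d * real k else real d * (real k - 1)) * U m x" if x: "x \<in> ?V" for m x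
  proof -
    have "(\<Sum>z\<in>?V. sum_matrix k S x z * U (Suc m) z)
      = (\<Sum>w\<in>alt_words k (Suc m). (\<Sum>j\<in>{1..k} - first_letter w. u (j # w) x) + u (hd w # w) x)"
      unfolding aU by (intro sum.cong refl sum_split_first_letter)
    also have "\<dots> = U (Suc (Suc m)) x + (\<Sum>w\<in>alt_words k (Suc m). u (hd w # w) x)"
      unfolding U_def sum_alt_words_Suc[of _ k "Suc m"] by (rule sum.distrib)
    also have "(\<Sum>w\<in>alt_words k (Suc m). u (hd w # w) x)
      = (\<Sum>w\<in>alt_words k m. \<Sum>j\<in>{1..k} - first_letter w. (real d - 1) * u (j # w) x + real d * u w x)"
      unfolding sum_alt_words_Suc by (intro sum.cong refl) (simp add: u_sq x)
    also have "\<dots> = (\<Sum>w\<in>alt_words k m. (real d - 1) * (\<Sum>j\<in>{1..k} - first_letter w. u (j # w) x)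
        + (if m = 0 then real d * real k else real d * (real k - 1)) * u w x)"
    proof (intro sum.cong refl)
      fix w assume "w \<in> alt_words k m"
      note c = card_minus_first_letter[OF this k]
      show "(\<Sum>j\<in>{1..k} - first_letter w. (real d - 1) * u (j # w) x + real d * u w x)
        = (real d - 1) * (\<Sum>j\<in>{1..k} - first_letter w. u (j # w) x)
          + (if m = 0 then real d * real k else real d * (real k - 1)) * u w x"
        unfolding sum.distrib sum_distrib_left[symmetric] sum_constant c by simp
    qed
    also have "\<dots> = (real d - 1) * U (Suc m) x + (if m = 0 then real d * real k else real d * (real k - 1)) * U m x"
      unfolding U_def sum_alt_words_Suc[of _ k m] by (simp add: sum.distrib sum_distrib_left)
    finally show ?thesis by simp
  qed
  have U0: "U 0 x = b x" if "x \<in> ?V" for x using u_Nil[OF that] by (simp add: U_def alt_words_0)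
  have main: "\<forall>x\<in>?V. U m x = word_poly (real d) (real k) m l * b x" for m
  proof (induction m rule: less_induct)
    case (less m)
    have act: "(\<Sum>z\<in>?V. sum_matrix k S x z * U i z) = word_poly (real d) (real k) i l * (l * b x)"
      if "x \<in> ?V" "i < m" for x i
    proof -
      have "(\<Sum>z\<in>?V. sum_matrix k S x z * U i z) = (\<Sum>z\<in>?V. word_poly (real d) (real k) i l * (sum_matrix k S x z * b z))"
        using less[OF that(2)] by (intro sum.cong refl) simp
      then show ?thesis using b[OF that(1)] by (simp add: sum_distrib_left[symmetric])
    qed
    consider "m = 0" | "m = 1" | j where "m = Suc (Suc j)" by (metis One_nat_def not0_implies_Suc)
    then show ?case
    proof cases
      case 1
      then show ?thesis using U0 by simp
    next
      case 2
      then show ?thesis using U1 act[of _ 0] by simp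
    next
      case 3
      show ?thesis
      proof
        fix x assume x: "x \<in> ?V"
        have "U m x = word_poly (real d) (real k) (Suc j) l * (l * b x) - (real d - 1) * (word_poly (real d) (real k) (Suc j) l * b x)
           - (if j = 0 then real d * real k else real d * (real k - 1)) * (word_poly (real d) (real k) j l * b x)"
          using U2[OF x, of j] act[OF x, of "Suc j"] less[of "Suc j"] less[of j] x 3 by simp
        also have "\<dots> = word_poly (real d) (real k) m l * b x"
        proof -
          have "p * (l * B) - (D - 1) * (p * B) - q * (r * B) = ((l - (D - 1)) * p - q * r) * B" for p B D q r :: real
            by algebra
          then show ?thesis unfolding 3 word_poly.simps .
        qed
        finally show "U m x = word_poly (real d) (real k) m l * b x" .
      qed
    qed
  qed
  have "(\<Sum>y\<in>?V. (\<Sum>w\<in>alt_words k m. word_matrix ?V S w x y) * b y) = U m x"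
    unfolding U_def u_def by (simp add: sum_distrib_right sum.swap[of _ ?V "alt_words k m"])
  then show ?thesis using main[of m] x by simp
qed

lemma finite_walk_set: "finite {hs. is_walk (dsets n d) S w hs \<and> P hs}"
  by (rule finite_subset[OF _ finite_lists_length_eq[of "dsets n d" "Suc (length w)"]])
    (auto dest: is_walkD)

text \<open>Expanding the matrix product writes an entry as a sum of signs over walks; the signs are
  discarded.\<close>

lemma abs_word_matrix_le:
  "x \<in> dsets n d \<Longrightarrow> \<bar>word_matrix (dsets n d) S w x y\<bar> \<le> real (card {hs. is_walk (dsets n d) S w hs \<and> hd hs = x \<and> last hs = y})"
proof (induction w arbitrary: x)
  case Nil
  show ?case
  proof (cases "x = y")
    case True
    have "{[x]} \<subseteq> {hs. is_walk (dsets n d) S [] hs \<and> hd hs = x \<and> last hs = y}" using Nil True by auto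
    then have "card {[x]} \<le> card {hs. is_walk (dsets n d) S [] hs \<and> hd hs = x \<and> last hs = y}"
      by (rule card_mono[OF finite_walk_set])
    then show ?thesis using True by simp
  qed simp
next
  case (Cons j w)
  let ?W = "\<lambda>z. {hs. is_walk (dsets n d) S w hs \<and> hd hs = z \<and> last hs = y}"
  let ?Z = "{z \<in> dsets n d. x \<noteq> z \<and> x \<union> z \<in> S j}"
  have "\<bar>word_matrix (dsets n d) S (j # w) x y\<bar> \<le> (\<Sum>z\<in>dsets n d. \<bar>block_matrix (S j) x z\<bar> * \<bar>word_matrix (dsets n d) S w z y\<bar>)"
    unfolding word_matrix.simps abs_mult[symmetric] by (rule sum_abs)
  also have "\<dots> = (\<Sum>z\<in>?Z. \<bar>block_matrix (S j) x z\<bar> * \<bar>word_matrix (dsets n d) S w z y\<bar>)"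
    by (rule sum.mono_neutral_right) (auto simp: block_matrix_def)
  also have "\<dots> \<le> (\<Sum>z\<in>?Z. 1 * real (card (?W z)))"
    using Cons.IH by (intro sum_mono mult_mono abs_block_matrix_le) auto
  also have "\<dots> = real (card (\<Union>z\<in>?Z. (#) x ` ?W z))"
  proof -
    have "card (\<Union>z\<in>?Z. (#) x ` ?W z) = (\<Sum>z\<in>?Z. card ((#) x ` ?W z))"
      using finite_walk_set[of w] by (intro card_UN_disjoint) auto
    also have "\<dots> = (\<Sum>z\<in>?Z. card (?W z))" by (intro sum.cong refl card_image) (simp add: inj_on_def)
    finally show ?thesis by simp
  qed
  also have "\<dots> \<le> real (card {hs. is_walk (dsets n d) S (j # w) hs \<and> hd hs = x \<and> last hs = y})"
  proof (intro of_nat_mono card_mono finite_walk_set subsetI)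
    fix hs assume "hs \<in> (\<Union>z\<in>?Z. (#) x ` ?W z)"
    then obtain z gs where h: "hs = x # gs" "z \<in> ?Z" "is_walk (dsets n d) S w gs" "hd gs = z" "last gs = y" by auto
    then obtain gs' where "gs = z # gs'" using is_walkD by (cases gs) force+
    then show "hs \<in> {hs. is_walk (dsets n d) S (j # w) hs \<and> hd hs = x \<and> last hs = y}"
      using h Cons.prems by (auto simp: Un_commute)
  qed
  finally show ?case .
qed

lemma abs_trace_word_le: "\<bar>\<Sum>x\<in>dsets n d. word_matrix (dsets n d) S w x x\<bar> \<le> real (closed_count (dsets n d) S w)"
proof -
  let ?W = "\<lambda>x. {hs. is_walk (dsets n d) S w hs \<and> hd hs = x \<and> last hs = x}"
  have "\<bar>\<Sum>x\<in>dsets n d. word_matrix (dsets n d) S w x x\<bar> \<le> (\<Sum>x\<in>dsets n d. real (card (?W x)))"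
    by (rule order_trans[OF sum_abs sum_mono]) (rule abs_word_matrix_le)
  also have "\<dots> = real (card (\<Union>x\<in>dsets n d. ?W x))"
  proof -
    have "card (\<Union>x\<in>dsets n d. ?W x) = (\<Sum>x\<in>dsets n d. card (?W x))"
      using finite_walk_set[of w] by (intro card_UN_disjoint) auto
    then show ?thesis by simp
  qed
  also have "\<dots> \<le> real (closed_count (dsets n d) S w)"
    unfolding closed_count_def by (intro of_nat_mono card_mono finite_walk_set) auto
  finally show ?thesis .
qed

end

lemma sum_closed_count:
  "(\<Sum>S\<in>steiner_tuples n d k. closed_count (dsets n d) S w) = card {(S, hs) \<in> walks n d k w. hd hs = last hs}"
proof -
  have "finite {hs. is_walk (dsets n d) S w hs \<and> hd hs = last hs}" for S
    by (rule finite_subset[OF _ finite_lists_length_eq[of "dsets n d" "Suc (length w)"]]) (auto dest: is_walkD)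
  then have "card (SIGMA S:steiner_tuples n d k. {hs. is_walk (dsets n d) S w hs \<and> hd hs = last hs})
    = (\<Sum>S\<in>steiner_tuples n d k. closed_count (dsets n d) S w)"
    unfolding closed_count_def by (intro card_SigmaI) auto
  moreover have "(SIGMA S:steiner_tuples n d k. {hs. is_walk (dsets n d) S w hs \<and> hd hs = last hs})
    = {(S, hs) \<in> walks n d k w. hd hs = last hs}" by (auto simp: walks_def)
  ultimately show ?thesis by simp
qed

subsection \<open>Perturbation of traces of powers\<close>

fun mat_power :: "'b set \<Rightarrow> ('b \<Rightarrow> 'b \<Rightarrow> real) \<Rightarrow> nat \<Rightarrow> 'b \<Rightarrow> 'b \<Rightarrow> real" where
  "mat_power D M 0 x y = (if x = y then 1 else 0)"
| "mat_power D M (Suc m) x y = (\<Sum>z\<in>D. M x z * mat_power D M m z y)"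

lemma mat_power_eigenvector:
  assumes fin: "finite D" and b: "\<And>x. x \<in> D \<Longrightarrow> (\<Sum>y\<in>D. M x y * b y) = l * b x" and x: "x \<in> D"
  shows "(\<Sum>y\<in>D. mat_power D M m x y * b y) = l ^ m * b x"
  using x
proof (induction m arbitrary: x)
  case 0
  have "(\<Sum>y\<in>D. mat_power D M 0 x y * b y) = (\<Sum>y\<in>D. if y = x then b y else 0)" by (intro sum.cong refl) auto
  then show ?case using fin 0 by simp
next
  case (Suc m)
  have "(\<Sum>y\<in>D. mat_power D M (Suc m) x y * b y) = (\<Sum>y\<in>D. \<Sum>z\<in>D. M x z * (mat_power D M m z y * b y))"
    by (simp add: sum_distrib_right mult.assoc)
  also have "\<dots> = (\<Sum>z\<in>D. M x z * (\<Sum>y\<in>D. mat_power D M m z y * b y))"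
    by (subst sum.swap) (simp add: sum_distrib_left)
  also have "\<dots> = (\<Sum>z\<in>D. l ^ m * (M x z * b z))" using Suc.IH by (intro sum.cong refl) simp
  also have "\<dots> = l ^ m * (l * b x)" using b[OF Suc.prems] by (simp add: sum_distrib_left[symmetric])
  finally show ?case by simp
qed

lemma mat_power_row_sum_le:
  assumes C: "\<And>x. x \<in> D \<Longrightarrow> (\<Sum>y\<in>D. \<bar>M x y\<bar>) \<le> C" "0 \<le> C" and fin: "finite D" and x: "x \<in> D"
  shows "(\<Sum>y\<in>D. \<bar>mat_power D M m x y\<bar>) \<le> C ^ m"
  using x
proof (induction m arbitrary: x)
  case 0
  have "(\<Sum>y\<in>D. \<bar>mat_power D M 0 x y\<bar>) = (\<Sum>y\<in>D. if y = x then 1 else 0)" by (intro sum.cong refl) auto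
  then show ?case using fin 0 by simp
next
  case (Suc m)
  have "(\<Sum>y\<in>D. \<bar>mat_power D M (Suc m) x y\<bar>) \<le> (\<Sum>y\<in>D. \<Sum>z\<in>D. \<bar>M x z\<bar> * \<bar>mat_power D M m z y\<bar>)"
    unfolding mat_power.simps abs_mult[symmetric] by (intro sum_mono sum_abs)
  also have "\<dots> = (\<Sum>z\<in>D. \<bar>M x z\<bar> * (\<Sum>y\<in>D. \<bar>mat_power D M m z y\<bar>))"
    by (subst sum.swap) (simp add: sum_distrib_left)
  also have "\<dots> \<le> (\<Sum>z\<in>D. \<bar>M x z\<bar> * C ^ m)" using Suc.IH by (intro sum_mono mult_left_mono) auto
  also have "\<dots> \<le> C * C ^ m"
    unfolding sum_distrib_right[symmetric] using C Suc.prems by (intro mult_right_mono) auto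
  finally show ?case by simp
qed

text \<open>Telescoping: T^(m+1) - R^(m+1) = T (T^m - R^m) + (T - R) R^m, measured by the sum of the
  moduli of all entries.\<close>

lemma mat_power_diff_le:
  assumes fin: "finite D" and C: "1 \<le> C"
    and T: "\<And>x y. T x y = T y x" "\<And>x. x \<in> D \<Longrightarrow> (\<Sum>y\<in>D. \<bar>T x y\<bar>) \<le> C"
    and R: "\<And>x. x \<in> D \<Longrightarrow> (\<Sum>y\<in>D. \<bar>R x y\<bar>) \<le> C"
  shows "(\<Sum>x\<in>D. \<Sum>y\<in>D. \<bar>mat_power D T m x y - mat_power D R m x y\<bar>)
    \<le> real m * C ^ m * (\<Sum>x\<in>D. \<Sum>y\<in>D. \<bar>T x y - R x y\<bar>)"
proof (induction m)
  case 0
  then show ?case by simp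
next
  case (Suc m)
  let ?e = "\<Sum>x\<in>D. \<Sum>y\<in>D. \<bar>T x y - R x y\<bar>"
  let ?D = "\<lambda>x y. mat_power D T m x y - mat_power D R m x y"
  have e: "0 \<le> ?e" by (intro sum_nonneg) auto
  have "\<bar>mat_power D T (Suc m) x y - mat_power D R (Suc m) x y\<bar>
    \<le> (\<Sum>z\<in>D. \<bar>T x z\<bar> * \<bar>?D z y\<bar>) + (\<Sum>z\<in>D. \<bar>T x z - R x z\<bar> * \<bar>mat_power D R m z y\<bar>)" for x y
  proof -
    have eq: "mat_power D T (Suc m) x y - mat_power D R (Suc m) x y
      = (\<Sum>z\<in>D. T x z * ?D z y) + (\<Sum>z\<in>D. (T x z - R x z) * mat_power D R m z y)"
      unfolding mat_power.simps sum.distrib[symmetric] sum_subtractf[symmetric]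
      by (intro sum.cong refl) (simp add: algebra_simps)
    have "\<bar>mat_power D T (Suc m) x y - mat_power D R (Suc m) x y\<bar> \<le> \<bar>\<Sum>z\<in>D. T x z * ?D z y\<bar> + \<bar>\<Sum>z\<in>D. (T x z - R x z) * mat_power D R m z y\<bar>"
      unfolding eq by (rule abs_triangle_ineq)
    also have "\<dots> \<le> (\<Sum>z\<in>D. \<bar>T x z\<bar> * \<bar>?D z y\<bar>) + (\<Sum>z\<in>D. \<bar>T x z - R x z\<bar> * \<bar>mat_power D R m z y\<bar>)"
      by (rule add_mono; rule order_trans[OF sum_abs]) (simp_all only: abs_mult order_refl)
    finally show ?thesis .
  qed
  then have "(\<Sum>x\<in>D. \<Sum>y\<in>D. \<bar>mat_power D T (Suc m) x y - mat_power D R (Suc m) x y\<bar>)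
    \<le> (\<Sum>x\<in>D. \<Sum>y\<in>D. (\<Sum>z\<in>D. \<bar>T x z\<bar> * \<bar>?D z y\<bar>) + (\<Sum>z\<in>D. \<bar>T x z - R x z\<bar> * \<bar>mat_power D R m z y\<bar>))"
    by (intro sum_mono)
  also have "\<dots> = (\<Sum>x\<in>D. \<Sum>y\<in>D. \<Sum>z\<in>D. \<bar>T x z\<bar> * \<bar>?D z y\<bar>)
      + (\<Sum>x\<in>D. \<Sum>y\<in>D. \<Sum>z\<in>D. \<bar>T x z - R x z\<bar> * \<bar>mat_power D R m z y\<bar>)"
    by (simp only: sum.distrib)
  also have "\<dots> \<le> C * (real m * C ^ m * ?e) + C ^ m * ?e"
  proof (rule add_mono)
    have "(\<Sum>x\<in>D. \<Sum>y\<in>D. \<Sum>z\<in>D. \<bar>T x z\<bar> * \<bar>?D z y\<bar>) = (\<Sum>y\<in>D. \<Sum>z\<in>D. \<Sum>x\<in>D. \<bar>T x z\<bar> * \<bar>?D z y\<bar>)"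
      by (subst sum.swap, rule sum.cong[OF refl], rule sum.swap)
    \<comment> \<open>Summing over \<open>x\<close> first calls for column sums of \<open>T\<close>;
      symmetry turns them into row sums.\<close>
    also have "\<dots> = (\<Sum>y\<in>D. \<Sum>z\<in>D. (\<Sum>x\<in>D. \<bar>T z x\<bar>) * \<bar>?D z y\<bar>)"
      by (intro sum.cong refl) (simp only: sum_distrib_right T(1))
    also have "\<dots> \<le> (\<Sum>y\<in>D. \<Sum>z\<in>D. C * \<bar>?D z y\<bar>)" by (intro sum_mono mult_right_mono T(2)) auto
    also have "\<dots> = C * (\<Sum>z\<in>D. \<Sum>y\<in>D. \<bar>?D z y\<bar>)" by (subst sum.swap) (simp add: sum_distrib_left)
    also have "\<dots> \<le> C * (real m * C ^ m * ?e)" using Suc.IH C by (intro mult_left_mono) auto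
    finally show "(\<Sum>x\<in>D. \<Sum>y\<in>D. \<Sum>z\<in>D. \<bar>T x z\<bar> * \<bar>?D z y\<bar>) \<le> C * (real m * C ^ m * ?e)" .
    have "(\<Sum>x\<in>D. \<Sum>y\<in>D. \<Sum>z\<in>D. \<bar>T x z - R x z\<bar> * \<bar>mat_power D R m z y\<bar>)
      = (\<Sum>x\<in>D. \<Sum>z\<in>D. \<bar>T x z - R x z\<bar> * (\<Sum>y\<in>D. \<bar>mat_power D R m z y\<bar>))"
      by (rule sum.cong[OF refl], subst sum.swap) (simp only: sum_distrib_left)
    also have "\<dots> \<le> (\<Sum>x\<in>D. \<Sum>z\<in>D. \<bar>T x z - R x z\<bar> * C ^ m)"
      using C by (intro sum_mono mult_left_mono mat_power_row_sum_le[OF R _ fin]) auto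
    also have "\<dots> = C ^ m * ?e" by (simp add: sum_distrib_right[symmetric])
    finally show "(\<Sum>x\<in>D. \<Sum>y\<in>D. \<Sum>z\<in>D. \<bar>T x z - R x z\<bar> * \<bar>mat_power D R m z y\<bar>) \<le> C ^ m * ?e" .
  qed
  also have "\<dots> \<le> C * (real m * C ^ m * ?e) + C * C ^ m * ?e"
    using C e by (intro add_left_mono mult_right_mono) auto
  also have "\<dots> = real (Suc m) * C ^ Suc m * ?e" by (simp add: algebra_simps)
  finally show ?case .
qed

lemma trace_power_diff_le:
  assumes fin: "finite D" and C: "1 \<le> C"
    and T: "\<And>x y. T x y = T y x" "\<And>x. x \<in> D \<Longrightarrow> (\<Sum>y\<in>D. \<bar>T x y\<bar>) \<le> C"
    and R: "\<And>x. x \<in> D \<Longrightarrow> (\<Sum>y\<in>D. \<bar>R x y\<bar>) \<le> C"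
  shows "\<bar>(\<Sum>x\<in>D. mat_power D T m x x) - (\<Sum>x\<in>D. mat_power D R m x x)\<bar>
    \<le> real m * C ^ m * (\<Sum>x\<in>D. \<Sum>y\<in>D. \<bar>T x y - R x y\<bar>)"
proof -
  have "\<bar>(\<Sum>x\<in>D. mat_power D T m x x) - (\<Sum>x\<in>D. mat_power D R m x x)\<bar>
    \<le> (\<Sum>x\<in>D. \<bar>mat_power D T m x x - mat_power D R m x x\<bar>)"
    unfolding sum_subtractf[symmetric] by (rule sum_abs)
  also have "\<dots> \<le> (\<Sum>x\<in>D. \<Sum>y\<in>D. \<bar>mat_power D T m x y - mat_power D R m x y\<bar>)"
    using fin by (intro sum_mono member_le_sum) auto
  also have "\<dots> \<le> real m * C ^ m * (\<Sum>x\<in>D. \<Sum>y\<in>D. \<bar>T x y - R x y\<bar>)"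
    by (rule mat_power_diff_le[OF assms])
  finally show ?thesis .
qed

subsection \<open>Comparison of the complex with the sum of the blocks\<close>

definition union_cells :: "nat \<Rightarrow> (nat \<Rightarrow> nat set set) \<Rightarrow> nat set set" where
  "union_cells k S = (\<Union>j\<in>{1..k}. S j)"

definition laplace_matrix :: "nat set set \<Rightarrow> nat set \<Rightarrow> nat set \<Rightarrow> real" where
  "laplace_matrix Y t t' = (if t = t' then real (card {s \<in> Y. t \<subseteq> s}) else 0) + block_matrix Y t t'"

definition adjacency_matrix :: "nat set set \<Rightarrow> nat set \<Rightarrow> nat set \<Rightarrow> real" where
  "adjacency_matrix Y t t' = - block_matrix Y t t'"

text \<open>The idealised operators: (\<alpha>, \<beta>) = (k, 1) for the Laplacian and (0, -1) for
  adjacency.\<close>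

definition affine_matrix :: "real \<Rightarrow> real \<Rightarrow> nat \<Rightarrow> (nat \<Rightarrow> nat set set) \<Rightarrow> nat set \<Rightarrow> nat set \<Rightarrow> real" where
  "affine_matrix \<alpha> \<beta> k S x y = (if x = y then \<alpha> else 0) + \<beta> * sum_matrix k S x y"

text \<open>At such an \<open>x\<close> the union of the systems loses a multiplicity, which is the
  only source of deviation from the sum of the blocks.\<close>

definition repeated_cell :: "nat \<Rightarrow> (nat \<Rightarrow> nat set set) \<Rightarrow> nat set \<Rightarrow> bool" where
  "repeated_cell k S x \<longleftrightarrow> \<not> inj_on (\<lambda>j. cell (S j) x) {1..k}"

context
  fixes n d k :: nat and S :: "nat \<Rightarrow> nat set set"
  assumes d: "1 \<le> d" and k: "1 \<le> k" and S: "S \<in> steiner_tuples n d k"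
begin

lemma union_cellsD: "s \<in> union_cells k S \<Longrightarrow> s \<subseteq> {1..n} \<and> card s = d + 1"
proof -
  assume "s \<in> union_cells k S"
  then obtain j where "j \<in> {1..k}" "s \<in> S j" unfolding union_cells_def by blast
  then show ?thesis using steiner_systemD(1,2)[OF tuple_system[OF d k S]] by blast
qed

text \<open>From \<open>x\<close> to another facet of the shared cell by one system and back by the
  other is a closed walk with two distinct letters. Hence the walk estimate also controls these
  collisions; d >= 1 provides the other facet.\<close>

lemma card_repeated_cell_le:
  "card {x \<in> dsets n d. repeated_cell k S x} \<le> (\<Sum>w\<in>alt_words k 2. closed_count (dsets n d) S w)"
proof -
  let ?W = "\<lambda>w. {hs. is_walk (dsets n d) S w hs \<and> hd hs = last hs}"
  have fin: "finite (?W w)" for w by (rule finite_walk_set[OF d k S])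
  have "{x \<in> dsets n d. repeated_cell k S x} \<subseteq> (\<Union>w\<in>alt_words k 2. hd ` ?W w)"
  proof
    fix x assume "x \<in> {x \<in> dsets n d. repeated_cell k S x}"
    then have x: "x \<in> dsets n d" and "\<not> inj_on (\<lambda>j. cell (S j) x) {1..k}" by (auto simp: repeated_cell_def)
    then obtain i j where ij: "i \<in> {1..k}" "j \<in> {1..k}" "i \<noteq> j" "cell (S i) x = cell (S j) x"
      unfolding inj_on_def by blast
    let ?s = "cell (S i) x"
    have s: "?s \<in> S i" "x \<subseteq> ?s" using cell_in[OF tuple_system[OF d k S ij(1)] x] by auto
    have "card {z \<in> dsets n d. z \<subseteq> ?s} = d + 1" by (rule card_facets[OF tuple_system[OF d k S ij(1)] s(1)])
    then have "card ({z \<in> dsets n d. z \<subseteq> ?s} - {x}) = d" using x s by simp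
    then have "{z \<in> dsets n d. z \<subseteq> ?s} - {x} \<noteq> {}" using d by (metis card.empty not_one_le_zero)
    then obtain y where y: "y \<in> dsets n d" "y \<subseteq> ?s" "y \<noteq> x" by blast
    have "x \<union> y \<in> S i" "x \<union> y \<in> S j"
      using union_in_system_iff[OF tuple_system[OF d k S ij(1)] x y(1)] union_in_system_iff[OF tuple_system[OF d k S ij(2)] x y(1)] y ij(4)
      by auto
    then have "is_walk (dsets n d) S [i, j] [x, y, x]" using x y by (simp add: Un_commute)
    then have "[x, y, x] \<in> ?W [i, j]" by simp
    then have "x \<in> hd ` ?W [i, j]" by (rule rev_image_eqI) simp
    moreover have "[i, j] \<in> alt_words k 2" using ij by (simp add: alt_words_def)
    ultimately show "x \<in> (\<Union>w\<in>alt_words k 2. hd ` ?W w)" by blast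
  qed
  then have "card {x \<in> dsets n d. repeated_cell k S x} \<le> card (\<Union>w\<in>alt_words k 2. hd ` ?W w)"
    using fin by (intro card_mono) auto
  also have "\<dots> \<le> (\<Sum>w\<in>alt_words k 2. card (hd ` ?W w))" by (rule card_UN_le) simp
  also have "\<dots> \<le> (\<Sum>w\<in>alt_words k 2. closed_count (dsets n d) S w)"
    unfolding closed_count_def using fin by (intro sum_mono card_image_le) auto
  finally show ?thesis .
qed

lemma row_sum_block_le:
  assumes j: "j \<in> {1..k}" and x: "x \<in> dsets n d"
  shows "(\<Sum>y\<in>dsets n d. \<bar>block_matrix (S j) x y\<bar>) \<le> real d"
proof -
  let ?Z = "{y \<in> dsets n d. x \<noteq> y \<and> x \<union> y \<in> S j}"
  have "(\<Sum>y\<in>dsets n d. \<bar>block_matrix (S j) x y\<bar>) = (\<Sum>y\<in>?Z. \<bar>block_matrix (S j) x y\<bar>)"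
    by (rule sum.mono_neutral_right) (auto simp: block_matrix_def)
  also have "\<dots> \<le> (\<Sum>y\<in>?Z. 1)" by (intro sum_mono abs_block_matrix_le)
  also have "\<dots> \<le> real d" using card_steps_le[OF tuple_system[OF d k S j] x] by simp
  finally show ?thesis .
qed

lemma row_sum_blocks_le:
  assumes x: "x \<in> dsets n d"
  shows "(\<Sum>y\<in>dsets n d. \<Sum>j\<in>{1..k}. \<bar>block_matrix (S j) x y\<bar>) \<le> real k * real d"
proof -
  have "(\<Sum>y\<in>dsets n d. \<Sum>j\<in>{1..k}. \<bar>block_matrix (S j) x y\<bar>) = (\<Sum>j\<in>{1..k}. \<Sum>y\<in>dsets n d. \<bar>block_matrix (S j) x y\<bar>)"
    by (rule sum.swap)
  also have "\<dots> \<le> (\<Sum>j\<in>{1..k}. real d)" by (intro sum_mono row_sum_block_le x)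
  finally show ?thesis by simp
qed

lemma abs_union_block_le: "\<bar>block_matrix (union_cells k S) x y\<bar> \<le> (\<Sum>j\<in>{1..k}. \<bar>block_matrix (S j) x y\<bar>)"
proof (cases "x \<noteq> y \<and> x \<union> y \<in> union_cells k S")
  case True
  then obtain j where j: "j \<in> {1..k}" "x \<union> y \<in> S j" unfolding union_cells_def by blast
  then have "\<bar>block_matrix (union_cells k S) x y\<bar> = \<bar>block_matrix (S j) x y\<bar>" using True by (simp add: block_matrix_def)
  also have "\<dots> \<le> (\<Sum>j\<in>{1..k}. \<bar>block_matrix (S j) x y\<bar>)"
    by (rule member_le_sum) (use j in auto)
  finally show ?thesis .
next
  case False
  then have "block_matrix (union_cells k S) x y = 0" by (auto simp: block_matrix_def)
  then show ?thesis by (simp add: sum_nonneg)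
qed

lemma cells_containing: "x \<in> dsets n d \<Longrightarrow> {s \<in> union_cells k S. x \<subseteq> s} = (\<lambda>j. cell (S j) x) ` {1..k}"
proof (intro equalityI subsetI)
  fix s assume x: "x \<in> dsets n d" and "s \<in> {s \<in> union_cells k S. x \<subseteq> s}"
  then obtain j where j: "j \<in> {1..k}" "s \<in> S j" "x \<subseteq> s" by (auto simp: union_cells_def)
  then have "cell (S j) x = s" by (intro cell_eq[OF tuple_system[OF d k S] x])
  then show "s \<in> (\<lambda>j. cell (S j) x) ` {1..k}" using j by blast
next
  fix s assume x: "x \<in> dsets n d" and "s \<in> (\<lambda>j. cell (S j) x) ` {1..k}"
  then obtain j where j: "j \<in> {1..k}" "s = cell (S j) x" by blast
  then show "s \<in> {s \<in> union_cells k S. x \<subseteq> s}" using cell_in[OF tuple_system[OF d k S j(1)] x] by (auto simp: union_cells_def)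
qed

lemma degree_le: "x \<in> dsets n d \<Longrightarrow> card {s \<in> union_cells k S. x \<subseteq> s} \<le> k"
  unfolding cells_containing using card_image_le[of "{1..k}" "\<lambda>j. cell (S j) x"] by simp

text \<open>If \<open>x \<union> y\<close> belonged to two systems, it would be a common cell over
  \<open>x\<close>; so at most one summand is nonzero.\<close>

lemma union_block_eq:
  assumes x: "x \<in> dsets n d" and y: "y \<in> dsets n d" and nr: "\<not> repeated_cell k S x"
  shows "block_matrix (union_cells k S) x y = sum_matrix k S x y"
proof (cases "x \<noteq> y \<and> x \<union> y \<in> union_cells k S")
  case True
  then obtain j where j: "j \<in> {1..k}" "x \<union> y \<in> S j" unfolding union_cells_def by blast
  have z: "block_matrix (S i) x y = 0" if i: "i \<in> {1..k} - {j}" for i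
  proof (rule ccontr)
    assume "block_matrix (S i) x y \<noteq> 0"
    then have "x \<union> y \<in> S i" by (auto simp: block_matrix_def split: if_splits)
    then have "cell (S i) x = x \<union> y" using i by (intro cell_eq[OF tuple_system[OF d k S] x]) auto
    moreover have "cell (S j) x = x \<union> y" using j by (intro cell_eq[OF tuple_system[OF d k S] x]) auto
    ultimately have "cell (S i) x = cell (S j) x" by simp
    moreover have "inj_on (\<lambda>j. cell (S j) x) {1..k}" using nr by (simp add: repeated_cell_def)
    ultimately have "i = j" using i j(1) by (auto dest: inj_onD)
    then show False using i by simp
  qed
  have "sum_matrix k S x y = (\<Sum>i\<in>{j}. block_matrix (S i) x y)"
    unfolding sum_matrix_def by (rule sum.mono_neutral_right) (use j z in auto)
  then show ?thesis using True j by (simp add: block_matrix_def)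
next
  case False
  then have "block_matrix (S j) x y = 0" if "j \<in> {1..k}" for j
    using that by (auto simp: block_matrix_def union_cells_def)
  then have "sum_matrix k S x y = 0" by (simp add: sum_matrix_def)
  then show ?thesis using False by (auto simp: block_matrix_def)
qed

lemma CC_ge_1: "1 \<le> (real k * (real d + 1))"
proof -
  have "1 * 1 \<le> real k * (real d + 1)" using k by (intro mult_mono) auto
  then show ?thesis by simp
qed

lemma row_sum_laplace:
  assumes x: "x \<in> dsets n d"
  shows "(\<Sum>y\<in>dsets n d. \<bar>laplace_matrix (union_cells k S) x y\<bar>) \<le> (real k * (real d + 1))"
proof -
  have "(\<Sum>y\<in>dsets n d. \<bar>laplace_matrix (union_cells k S) x y\<bar>)
    \<le> (\<Sum>y\<in>dsets n d. (if y = x then real (card {s \<in> union_cells k S. x \<subseteq> s}) else 0) + (\<Sum>j\<in>{1..k}. \<bar>block_matrix (S j) x y\<bar>))"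
  proof (rule sum_mono)
    fix y
    have "\<bar>laplace_matrix (union_cells k S) x y\<bar> \<le> (if y = x then real (card {s \<in> union_cells k S. x \<subseteq> s}) else 0) + \<bar>block_matrix (union_cells k S) x y\<bar>"
      by (auto simp: laplace_matrix_def)
    then show "\<bar>laplace_matrix (union_cells k S) x y\<bar>
      \<le> (if y = x then real (card {s \<in> union_cells k S. x \<subseteq> s}) else 0) + (\<Sum>j\<in>{1..k}. \<bar>block_matrix (S j) x y\<bar>)"
      using abs_union_block_le[of x y] by linarith
  qed
  also have "\<dots> = real (card {s \<in> union_cells k S. x \<subseteq> s}) + (\<Sum>y\<in>dsets n d. \<Sum>j\<in>{1..k}. \<bar>block_matrix (S j) x y\<bar>)"
    using x by (simp add: sum.distrib)
  also have "\<dots> \<le> real k + real k * real d"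
    using degree_le[OF x] row_sum_blocks_le[OF x] by (intro add_mono) auto
  finally show ?thesis by (simp add: algebra_simps)
qed

lemma row_sum_adjacency:
  assumes x: "x \<in> dsets n d"
  shows "(\<Sum>y\<in>dsets n d. \<bar>adjacency_matrix (union_cells k S) x y\<bar>) \<le> (real k * (real d + 1))"
proof -
  have "(\<Sum>y\<in>dsets n d. \<bar>adjacency_matrix (union_cells k S) x y\<bar>) \<le> (\<Sum>y\<in>dsets n d. \<Sum>j\<in>{1..k}. \<bar>block_matrix (S j) x y\<bar>)"
    unfolding adjacency_matrix_def abs_minus_cancel by (intro sum_mono abs_union_block_le)
  also have "\<dots> \<le> real k * real d" by (rule row_sum_blocks_le[OF x])
  also have "\<dots> \<le> (real k * (real d + 1))" by (intro mult_left_mono) auto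
  finally show ?thesis .
qed

lemma row_sum_affine:
  assumes x: "x \<in> dsets n d" and ab: "\<bar>\<alpha>\<bar> \<le> real k" "\<bar>\<beta>\<bar> \<le> 1"
  shows "(\<Sum>y\<in>dsets n d. \<bar>affine_matrix \<alpha> \<beta> k S x y\<bar>) \<le> (real k * (real d + 1))"
proof -
  have "(\<Sum>y\<in>dsets n d. \<bar>affine_matrix \<alpha> \<beta> k S x y\<bar>)
    \<le> (\<Sum>y\<in>dsets n d. (if y = x then real k else 0) + (\<Sum>j\<in>{1..k}. \<bar>block_matrix (S j) x y\<bar>))"
  proof (rule sum_mono)
    fix y
    have "\<bar>sum_matrix k S x y\<bar> \<le> (\<Sum>j\<in>{1..k}. \<bar>block_matrix (S j) x y\<bar>)"
      unfolding sum_matrix_def by (rule sum_abs)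
    moreover have "\<bar>\<beta> * sum_matrix k S x y\<bar> \<le> 1 * \<bar>sum_matrix k S x y\<bar>"
      unfolding abs_mult using ab by (intro mult_right_mono) auto
    moreover have "\<bar>if x = y then \<alpha> else 0\<bar> \<le> (if y = x then real k else 0)" using ab by auto
    ultimately show "\<bar>affine_matrix \<alpha> \<beta> k S x y\<bar>
      \<le> (if y = x then real k else 0) + (\<Sum>j\<in>{1..k}. \<bar>block_matrix (S j) x y\<bar>)"
      unfolding affine_matrix_def by linarith
  qed
  also have "\<dots> = real k + (\<Sum>y\<in>dsets n d. \<Sum>j\<in>{1..k}. \<bar>block_matrix (S j) x y\<bar>)"
    using x by (simp add: sum.distrib)
  also have "\<dots> \<le> real k + real k * real d"
    using row_sum_blocks_le[OF x] by (intro add_left_mono)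
  finally show ?thesis by (simp add: algebra_simps)
qed

lemma laplace_matrix_eq:
  assumes "x \<in> dsets n d" "y \<in> dsets n d" "\<not> repeated_cell k S x"
  shows "laplace_matrix (union_cells k S) x y = affine_matrix (real k) 1 k S x y"
proof -
  have "card {s \<in> union_cells k S. x \<subseteq> s} = k"
    unfolding cells_containing[OF assms(1)] using assms(3) by (simp add: repeated_cell_def card_image)
  then show ?thesis by (auto simp: laplace_matrix_def affine_matrix_def union_block_eq[OF assms])
qed

lemma adjacency_matrix_eq:
  assumes "x \<in> dsets n d" "y \<in> dsets n d" "\<not> repeated_cell k S x"
  shows "adjacency_matrix (union_cells k S) x y = affine_matrix 0 (-1) k S x y"
  by (simp add: adjacency_matrix_def affine_matrix_def union_block_eq[OF assms])

text \<open>Only rows with a repeated cell can differ, and each of them costs at most the two row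
  sums.\<close>

lemma matrix_diff_le:
  assumes T: "\<And>x. x \<in> dsets n d \<Longrightarrow> (\<Sum>y\<in>dsets n d. \<bar>T x y\<bar>) \<le> (real k * (real d + 1))"
    and R: "\<And>x. x \<in> dsets n d \<Longrightarrow> (\<Sum>y\<in>dsets n d. \<bar>R x y\<bar>) \<le> (real k * (real d + 1))"
    and eq: "\<And>x y. x \<in> dsets n d \<Longrightarrow> y \<in> dsets n d \<Longrightarrow> \<not> repeated_cell k S x \<Longrightarrow> T x y = R x y"
  shows "(\<Sum>x\<in>dsets n d. \<Sum>y\<in>dsets n d. \<bar>T x y - R x y\<bar>) \<le> 2 * (real k * (real d + 1)) * (\<Sum>w\<in>alt_words k 2. real (closed_count (dsets n d) S w))"
proof -
  have "(\<Sum>x\<in>dsets n d. \<Sum>y\<in>dsets n d. \<bar>T x y - R x y\<bar>) \<le> (\<Sum>x\<in>dsets n d. if repeated_cell k S x then 2 * (real k * (real d + 1)) else 0)"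
  proof (rule sum_mono)
    fix x assume x: "x \<in> dsets n d"
    have "(\<Sum>y\<in>dsets n d. \<bar>T x y - R x y\<bar>) \<le> (\<Sum>y\<in>dsets n d. \<bar>T x y\<bar> + \<bar>R x y\<bar>)"
      by (intro sum_mono abs_triangle_ineq4)
    also have "\<dots> \<le> 2 * (real k * (real d + 1))" using T[OF x] R[OF x] by (simp add: sum.distrib)
    finally show "(\<Sum>y\<in>dsets n d. \<bar>T x y - R x y\<bar>) \<le> (if repeated_cell k S x then 2 * (real k * (real d + 1)) else 0)"
      using eq[OF x] by simp
  qed
  also have "\<dots> = (\<Sum>x\<in>{x \<in> dsets n d. repeated_cell k S x}. 2 * (real k * (real d + 1)))"
    by (intro sum.mono_neutral_cong_right) auto
  also have "\<dots> = 2 * (real k * (real d + 1)) * real (card {x \<in> dsets n d. repeated_cell k S x})" by simp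
  also have "\<dots> \<le> 2 * (real k * (real d + 1)) * real (\<Sum>w\<in>alt_words k 2. closed_count (dsets n d) S w)"
    by (intro mult_left_mono of_nat_mono card_repeated_cell_le) auto
  finally show ?thesis by simp
qed

end

subsection \<open>Spectral integrals\<close>

definition spec :: "'b set \<Rightarrow> ('b \<Rightarrow> 'b \<Rightarrow> real) \<Rightarrow> real measure" where
  "spec D M = esd (fsupp D) (matop D M)"

lemma spec_prob: "finite D \<Longrightarrow> D \<noteq> {} \<Longrightarrow> (\<And>x y. M x y = M y x) \<Longrightarrow> spec D M \<in> space (prob_algebra borel)"
  unfolding spec_def using ex_eigen_system[of D M] prob_esd_matop by blast

lemma spec_AE_bound:
  assumes "finite D" "D \<noteq> {}" "\<And>x y. M x y = M y x"
    and C: "\<And>x. x \<in> D \<Longrightarrow> (\<Sum>y\<in>D. \<bar>M x y\<bar>) \<le> C"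
  shows "AE x in spec D M. \<bar>x\<bar> \<le> C"
proof -
  obtain B evl where es: "eigen_system D M B evl"
    using ex_eigen_system[of D M, OF assms(1,2,3)] by blast
  note B = integral_esd_matop[OF es, folded spec_def] and evl = abs_eigenvalue_le[OF es]
    and p = prob_esd_matop[OF es, folded spec_def]
  interpret prob_space "spec D M" using p by (simp add: space_prob_algebra)
  have sets: "sets (spec D M) = sets borel" using p by (simp add: space_prob_algebra)
  have A: "{x. C < \<bar>x\<bar>} \<in> sets borel" by measurable
  then have "prob {x. C < \<bar>x\<bar>} = (\<integral>x. indicator {x. C < \<bar>x\<bar>} x \<partial>spec D M)"
    using sets sets_eq_imp_space_eq[OF sets] by simp
  also have "\<dots> = (\<Sum>b\<in>B. indicator {x. C < \<bar>x\<bar>} (evl b)) / real (card D)"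
    using A by (intro B) simp
  also have "(\<Sum>b\<in>B. indicator {x. C < \<bar>x\<bar>} (evl b)) = (0 :: real)"
    using evl[OF _ C] by (intro sum.neutral) (auto simp: indicator_def not_less)
  finally have "prob {x. C < \<bar>x\<bar>} = 0" by simp
  then have "AE x in spec D M. x \<notin> {x. C < \<bar>x\<bar>}" using A sets by (subst (asm) prob_eq_0) auto
  then show ?thesis by (simp add: not_less)
qed

lemma spec_power:
  assumes "finite D" "D \<noteq> {}" "\<And>x y. M x y = M y x"
  shows "(\<integral>x. x ^ m \<partial>spec D M) = (\<Sum>x\<in>D. mat_power D M m x x) / real (card D)"
proof -
  obtain B evl where es: "eigen_system D M B evl"
    using ex_eigen_system[of D M, OF assms] by blast
  note B = integral_esd_matop[OF es, folded spec_def] and eig = eigen_system_eigen[OF es]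
    and tr = trace_eq_sum_eigenvalues[OF es]
  have "(\<Sum>x\<in>D. mat_power D M m x x) = (\<Sum>b\<in>B. evl b ^ m)"
    by (rule tr) (rule mat_power_eigenvector[OF assms(1) eig])
  then show ?thesis by (subst B) auto
qed

context
  fixes n d k :: nat and S :: "nat \<Rightarrow> nat set set"
  assumes d: "1 \<le> d" and k: "1 \<le> k" and S: "S \<in> steiner_tuples n d k" and ne: "dsets n d \<noteq> {}"
begin

lemma spec_affine_power:
  "(\<integral>x. (\<alpha> + \<beta> * x) ^ m \<partial>spec (dsets n d) (sum_matrix k S))
    = (\<Sum>x\<in>dsets n d. mat_power (dsets n d) (affine_matrix \<alpha> \<beta> k S) m x x) / real (card (dsets n d))"
proof -
  let ?D = "dsets n d" and ?M = "sum_matrix k S"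
  obtain B evl where es: "eigen_system ?D ?M B evl"
    using ex_eigen_system[of ?D ?M, OF finite_dsets ne sum_matrix_sym[OF d k S]] by blast
  note B = integral_esd_matop[OF es, folded spec_def] and eig = eigen_system_eigen[OF es]
    and tr = trace_eq_sum_eigenvalues[OF es]
  have "(\<Sum>y\<in>?D. affine_matrix \<alpha> \<beta> k S x y * b y) = (\<alpha> + \<beta> * evl b) * b x" if b: "b \<in> B" and x: "x \<in> ?D" for b x
  proof -
    have "(\<Sum>y\<in>?D. affine_matrix \<alpha> \<beta> k S x y * b y) = (\<Sum>y\<in>?D. (if y = x then \<alpha> * b y else 0) + \<beta> * (?M x y * b y))"
      by (intro sum.cong refl) (simp add: affine_matrix_def distrib_right)
    also have "\<dots> = \<alpha> * b x + \<beta> * (\<Sum>y\<in>?D. ?M x y * b y)"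
      using x by (simp add: sum.distrib sum_distrib_left)
    finally show ?thesis unfolding eig[OF b x] by (simp add: algebra_simps)
  qed
  then have "(\<Sum>x\<in>?D. mat_power ?D (affine_matrix \<alpha> \<beta> k S) m x x) = (\<Sum>b\<in>B. (\<alpha> + \<beta> * evl b) ^ m)"
    by (intro tr mat_power_eigenvector[OF finite_dsets])
  then show ?thesis by (subst B) auto
qed

text \<open>The polynomial is chosen so that its spectral integral is the normalised trace of all
  alternating words, and each of these traces is bounded by closed walks.\<close>

lemma spec_word_poly_le:
  "\<bar>\<integral>x. word_poly (real d) (real k) m x \<partial>spec (dsets n d) (sum_matrix k S)\<bar>
    \<le> (\<Sum>w\<in>alt_words k m. real (closed_count (dsets n d) S w)) / real (card (dsets n d))"
proof -
  let ?D = "dsets n d" and ?M = "sum_matrix k S"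
  obtain B evl where es: "eigen_system ?D ?M B evl"
    using ex_eigen_system[of ?D ?M, OF finite_dsets ne sum_matrix_sym[OF d k S]] by blast
  note B = integral_esd_matop[OF es, folded spec_def] and eig = eigen_system_eigen[OF es]
    and tr = trace_eq_sum_eigenvalues[OF es]
  have t: "(\<Sum>x\<in>?D. \<Sum>w\<in>alt_words k m. word_matrix ?D S w x x) = (\<Sum>b\<in>B. word_poly (real d) (real k) m (evl b))"
    by (rule tr) (rule sum_words_eigenvector[OF d k S eig])
  have "(\<integral>x. word_poly (real d) (real k) m x \<partial>spec ?D ?M)
    = (\<Sum>x\<in>?D. \<Sum>w\<in>alt_words k m. word_matrix ?D S w x x) / real (card ?D)"
    unfolding t by (rule B[OF word_poly_measurable])
  also have "(\<Sum>x\<in>?D. \<Sum>w\<in>alt_words k m. word_matrix ?D S w x x) = (\<Sum>w\<in>alt_words k m. \<Sum>x\<in>?D. word_matrix ?D S w x x)"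
    by (rule sum.swap)
  finally have eq: "(\<integral>x. word_poly (real d) (real k) m x \<partial>spec ?D ?M)
    = (\<Sum>w\<in>alt_words k m. \<Sum>x\<in>?D. word_matrix ?D S w x x) / real (card ?D)" .
  have "\<bar>\<Sum>w\<in>alt_words k m. \<Sum>x\<in>?D. word_matrix ?D S w x x\<bar> \<le> (\<Sum>w\<in>alt_words k m. real (closed_count ?D S w))"
    by (rule order_trans[OF sum_abs sum_mono]) (rule abs_trace_word_le[OF d k S])
  then show ?thesis unfolding eq abs_divide by (simp add: divide_right_mono)
qed

lemma spec_compare:
  assumes sym: "\<And>x y. T x y = T y x" and T: "\<And>x. x \<in> dsets n d \<Longrightarrow> (\<Sum>y\<in>dsets n d. \<bar>T x y\<bar>) \<le> real k * (real d + 1)"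
    and ab: "\<bar>\<alpha>\<bar> \<le> real k" "\<bar>\<beta>\<bar> \<le> 1"
    and eq: "\<And>x y. x \<in> dsets n d \<Longrightarrow> y \<in> dsets n d \<Longrightarrow> \<not> repeated_cell k S x \<Longrightarrow> T x y = affine_matrix \<alpha> \<beta> k S x y"
  shows "\<bar>(\<integral>x. x ^ m \<partial>spec (dsets n d) T) - (\<integral>x. (\<alpha> + \<beta> * x) ^ m \<partial>spec (dsets n d) (sum_matrix k S))\<bar>
    \<le> real m * (real k * (real d + 1)) ^ m * (2 * (real k * (real d + 1)))
      * ((\<Sum>w\<in>alt_words k 2. real (closed_count (dsets n d) S w)) / real (card (dsets n d)))"
proof -
  let ?D = "dsets n d" and ?C = "real k * (real d + 1)" and ?R = "affine_matrix \<alpha> \<beta> k S"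
  have R: "(\<Sum>y\<in>?D. \<bar>?R x y\<bar>) \<le> ?C" if "x \<in> ?D" for x by (rule row_sum_affine[OF d k S that ab])
  have "\<bar>(\<Sum>x\<in>?D. mat_power ?D T m x x) - (\<Sum>x\<in>?D. mat_power ?D ?R m x x)\<bar>
    \<le> real m * ?C ^ m * (\<Sum>x\<in>?D. \<Sum>y\<in>?D. \<bar>T x y - ?R x y\<bar>)"
    by (rule trace_power_diff_le[OF finite_dsets CC_ge_1[OF d k S] sym T R])
  also have "\<dots> \<le> real m * ?C ^ m * (2 * ?C * (\<Sum>w\<in>alt_words k 2. real (closed_count ?D S w)))"
    by (intro mult_left_mono matrix_diff_le[OF d k S T R eq]) auto
  finally have "\<bar>(\<Sum>x\<in>?D. mat_power ?D T m x x) - (\<Sum>x\<in>?D. mat_power ?D ?R m x x)\<bar> / real (card ?D)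
    \<le> real m * ?C ^ m * (2 * ?C * (\<Sum>w\<in>alt_words k 2. real (closed_count ?D S w))) / real (card ?D)"
    by (rule divide_right_mono) simp
  then show ?thesis
    unfolding spec_power[OF finite_dsets ne sym] spec_affine_power
    by (simp add: diff_divide_distrib[symmetric] mult.assoc)
qed

end

subsection \<open>Compactly supported laws\<close>

definition bounded_law :: "real \<Rightarrow> real measure \<Rightarrow> bool" where
  "bounded_law C \<mu> \<longleftrightarrow> prob_space \<mu> \<and> sets \<mu> = sets borel \<and> (AE x in \<mu>. \<bar>x\<bar> \<le> C)"

lemma bounded_law_AE_le:
  fixes f :: "real \<Rightarrow> real"
  assumes \<mu>: "bounded_law C \<mu>" and f: "continuous_on UNIV f" and b: "\<And>x. x \<in> {-C..C} \<Longrightarrow> \<bar>f x\<bar> \<le> b"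
  shows "integrable \<mu> f" "\<bar>\<integral>x. f x \<partial>\<mu>\<bar> \<le> b"
proof -
  interpret prob_space \<mu> using \<mu> by (simp add: bounded_law_def)
  have AE: "AE x in \<mu>. \<bar>x\<bar> \<le> C" and sets: "sets \<mu> = sets borel" using \<mu> by (simp_all add: bounded_law_def)
  have meas: "f \<in> borel_measurable \<mu>"
    using borel_measurable_continuous_onI[OF f] measurable_cong_sets[OF sets refl] by blast
  have le: "AE x in \<mu>. \<bar>f x\<bar> \<le> b" using AE by eventually_elim (rule b, auto simp: abs_le_iff)
  show int: "integrable \<mu> f" by (rule integrable_const_bound[OF _ meas]) (use le in simp)
  have "\<bar>\<integral>x. f x \<partial>\<mu>\<bar> \<le> (\<integral>x. \<bar>f x\<bar> \<partial>\<mu>)" by (rule integral_abs_bound)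
  also have "\<dots> \<le> (\<integral>x. b \<partial>\<mu>)" using int le by (intro integral_mono_AE) auto
  also have "\<dots> = b" by (simp add: prob_space)
  finally show "\<bar>\<integral>x. f x \<partial>\<mu>\<bar> \<le> b" .
qed

lemma bounded_law_integrable:
  assumes \<mu>: "bounded_law C \<mu>" and f: "continuous_on UNIV f"
  shows "integrable \<mu> (f :: real \<Rightarrow> real)"
proof -
  have "compact (f ` {-C..C})" by (intro compact_continuous_image continuous_on_subset[OF f]) auto
  then obtain b where "\<And>y. y \<in> f ` {-C..C} \<Longrightarrow> norm y \<le> b" using compact_imp_bounded bounded_iff by metis
  then show ?thesis by (intro bounded_law_AE_le(1)[OF \<mu> f, of b]) auto
qed

lemma bounded_law_mono: "bounded_law C \<mu> \<Longrightarrow> C \<le> C' \<Longrightarrow> bounded_law C' \<mu>"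
  unfolding bounded_law_def by (auto elim!: eventually_mono)

lemma bounded_law_nu:
  assumes "1 \<le> d" "d + 1 \<le> k"
  shows "bounded_law ((sqrt (real k - 1) + sqrt (real d))\<^sup>2) (nu d k)"
proof -
  have m: "I_int d k \<in> sets borel" by (simp add: I_int_def)
  have "AE x in nu d k. \<bar>x\<bar> \<le> (sqrt (real k - 1) + sqrt (real d))\<^sup>2"
    unfolding nu_def
  proof (subst AE_density)
    show "(\<lambda>x. ennreal (indicator (I_int d k) x * (real k * sqrt (4 * (real k - 1) * real d - (real k - 1 + real d - x)\<^sup>2) /
       (2 * pi * x * ((real d + 1) * real k - x))))) \<in> borel_measurable lborel"
      using m by measurable
    have "\<bar>x\<bar> \<le> (sqrt (real k - 1) + sqrt (real d))\<^sup>2" if "x \<in> I_int d k" for x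
    proof -
      have "0 \<le> x" using that by (auto simp: I_int_def intro: order_trans[OF zero_le_power2])
      then show ?thesis using that by (simp add: I_int_def)
    qed
    then show "AE x in lborel. 0 < ennreal (indicator (I_int d k) x * (real k * sqrt (4 * (real k - 1) * real d - (real k - 1 + real d - x)\<^sup>2) /
       (2 * pi * x * ((real d + 1) * real k - x)))) \<longrightarrow> \<bar>x\<bar> \<le> (sqrt (real k - 1) + sqrt (real d))\<^sup>2"
      by (intro AE_I2) (auto simp: indicator_def)
  qed
  moreover have "sets (nu d k) = sets borel" by (simp add: nu_def)
  ultimately show ?thesis using prob_space_nu[OF assms] unfolding bounded_law_def by blast
qed

lemma bounded_law_distr:
  assumes \<mu>: "bounded_law C \<mu>" and g: "continuous_on UNIV g" "\<And>x. \<bar>x\<bar> \<le> C \<Longrightarrow> \<bar>g x\<bar> \<le> C'"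
  shows "bounded_law C' (distr \<mu> borel g)"
proof -
  have \<mu>': "prob_space \<mu>" "sets \<mu> = sets borel" "AE x in \<mu>. \<bar>x\<bar> \<le> C" using \<mu> by (simp_all add: bounded_law_def)
  have m: "g \<in> measurable \<mu> borel"
    using borel_measurable_continuous_onI[OF g(1)] measurable_cong_sets[OF \<mu>'(2) refl] by blast
  have "AE x in distr \<mu> borel g. \<bar>x\<bar> \<le> C'"
    by (subst AE_distr_iff[OF m]) (use \<mu>'(3) g(2) in auto)
  then show ?thesis using prob_space.prob_space_distr[OF \<mu>'(1) m] by (simp add: bounded_law_def)
qed

subsection \<open>Convergence in mean of spectral integrals\<close>

definition avg :: "'s set \<Rightarrow> ('s \<Rightarrow> real) \<Rightarrow> real" where
  "avg A F = (\<Sum>S\<in>A. F S) / real (card A)"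

lemma avg_mono: "(\<And>S. S \<in> A \<Longrightarrow> F S \<le> G S) \<Longrightarrow> avg A F \<le> avg A G"
  unfolding avg_def by (intro divide_right_mono sum_mono) auto

lemma avg_nonneg: "(\<And>S. S \<in> A \<Longrightarrow> 0 \<le> F S) \<Longrightarrow> 0 \<le> avg A F"
  unfolding avg_def by (intro divide_nonneg_nonneg sum_nonneg) auto

lemma avg_add: "avg A (\<lambda>S. F S + G S) = avg A F + avg A G"
  by (simp add: avg_def sum.distrib add_divide_distrib)

lemma avg_cmult: "avg A (\<lambda>S. c * F S) = c * avg A F"
  by (simp add: avg_def sum_distrib_left)

lemma avg_sum: "avg A (\<lambda>S. \<Sum>w\<in>W. F w S) = (\<Sum>w\<in>W. avg A (F w))"
  by (simp add: avg_def sum_divide_distrib sum.swap[of _ W A])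

lemma avg_tendsto_0_bound:
  assumes "\<And>i S. S \<in> A i \<Longrightarrow> 0 \<le> F i S" "\<And>i S. S \<in> A i \<Longrightarrow> F i S \<le> G i S" "(\<lambda>i. avg (A i) (G i)) \<longlonglongrightarrow> 0"
  shows "(\<lambda>i. avg (A i) (F i)) \<longlonglongrightarrow> 0"
proof (rule tendsto_sandwich[OF _ _ tendsto_const assms(3)])
  show "\<forall>\<^sub>F i in sequentially. 0 \<le> avg (A i) (F i)" using assms(1) by (intro always_eventually allI avg_nonneg)
  show "\<forall>\<^sub>F i in sequentially. avg (A i) (F i) \<le> avg (A i) (G i)" using assms(2) by (intro always_eventually allI avg_mono)
qed

text \<open>Convergence in mean is stable under linear combinations of test functions and passes to
  convergence in probability by Markov's inequality. Continuity of \<open>f\<close> is included so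
  that the integrals exist and add up.\<close>

definition mean_conv :: "(nat \<Rightarrow> 's set) \<Rightarrow> (nat \<Rightarrow> 's \<Rightarrow> real measure) \<Rightarrow> real measure \<Rightarrow> (real \<Rightarrow> real) \<Rightarrow> bool" where
  "mean_conv \<Omega> \<rho> \<tau> f \<longleftrightarrow> continuous_on UNIV f \<and>
     (\<lambda>i. avg (\<Omega> i) (\<lambda>S. \<bar>(\<integral>x. f x \<partial>\<rho> i S) - (\<integral>x. f x \<partial>\<tau>)\<bar>)) \<longlonglongrightarrow> 0"

context
  fixes \<Omega> :: "nat \<Rightarrow> 's set" and \<rho> :: "nat \<Rightarrow> 's \<Rightarrow> real measure" and \<tau> :: "real measure" and C :: real
  assumes \<rho>: "\<And>i S. S \<in> \<Omega> i \<Longrightarrow> bounded_law C (\<rho> i S)" and \<tau>: "bounded_law C \<tau>"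
begin

lemma mean_conv_add:
  assumes f: "mean_conv \<Omega> \<rho> \<tau> f" and g: "mean_conv \<Omega> \<rho> \<tau> g"
  shows "mean_conv \<Omega> \<rho> \<tau> (\<lambda>x. f x + g x)"
proof -
  have cf: "continuous_on UNIV f" and cg: "continuous_on UNIV g" using f g by (simp_all add: mean_conv_def)
  have lin: "(\<integral>x. f x + g x \<partial>\<mu>) = (\<integral>x. f x \<partial>\<mu>) + (\<integral>x. g x \<partial>\<mu>)" if "bounded_law C \<mu>" for \<mu>
    using bounded_law_integrable[OF that cf] bounded_law_integrable[OF that cg] by simp
  let ?F = "\<lambda>f i S. \<bar>(\<integral>x. f x \<partial>\<rho> i S) - (\<integral>x. f x \<partial>\<tau>)\<bar>"
  have "(\<lambda>i. avg (\<Omega> i) (\<lambda>S. ?F f i S + ?F g i S)) \<longlonglongrightarrow> 0"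
    unfolding avg_add using f g by (intro tendsto_add_zero) (simp_all add: mean_conv_def)
  then have "(\<lambda>i. avg (\<Omega> i) (?F (\<lambda>x. f x + g x) i)) \<longlonglongrightarrow> 0"
    by (rule avg_tendsto_0_bound[rotated 2]) (auto simp: lin[OF \<rho>] lin[OF \<tau>])
  then show ?thesis using cf cg unfolding mean_conv_def by (simp add: continuous_on_add)
qed

lemma mean_conv_cmult:
  assumes f: "mean_conv \<Omega> \<rho> \<tau> f"
  shows "mean_conv \<Omega> \<rho> \<tau> (\<lambda>x. c * f x)"
proof -
  have "(\<lambda>i. avg (\<Omega> i) (\<lambda>S. \<bar>(\<integral>x. c * f x \<partial>\<rho> i S) - (\<integral>x. c * f x \<partial>\<tau>)\<bar>)) =
    (\<lambda>i. \<bar>c\<bar> * avg (\<Omega> i) (\<lambda>S. \<bar>(\<integral>x. f x \<partial>\<rho> i S) - (\<integral>x. f x \<partial>\<tau>)\<bar>))"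
    by (simp add: avg_cmult[symmetric] abs_mult[symmetric] right_diff_distrib)
  moreover have "\<dots> \<longlonglongrightarrow> 0" using f by (intro tendsto_mult_right_zero) (simp add: mean_conv_def)
  ultimately show ?thesis using f unfolding mean_conv_def by (simp add: continuous_on_mult_left)
qed

lemma mean_conv_const: "mean_conv \<Omega> \<rho> \<tau> (\<lambda>x. c)"
proof -
  have one: "measure \<mu> (space \<mu>) = 1" if "bounded_law C \<mu>" for \<mu>
    using that by (intro prob_space.prob_space) (simp add: bounded_law_def)
  then have "(\<lambda>i. avg (\<Omega> i) (\<lambda>S. \<bar>(\<integral>x. c \<partial>\<rho> i S) - (\<integral>x. c \<partial>\<tau>)\<bar>)) = (\<lambda>i. 0)"
    by (simp add: avg_def one[OF \<rho>] one[OF \<tau>])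
  then show ?thesis by (simp add: mean_conv_def)
qed

lemma mean_conv_sum:
  "finite A \<Longrightarrow> (\<And>j. j \<in> A \<Longrightarrow> mean_conv \<Omega> \<rho> \<tau> (f j)) \<Longrightarrow> mean_conv \<Omega> \<rho> \<tau> (\<lambda>x. \<Sum>j\<in>A. f j x)"
proof (induction A rule: finite_induct)
  case empty
  then show ?case using mean_conv_const[of 0] by simp
next
  case (insert j A)
  then show ?case by (simp add: mean_conv_add)
qed

text \<open>Moments determine the limit because all laws live on one compact interval, where polynomials
  are uniformly dense.\<close>

lemma mean_conv_imp_in_probability:
  assumes fin: "\<And>i. finite (\<Omega> i)" and pow: "\<And>m. mean_conv \<Omega> \<rho> \<tau> (\<lambda>x. x ^ m)"
    and f: "continuous_on UNIV (f :: real \<Rightarrow> real)" and \<epsilon>: "0 < \<epsilon>"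
  shows "(\<lambda>i. real (card {S \<in> \<Omega> i. \<bar>(\<integral>x. f x \<partial>\<rho> i S) - (\<integral>x. f x \<partial>\<tau>)\<bar> > \<epsilon>}) / real (card (\<Omega> i))) \<longlonglongrightarrow> 0"
proof -
  \<comment> \<open>Each of the two laws loses at most \<epsilon> / 4 in the approximation, which
    leaves a deviation of \<epsilon> / 2 to the polynomial.\<close>
  obtain p where p: "real_polynomial_function p" "\<And>x. x \<in> {-C..C} \<Longrightarrow> \<bar>f x - p x\<bar> < \<epsilon> / 4"
    using Stone_Weierstrass_real_polynomial_function[of "{-C..C}" f "\<epsilon> / 4"] continuous_on_subset[OF f] \<epsilon> by auto
  obtain a m where pa: "p = (\<lambda>x. \<Sum>i\<le>m. a i * x ^ i)" using p(1) real_polynomial_function_iff_sum by blast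
  have mc: "mean_conv \<Omega> \<rho> \<tau> p" unfolding pa by (intro mean_conv_sum mean_conv_cmult pow) simp
  then have cp: "continuous_on UNIV p" by (simp add: mean_conv_def)
  have near: "\<bar>(\<integral>x. f x \<partial>\<mu>) - (\<integral>x. p x \<partial>\<mu>)\<bar> \<le> \<epsilon> / 4" if \<mu>: "bounded_law C \<mu>" for \<mu>
  proof -
    have "\<bar>\<integral>x. f x - p x \<partial>\<mu>\<bar> \<le> \<epsilon> / 4"
      by (rule bounded_law_AE_le(2)[OF \<mu> continuous_on_diff[OF f cp]]) (use p(2) in force)
    then show ?thesis using bounded_law_integrable[OF \<mu> f] bounded_law_integrable[OF \<mu> cp] by simp
  qed
  let ?P = "\<lambda>i S. \<bar>(\<integral>x. p x \<partial>\<rho> i S) - (\<integral>x. p x \<partial>\<tau>)\<bar>"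
  have ind: "real (card {S \<in> \<Omega> i. \<bar>(\<integral>x. f x \<partial>\<rho> i S) - (\<integral>x. f x \<partial>\<tau>)\<bar> > \<epsilon>}) / real (card (\<Omega> i))
    = avg (\<Omega> i) (\<lambda>S. of_bool (\<bar>(\<integral>x. f x \<partial>\<rho> i S) - (\<integral>x. f x \<partial>\<tau>)\<bar> > \<epsilon>))" for i
    using fin[of i] by (simp add: avg_def sum_of_bool_eq Int_def Collect_conj_eq[symmetric])
  have "(\<lambda>i. avg (\<Omega> i) (\<lambda>S. 2 / \<epsilon> * ?P i S)) \<longlonglongrightarrow> 0"
    unfolding avg_cmult using mc by (intro tendsto_mult_right_zero) (simp add: mean_conv_def)
  then have "(\<lambda>i. avg (\<Omega> i) (\<lambda>S. of_bool (\<bar>(\<integral>x. f x \<partial>\<rho> i S) - (\<integral>x. f x \<partial>\<tau>)\<bar> > \<epsilon>))) \<longlonglongrightarrow> 0"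
  proof (rule avg_tendsto_0_bound[rotated 2])
    fix i S assume S: "S \<in> \<Omega> i"
    show "of_bool (\<bar>(\<integral>x. f x \<partial>\<rho> i S) - (\<integral>x. f x \<partial>\<tau>)\<bar> > \<epsilon>) \<le> 2 / \<epsilon> * ?P i S"
    proof (cases "\<bar>(\<integral>x. f x \<partial>\<rho> i S) - (\<integral>x. f x \<partial>\<tau>)\<bar> > \<epsilon>")
      case True
      \<comment> \<open>Markov's inequality in pointwise form.\<close>
      then have "\<epsilon> / 2 \<le> ?P i S" using near[OF \<rho>[OF S]] near[OF \<tau>] by linarith
      then show ?thesis using True \<epsilon> by (simp add: field_simps)
    qed (use \<epsilon> in simp)
  qed simp
  then show ?thesis unfolding ind .
qed

end

subsection \<open>Moments of the random complexes\<close>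

context
  fixes d k :: nat and n :: "nat \<Rightarrow> nat"
  assumes d: "1 \<le> d" and k: "d + 1 \<le> k" and n: "filterlim n at_top sequentially"
    and nd: "\<And>i. d \<le> n i" and ex: "\<And>i. steiner_systems (n i) d \<noteq> {}"
begin

abbreviation "tuples i \<equiv> steiner_tuples (n i) d k"

abbreviation "num_dsets i \<equiv> real (card (dsets (n i) d))"

lemma one_le_k: "1 \<le> k" using k by simp

lemma dsets_nonempty: "dsets (n i) d \<noteq> {}"
proof -
  have "{1..d} \<in> dsets (n i) d" using nd[of i] by (auto simp: dsets_def)
  then show ?thesis by blast
qed

lemma num_dsets_pos: "0 < num_dsets i" using dsets_nonempty by (simp add: card_gt_0_iff)

lemma tuples_nonempty: "tuples i \<noteq> {}" using ex[of i] by (simp add: steiner_tuples_def PiE_eq_empty_iff)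

lemma tuples_pos: "0 < real (card (tuples i))" using tuples_nonempty by (simp add: card_gt_0_iff)

text \<open>The average is the number of pairs of a tuple and a closed walk, normalised; for a fixed
  word the bound is of order 1 / n.\<close>

lemma avg_closed_count:
  assumes w: "w \<in> alt_words k m" and m: "1 \<le> m"
  shows "(\<lambda>i. avg (tuples i) (\<lambda>S. real (closed_count (dsets (n i) d) S w) / num_dsets i)) \<longlonglongrightarrow> 0"
proof -
  have w': "set w \<subseteq> {1..k}" "distinct_adj w" "w \<noteq> []" "length w = m" using w m by (auto simp: alt_words_def)
  let ?c = "real m * real d ^ m"
  have le: "\<forall>\<^sub>F i in sequentially. avg (tuples i) (\<lambda>S. real (closed_count (dsets (n i) d) S w) / num_dsets i)
      \<le> ?c * (real (d * m) / real (n i - d * m))"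
  proof -
    have "\<forall>\<^sub>F i in sequentially. d * m + 1 \<le> n i" using n by (simp add: filterlim_at_top)
    then show ?thesis
    proof eventually_elim
      case (elim i)
      have eq: "(\<Sum>S\<in>tuples i. real (closed_count (dsets (n i) d) S w)) = real (card {(S, hs) \<in> walks (n i) d k w. hd hs = last hs})"
        unfolding sum_closed_count[symmetric] by simp
      have "avg (tuples i) (\<lambda>S. real (closed_count (dsets (n i) d) S w) / num_dsets i)
        = real (card {(S, hs) \<in> walks (n i) d k w. hd hs = last hs}) / (real (card (tuples i)) * num_dsets i)"
        unfolding avg_def sum_divide_distrib[symmetric] eq by (simp add: mult.commute)
      also have "\<dots> \<le> (?c * (real (d * m) / real (n i - d * m)) * (real (card (tuples i)) * num_dsets i)) / (real (card (tuples i)) * num_dsets i)"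
        using card_closed_walks_le[OF d w'(1,2,3), of "n i"] elim w'(4)
        by (intro divide_right_mono) (simp_all add: mult.assoc)
      also have "\<dots> = ?c * (real (d * m) / real (n i - d * m))"
        using mult_pos_pos[OF tuples_pos[of i] num_dsets_pos[of i]] by (intro nonzero_mult_div_cancel_right) linarith
      finally show ?case .
    qed
  qed
  have "filterlim (\<lambda>i. real (n i - d * m)) at_top sequentially"
    by (intro filterlim_compose[OF filterlim_real_sequentially]
        filterlim_compose[OF filterlim_minus_const_nat_at_top n])
  then have "(\<lambda>i. ?c * (real (d * m) / real (n i - d * m))) \<longlonglongrightarrow> ?c * 0"
    by (intro tendsto_mult tendsto_const real_tendsto_divide_at_top[OF tendsto_const])
  then have lim: "(\<lambda>i. ?c * (real (d * m) / real (n i - d * m))) \<longlonglongrightarrow> 0" by simp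
  show ?thesis
    by (rule tendsto_sandwich[OF _ le tendsto_const lim])
      (auto intro!: always_eventually avg_nonneg)
qed

lemma avg_sum_closed_count:
  "1 \<le> m \<Longrightarrow> (\<lambda>i. avg (tuples i) (\<lambda>S. (\<Sum>w\<in>alt_words k m. real (closed_count (dsets (n i) d) S w)) / num_dsets i)) \<longlonglongrightarrow> 0"
  unfolding sum_divide_distrib avg_sum by (intro tendsto_null_sum avg_closed_count)

abbreviation "block_law i S \<equiv> spec (dsets (n i) d) (sum_matrix k S)"

text \<open>The shift by \<open>k\<close> removes the diagonal of the Laplacian, leaving the sum of
  the blocks.\<close>

abbreviation "block_limit \<equiv> distr (nu d k) borel (\<lambda>x. x - real k)"

text \<open>A crude common bound: the upper end of \<open>I_int d k\<close>, the shift or reflection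
  by \<open>k\<close>, and the row sums of the matrices.\<close>

abbreviation "law_bound \<equiv> (sqrt (real k - 1) + sqrt (real d))\<^sup>2 + real k + real k * (real d + 1)"

lemma bounded_law_spec:
  assumes sym: "\<And>x y. T x y = T y x"
    and T: "\<And>x. x \<in> dsets (n i) d \<Longrightarrow> (\<Sum>y\<in>dsets (n i) d. \<bar>T x y\<bar>) \<le> real k * (real d + 1)"
  shows "bounded_law law_bound (spec (dsets (n i) d) T)"
proof (rule bounded_law_mono)
  show "bounded_law (real k * (real d + 1)) (spec (dsets (n i) d) T)"
    using spec_AE_bound[OF finite_dsets dsets_nonempty sym T] spec_prob[OF finite_dsets dsets_nonempty sym, of i]
    by (simp add: bounded_law_def space_prob_algebra)
qed simp

lemma bounded_block_law: "S \<in> tuples i \<Longrightarrow> bounded_law law_bound (block_law i S)"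
proof (rule bounded_law_spec)
  assume S: "S \<in> tuples i"
  show "sum_matrix k S x y = sum_matrix k S y x" for x y by (rule sum_matrix_sym[OF d one_le_k S])
  show "(\<Sum>y\<in>dsets (n i) d. \<bar>sum_matrix k S x y\<bar>) \<le> real k * (real d + 1)" if "x \<in> dsets (n i) d" for x
    using row_sum_affine[OF d one_le_k S that, of 0 1] by (simp add: affine_matrix_def)
qed

lemma bounded_block_limit: "bounded_law law_bound block_limit"
  by (rule bounded_law_mono[OF bounded_law_distr[OF bounded_law_nu[OF d k], where C' = "(sqrt (real k - 1) + sqrt (real d))\<^sup>2 + real k"]])
    (auto intro!: continuous_intros)

lemma integral_block_limit:
  assumes "continuous_on UNIV f"
  shows "(\<integral>x. f x \<partial>block_limit) = (\<integral>x. (f (x - real k) :: real) \<partial>nu d k)"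
  by (rule integral_distr) (auto simp: nu_def borel_measurable_continuous_onI[OF assms])

abbreviation "block_conv \<equiv> mean_conv tuples block_law block_limit"

lemma block_conv_const: "block_conv (\<lambda>x. c)"
  by (rule mean_conv_const[OF _ bounded_block_limit]) (rule bounded_block_law)

lemma block_conv_add: "block_conv f \<Longrightarrow> block_conv g \<Longrightarrow> block_conv (\<lambda>x. f x + g x)"
  by (rule mean_conv_add[OF _ bounded_block_limit]) (rule bounded_block_law)

lemma block_conv_cmult: "block_conv f \<Longrightarrow> block_conv (\<lambda>x. c * f x)"
  by (rule mean_conv_cmult[OF _ bounded_block_limit]) (rule bounded_block_law)

lemma block_conv_word_poly: "block_conv (word_poly (real d) (real k) m)"
proof (cases m)
  case 0
  then show ?thesis
    using block_conv_const[of 1] by (simp add: word_poly.simps(1)[abs_def])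
next
  case (Suc l)
  have z: "(\<integral>x. word_poly (real d) (real k) m x \<partial>block_limit) = 0"
    unfolding integral_block_limit[OF continuous_word_poly] unfolding Suc by (rule integral_nu_word_poly[OF d k])
  have "(\<lambda>i. avg (tuples i) (\<lambda>S. \<bar>(\<integral>x. word_poly (real d) (real k) m x \<partial>block_law i S)
      - (\<integral>x. word_poly (real d) (real k) m x \<partial>block_limit)\<bar>)) \<longlonglongrightarrow> 0"
    unfolding z diff_0_right
    by (rule avg_tendsto_0_bound[OF _ spec_word_poly_le[OF d one_le_k _ dsets_nonempty] avg_sum_closed_count])
      (use Suc in auto)
  then show ?thesis by (simp add: mean_conv_def continuous_word_poly)
qed

text \<open>Read backwards, the recurrence writes y times a word polynomial as a combination of word
  polynomials. With \<open>m\<close> general in the induction this reaches all powers without a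
  separate spanning argument.\<close>

lemma block_conv_power_word_poly: "block_conv (\<lambda>y. y ^ i * word_poly (real d) (real k) m y)"
proof (induction i arbitrary: m)
  case 0
  then show ?case using block_conv_word_poly by simp
next
  case (Suc i)
  let ?p = "word_poly (real d) (real k)"
  show ?case
  proof (cases m)
    case 0
    have "(\<lambda>y. y ^ Suc i * ?p m y) = (\<lambda>y. y ^ i * ?p (Suc 0) y)" by (simp add: 0 fun_eq_iff)
    then show ?thesis using Suc[of "Suc 0"] by simp
  next
    case (Suc l)
    let ?c = "if l = 0 then real d * real k else real d * (real k - 1)"
    have "(\<lambda>y. y ^ Suc i * ?p m y) = (\<lambda>y. y ^ i * ?p (Suc (Suc l)) y
        + ((real d - 1) * (y ^ i * ?p (Suc l) y) + ?c * (y ^ i * ?p l y)))"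
      unfolding Suc word_poly.simps(3) fun_eq_iff by (simp add: algebra_simps)
    then show ?thesis using Suc.IH by (simp only:) (intro block_conv_add block_conv_cmult)
  qed
qed

text \<open>The free factor \<open>y ^ i\<close> absorbs the power of y produced by each
  multiplication with the affine term.\<close>

lemma block_conv_affine_power: "block_conv (\<lambda>y. y ^ i * (\<alpha> + \<beta> * y) ^ m)"
proof (induction m arbitrary: i)
  case 0
  then show ?case using block_conv_power_word_poly[of i 0] by simp
next
  case (Suc m)
  have "(\<lambda>y. y ^ i * (\<alpha> + \<beta> * y) ^ Suc m) = (\<lambda>y. \<alpha> * (y ^ i * (\<alpha> + \<beta> * y) ^ m) + \<beta> * (y ^ Suc i * (\<alpha> + \<beta> * y) ^ m))"
    by (simp add: fun_eq_iff algebra_simps)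
  then show ?case using Suc.IH by (simp only:) (intro block_conv_add block_conv_cmult)
qed

text \<open>The error splits into the effect of repeated cells, controlled by closed walks of length
  two, and the convergence of the block law. The hypothesis on \<tau> says in moments that it is the
  affine image of the block limit.\<close>

lemma perturbed_conv:
  assumes sym: "\<And>i S x y. S \<in> tuples i \<Longrightarrow> T i S x y = T i S y x"
    and T: "\<And>i S x. S \<in> tuples i \<Longrightarrow> x \<in> dsets (n i) d \<Longrightarrow> (\<Sum>y\<in>dsets (n i) d. \<bar>T i S x y\<bar>) \<le> real k * (real d + 1)"
    and ab: "\<bar>\<alpha>\<bar> \<le> real k" "\<bar>\<beta>\<bar> \<le> 1"
    and eq: "\<And>i S x y. S \<in> tuples i \<Longrightarrow> x \<in> dsets (n i) d \<Longrightarrow> y \<in> dsets (n i) d \<Longrightarrow> \<not> repeated_cell k S x \<Longrightarrow>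
      T i S x y = affine_matrix \<alpha> \<beta> k S x y"
    and \<tau>: "\<And>m. (\<integral>x. x ^ m \<partial>\<tau>) = (\<integral>x. (\<alpha> + \<beta> * x) ^ m \<partial>block_limit)"
  shows "mean_conv tuples (\<lambda>i S. spec (dsets (n i) d) (T i S)) \<tau> (\<lambda>x. x ^ m)"
proof -
  let ?K = "real m * (real k * (real d + 1)) ^ m * (2 * (real k * (real d + 1)))"
  let ?A = "\<lambda>i S. ?K * ((\<Sum>w\<in>alt_words k 2. real (closed_count (dsets (n i) d) S w)) / num_dsets i)"
  let ?B = "\<lambda>i S. \<bar>(\<integral>x. (\<alpha> + \<beta> * x) ^ m \<partial>block_law i S) - (\<integral>x. (\<alpha> + \<beta> * x) ^ m \<partial>block_limit)\<bar>"
  have "(\<lambda>i. avg (tuples i) (?B i)) \<longlonglongrightarrow> 0" using block_conv_affine_power[of 0] by (simp add: mean_conv_def)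
  moreover have "(\<lambda>i. avg (tuples i) (?A i)) \<longlonglongrightarrow> 0"
    unfolding avg_cmult by (intro tendsto_mult_right_zero avg_sum_closed_count) simp
  ultimately have "(\<lambda>i. avg (tuples i) (\<lambda>S. ?A i S + ?B i S)) \<longlonglongrightarrow> 0"
    unfolding avg_add by (intro tendsto_add_zero)
  then have "(\<lambda>i. avg (tuples i) (\<lambda>S. \<bar>(\<integral>x. x ^ m \<partial>spec (dsets (n i) d) (T i S)) - (\<integral>x. x ^ m \<partial>\<tau>)\<bar>)) \<longlonglongrightarrow> 0"
  proof (rule avg_tendsto_0_bound[rotated 2])
    fix i S assume S: "S \<in> tuples i"
    have "\<bar>(\<integral>x. x ^ m \<partial>spec (dsets (n i) d) (T i S)) - (\<integral>x. (\<alpha> + \<beta> * x) ^ m \<partial>block_law i S)\<bar> \<le> ?A i S"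
      by (rule spec_compare[OF d one_le_k S dsets_nonempty sym[OF S] T[OF S] ab eq[OF S]])
    then show "\<bar>(\<integral>x. x ^ m \<partial>spec (dsets (n i) d) (T i S)) - (\<integral>x. x ^ m \<partial>\<tau>)\<bar> \<le> ?A i S + ?B i S"
      unfolding \<tau> by linarith
  qed simp
  then show ?thesis by (simp add: mean_conv_def continuous_intros)
qed

lemma laplace_conv:
  "mean_conv tuples (\<lambda>i S. spec (dsets (n i) d) (laplace_matrix (union_cells k S))) (nu d k) (\<lambda>x. x ^ m)"
proof (rule perturbed_conv[where \<alpha> = "real k" and \<beta> = 1])
  show "laplace_matrix (union_cells k S) x y = laplace_matrix (union_cells k S) y x" for S x y
    by (auto simp: laplace_matrix_def block_matrix_sym)
  show "(\<integral>x. x ^ m \<partial>nu d k) = (\<integral>x. (real k + 1 * x) ^ m \<partial>block_limit)" for m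
    by (subst integral_block_limit) (auto intro!: continuous_intros)
qed (use row_sum_laplace[OF d one_le_k] laplace_matrix_eq[OF d one_le_k] in auto)

lemma adjacency_conv:
  "mean_conv tuples (\<lambda>i S. spec (dsets (n i) d) (adjacency_matrix (union_cells k S))) (mu d k) (\<lambda>x. x ^ m)"
proof (rule perturbed_conv[where \<alpha> = 0 and \<beta> = "-1"])
  show "adjacency_matrix (union_cells k S) x y = adjacency_matrix (union_cells k S) y x" for S x y
    by (auto simp: adjacency_matrix_def block_matrix_sym)
  show "(\<integral>x. x ^ m \<partial>mu d k) = (\<integral>x. (0 + -1 * x) ^ m \<partial>block_limit)" for m
  proof -
    have "(\<integral>x. x ^ m \<partial>mu d k) = (\<integral>x. (real k - x) ^ m \<partial>nu d k)"
      unfolding mu_eq_distr[OF one_le_k] by (rule integral_distr) (auto simp: nu_def)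
    then show ?thesis by (subst integral_block_limit) (auto intro!: continuous_intros)
  qed
qed (use row_sum_adjacency[OF d one_le_k] adjacency_matrix_eq[OF d one_le_k] in auto)

end

subsection \<open>Random Steiner complexes\<close>

definition uniform_tuple :: "'a measure \<Rightarrow> 's set \<Rightarrow> ('a \<Rightarrow> 's) \<Rightarrow> bool" where
  "uniform_tuple M \<Omega> \<phi> \<longleftrightarrow> \<phi> \<in> measurable M (count_space \<Omega>) \<and>
     (\<forall>A\<subseteq>\<Omega>. measure M {\<omega> \<in> space M. \<phi> \<omega> \<in> A} = real (card A) / real (card \<Omega>))"

text \<open>Independence makes the tuple uniform on the product, which replaces the probability
  space by counting. Steiner systems exist because the first random system takes a value at some
  sample point.\<close>

lemma random_steiner_complex_tuple:
  assumes X: "random_steiner_complex M d k n X" and k: "1 \<le> k"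
  shows "steiner_systems n d \<noteq> {} \<and> (\<exists>\<phi>. uniform_tuple M (steiner_tuples n d k) \<phi> \<and>
    (\<forall>\<omega>\<in>space M. X \<omega> = steiner_complex n d (union_cells k (\<phi> \<omega>))))"
proof -
  let ?SS = "steiner_systems n d" and ?\<Omega> = "steiner_tuples n d k"
  interpret prob_space M using X by (simp add: random_steiner_complex_def)
  obtain S where ind: "indep_vars (\<lambda>_. count_space ?SS) S {1..k}"
    and dis: "\<And>j. j \<in> {1..k} \<Longrightarrow> distr M (count_space ?SS) (S j) = uniform_count_measure ?SS"
    and XS: "\<And>\<omega>. \<omega> \<in> space M \<Longrightarrow> X \<omega> = {s. s \<subseteq> {1..n} \<and> card s \<le> d} \<union> (\<Union>j\<in>{1..k}. S j \<omega>)"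
    using X unfolding random_steiner_complex_def by blast
  have meas: "S j \<in> measurable M (count_space ?SS)" if "j \<in> {1..k}" for j
    using ind that unfolding indep_vars_def by blast
  define \<phi> where "\<phi> \<omega> = (\<lambda>j\<in>{1..k}. S j \<omega>)" for \<omega>
  have in_SS: "S j \<omega> \<in> ?SS" if "j \<in> {1..k}" "\<omega> \<in> space M" for j \<omega>
    using measurable_space[OF meas[OF that(1)] that(2)] by simp
  have \<phi>: "\<phi> \<omega> \<in> ?\<Omega>" if "\<omega> \<in> space M" for \<omega>
    unfolding \<phi>_def steiner_tuples_def restrict_PiE_iff using in_SS[OF _ that] by blast
  have one: "1 \<in> {1..k}" using k by simp
  obtain \<omega>0 where "\<omega>0 \<in> space M" using not_empty by blast
  then have ne: "?SS \<noteq> {}" using in_SS[OF one] by blast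
  have atom: "{\<omega> \<in> space M. \<phi> \<omega> = s} = (\<Inter>j\<in>{1..k}. S j -` {s j} \<inter> space M)" if s: "s \<in> ?\<Omega>" for s
  proof -
    \<comment> \<open>Points of the sample space are extensional, so agreement on the indices 1 to
      \<open>k\<close> is equality.\<close>
    have ext: "s = restrict s {1..k}" using s unfolding steiner_tuples_def by (simp add: PiE_restrict)
    have "\<phi> \<omega> = s \<longleftrightarrow> (\<forall>j\<in>{1..k}. S j \<omega> = s j)" for \<omega>
    proof
      assume "\<phi> \<omega> = s"
      then show "\<forall>j\<in>{1..k}. S j \<omega> = s j" by (metis \<phi>_def restrict_apply')
    next
      assume "\<forall>j\<in>{1..k}. S j \<omega> = s j"
      then have "\<phi> \<omega> = restrict s {1..k}" unfolding \<phi>_def by (intro restrict_ext) simp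
      then show "\<phi> \<omega> = s" using ext by simp
    qed
    then show ?thesis using one by auto
  qed
  have atom_ev: "{\<omega> \<in> space M. \<phi> \<omega> = s} \<in> events" if s: "s \<in> ?\<Omega>" for s
    unfolding atom[OF s] using s one
    by (intro sets.finite_INT measurable_sets[OF meas]) (auto simp: steiner_tuples_def PiE_iff)
  have atom_prob: "prob {\<omega> \<in> space M. \<phi> \<omega> = s} = 1 / real (card ?\<Omega>)" if s: "s \<in> ?\<Omega>" for s
  proof -
    have sj: "s j \<in> ?SS" if "j \<in> {1..k}" for j using s that unfolding steiner_tuples_def by (rule PiE_mem)
    have "prob {\<omega> \<in> space M. \<phi> \<omega> = s} = (\<Prod>j\<in>{1..k}. prob (S j -` {s j} \<inter> space M))"
      unfolding atom[OF s] by (rule indep_varsD_finite[OF ind]) (use one sj in auto)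
    also have "\<dots> = (\<Prod>j\<in>{1..k}. 1 / real (card ?SS))"
    proof (rule prod.cong[OF refl])
      fix j assume j: "j \<in> {1..k}"
      have "prob (S j -` {s j} \<inter> space M) = measure (distr M (count_space ?SS) (S j)) {s j}"
        by (rule measure_distr[OF meas[OF j], symmetric]) (use sj[OF j] in simp)
      also have "\<dots> = 1 / real (card ?SS)"
        unfolding dis[OF j] using sj[OF j] by (subst measure_uniform_count_measure) auto
      finally show "prob (S j -` {s j} \<inter> space M) = 1 / real (card ?SS)" .
    qed
    also have "\<dots> = 1 / real (card ?\<Omega>)" by (simp add: steiner_tuples_def card_PiE power_one_over)
    finally show ?thesis .
  qed
  have "\<phi> \<in> measurable M (count_space ?\<Omega>)"
  proof (subst measurable_count_space_eq2)
    have "\<phi> -` {s} \<inter> space M = {\<omega> \<in> space M. \<phi> \<omega> = s}" for s by auto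
    then show "\<phi> \<in> space M \<rightarrow> ?\<Omega> \<and> (\<forall>a\<in>?\<Omega>. \<phi> -` {a} \<inter> space M \<in> events)"
      using \<phi> atom_ev by auto
  qed simp
  moreover have "prob {\<omega> \<in> space M. \<phi> \<omega> \<in> A} = real (card A) / real (card ?\<Omega>)" if A: "A \<subseteq> ?\<Omega>" for A
  proof -
    have fin: "finite A" using A by (rule finite_subset) simp
    have "{\<omega> \<in> space M. \<phi> \<omega> \<in> A} = (\<Union>s\<in>A. {\<omega> \<in> space M. \<phi> \<omega> = s})" by auto
    also have "prob \<dots> = (\<Sum>s\<in>A. prob {\<omega> \<in> space M. \<phi> \<omega> = s})"
      using A atom_ev by (intro finite_measure_finite_Union fin) (auto simp: disjoint_family_on_def)
    also have "\<dots> = (\<Sum>s\<in>A. 1 / real (card ?\<Omega>))" using A atom_prob by (intro sum.cong) auto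
    finally show ?thesis by simp
  qed
  ultimately have "uniform_tuple M ?\<Omega> \<phi>" by (simp add: uniform_tuple_def)
  moreover have "X \<omega> = steiner_complex n d (union_cells k (\<phi> \<omega>))" if "\<omega> \<in> space M" for \<omega>
    unfolding XS[OF that] steiner_complex_def union_cells_def \<phi>_def by simp
  ultimately show ?thesis using ne by blast
qed

text \<open>The random measures factor through a finite discrete space; this gives their
  measurability and turns probabilities into proportions.\<close>

lemma weakly_in_probability_uniform_tuple:
  assumes \<phi>: "\<And>i. uniform_tuple (M i) (\<Omega> i) (\<phi> i)"
    and \<mu>: "\<And>i \<omega>. \<omega> \<in> space (M i) \<Longrightarrow> \<mu> i \<omega> = \<rho> i (\<phi> i \<omega>)"
    and \<rho>: "\<And>i S. S \<in> \<Omega> i \<Longrightarrow> \<rho> i S \<in> space (prob_algebra borel)"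
    and \<tau>: "prob_space \<tau>" "sets \<tau> = sets borel"
    and conv: "\<And>f \<epsilon>. continuous_on UNIV f \<Longrightarrow> 0 < \<epsilon> \<Longrightarrow>
      (\<lambda>i. real (card {S \<in> \<Omega> i. \<bar>(\<integral>x. (f x :: real) \<partial>\<rho> i S) - (\<integral>x. f x \<partial>\<tau>)\<bar> > \<epsilon>}) / real (card (\<Omega> i))) \<longlonglongrightarrow> 0"
  shows "weakly_in_probability M \<mu> \<tau>"
  unfolding weakly_in_probability_def
proof (intro conjI allI impI \<tau>)
  fix i
  have m: "\<phi> i \<in> measurable (M i) (count_space (\<Omega> i))" using \<phi>[of i] by (simp add: uniform_tuple_def)
  have "\<rho> i \<in> measurable (count_space (\<Omega> i)) (prob_algebra borel)" using \<rho> by (simp add: measurable_count_space_eq1)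
  from measurable_compose[OF m this] have "(\<lambda>\<omega>. \<rho> i (\<phi> i \<omega>)) \<in> measurable (M i) (prob_algebra borel)" .
  then show "\<mu> i \<in> measurable (M i) (prob_algebra borel)" using \<mu> by (subst measurable_cong[of "M i" "\<mu> i"]) auto
next
  fix f :: "real \<Rightarrow> real" and \<epsilon> :: real
  assume f: "continuous_on UNIV f \<and> bounded (range f) \<and> 0 < \<epsilon>"
  let ?A = "\<lambda>i. {S \<in> \<Omega> i. \<bar>(\<integral>x. f x \<partial>\<rho> i S) - (\<integral>x. f x \<partial>\<tau>)\<bar> > \<epsilon>}"
  have "measure (M i) {\<omega> \<in> space (M i). \<bar>(\<integral>x. f x \<partial>\<mu> i \<omega>) - (\<integral>x. f x \<partial>\<tau>)\<bar> > \<epsilon>} = real (card (?A i)) / real (card (\<Omega> i))" for i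
  proof -
    have "\<phi> i \<omega> \<in> \<Omega> i" if "\<omega> \<in> space (M i)" for \<omega>
      using \<phi>[of i] that measurable_space[of "\<phi> i" "M i" "count_space (\<Omega> i)"] by (simp add: uniform_tuple_def)
    then have "{\<omega> \<in> space (M i). \<bar>(\<integral>x. f x \<partial>\<mu> i \<omega>) - (\<integral>x. f x \<partial>\<tau>)\<bar> > \<epsilon>} = {\<omega> \<in> space (M i). \<phi> i \<omega> \<in> ?A i}"
      using \<mu> by auto
    moreover have "?A i \<subseteq> \<Omega> i" by blast
    then have "measure (M i) {\<omega> \<in> space (M i). \<phi> i \<omega> \<in> ?A i} = real (card (?A i)) / real (card (\<Omega> i))"
      using \<phi>[of i] unfolding uniform_tuple_def by blast
    ultimately show ?thesis by (simp only:)
  qed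
  then show "(\<lambda>i. measure (M i) {\<omega> \<in> space (M i). \<bar>(\<integral>x. f x \<partial>\<mu> i \<omega>) - (\<integral>x. f x \<partial>\<tau>)\<bar> > \<epsilon>}) \<longlonglongrightarrow> 0"
    using conv[of f \<epsilon>] f by simp
qed

theorem theorem2p2:
  fixes d k :: nat
    and n :: "nat \<Rightarrow> nat"
    and M :: "nat \<Rightarrow> 'a measure"
    and X :: "nat \<Rightarrow> 'a \<Rightarrow> nat set set"
  assumes "1 \<le> d"
    and "d + 1 \<le> k"
    and "\<And>i. d_admissible d (n i)"
    and "filterlim n at_top sequentially"
    and "\<And>i. random_steiner_complex (M i) d k (n i) (X i)"
  shows "weakly_in_probability M
           (\<lambda>i \<omega>. esd (cochains (X i \<omega>) (d - 1)) (upper_laplacian (X i \<omega>) d)) (nu d k) \<and>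
         weakly_in_probability M
           (\<lambda>i \<omega>. esd (cochains (X i \<omega>) (d - 1)) (adjacency_op (X i \<omega>) d)) (mu d k) \<and>
         mu d k = distr (nu d k) borel (\<lambda>x. real k - x)"
proof -
  note d = assms(1) and k = assms(2)
  have one_le_k: "1 \<le> k" using k by simp
  have nd: "d \<le> n i" for i using assms(3)[of i] by (simp add: d_admissible_def)
  have ex: "steiner_systems (n i) d \<noteq> {}" for i
    using random_steiner_complex_tuple[OF assms(5) one_le_k] by blast
  have "\<forall>i. \<exists>\<phi>. uniform_tuple (M i) (steiner_tuples (n i) d k) \<phi> \<and>
    (\<forall>\<omega>\<in>space (M i). X i \<omega> = steiner_complex (n i) d (union_cells k (\<phi> \<omega>)))"
    using random_steiner_complex_tuple[OF assms(5) one_le_k] by blast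
  from choice[OF this] obtain \<phi> where \<phi>: "\<And>i. uniform_tuple (M i) (steiner_tuples (n i) d k) (\<phi> i)"
    and X: "\<And>i \<omega>. \<omega> \<in> space (M i) \<Longrightarrow> X i \<omega> = steiner_complex (n i) d (union_cells k (\<phi> i \<omega>))" by blast
  note ctx = d k assms(4) nd ex
  have \<phi>_in: "\<phi> i \<omega> \<in> steiner_tuples (n i) d k" if "\<omega> \<in> space (M i)" for i \<omega>
    using \<phi>[of i] that measurable_space[of "\<phi> i" "M i" "count_space (steiner_tuples (n i) d k)"]
    by (simp add: uniform_tuple_def)
  \<comment> \<open>Equal to \<open>law_bound\<close>; it dominates the supports of the spectral
    laws and of both limits.\<close>
  let ?bnd = "(sqrt (real k - 1) + sqrt (real d))\<^sup>2 + real k + real k * (real d + 1)"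
  have lap_sym: "laplace_matrix (union_cells k S) x y = laplace_matrix (union_cells k S) y x" for S x y
    by (auto simp: laplace_matrix_def block_matrix_sym)
  have adj_sym: "adjacency_matrix (union_cells k S) x y = adjacency_matrix (union_cells k S) y x" for S x y
    by (simp add: adjacency_matrix_def block_matrix_sym)
  have lap_bnd: "bounded_law ?bnd (spec (dsets (n i) d) (laplace_matrix (union_cells k S)))"
    if "S \<in> steiner_tuples (n i) d k" for i S
    by (rule bounded_law_spec[OF ctx lap_sym row_sum_laplace[OF d one_le_k that]])
  have adj_bnd: "bounded_law ?bnd (spec (dsets (n i) d) (adjacency_matrix (union_cells k S)))"
    if "S \<in> steiner_tuples (n i) d k" for i S
    by (rule bounded_law_spec[OF ctx adj_sym row_sum_adjacency[OF d one_le_k that]])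
  have nu_bnd: "bounded_law ?bnd (nu d k)"
    by (rule bounded_law_mono[OF bounded_law_nu[OF d k]]) simp
  have mu_bnd: "bounded_law ?bnd (mu d k)"
    unfolding mu_eq_distr[OF one_le_k]
    by (rule bounded_law_mono[OF bounded_law_distr[OF bounded_law_nu[OF d k], where C' = "(sqrt (real k - 1) + sqrt (real d))\<^sup>2 + real k"]])
      (auto intro!: continuous_intros)
  have "weakly_in_probability M
     (\<lambda>i \<omega>. esd (cochains (X i \<omega>) (d - 1)) (upper_laplacian (X i \<omega>) d)) (nu d k)"
  proof (rule weakly_in_probability_uniform_tuple[OF \<phi>,
      where \<rho> = "\<lambda>i S. spec (dsets (n i) d) (laplace_matrix (union_cells k S))"])
    fix i \<omega> assume \<omega>: "\<omega> \<in> space (M i)"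
    note Y = union_cellsD[OF d one_le_k \<phi>_in[OF \<omega>]]
    show "esd (cochains (X i \<omega>) (d - 1)) (upper_laplacian (X i \<omega>) d)
      = spec (dsets (n i) d) (laplace_matrix (union_cells k (\<phi> i \<omega>)))"
      unfolding X[OF \<omega>] spec_def
      by (rule esd_cochains[OF d Y]) (simp_all only: upper_laplacian_cochain_of[OF d Y] laplace_matrix_def[abs_def])
  next
    show "prob_space (nu d k)" "sets (nu d k) = sets borel" using nu_bnd by (simp_all add: bounded_law_def)
    show "spec (dsets (n i) d) (laplace_matrix (union_cells k S)) \<in> space (prob_algebra borel)"
      if "S \<in> steiner_tuples (n i) d k" for i S
      using lap_bnd[OF that] by (simp add: bounded_law_def space_prob_algebra)
  qed (rule mean_conv_imp_in_probability[OF lap_bnd nu_bnd finite_steiner_tuples laplace_conv[OF ctx]])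
  moreover have "weakly_in_probability M
     (\<lambda>i \<omega>. esd (cochains (X i \<omega>) (d - 1)) (adjacency_op (X i \<omega>) d)) (mu d k)"
  proof (rule weakly_in_probability_uniform_tuple[OF \<phi>,
      where \<rho> = "\<lambda>i S. spec (dsets (n i) d) (adjacency_matrix (union_cells k S))"])
    fix i \<omega> assume \<omega>: "\<omega> \<in> space (M i)"
    note Y = union_cellsD[OF d one_le_k \<phi>_in[OF \<omega>]]
    show "esd (cochains (X i \<omega>) (d - 1)) (adjacency_op (X i \<omega>) d)
      = spec (dsets (n i) d) (adjacency_matrix (union_cells k (\<phi> i \<omega>)))"
      unfolding X[OF \<omega>] spec_def
      by (rule esd_cochains[OF d Y]) (simp_all only: adjacency_op_cochain_of[OF d Y] adjacency_matrix_def[abs_def])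
  next
    show "prob_space (mu d k)" "sets (mu d k) = sets borel" using mu_bnd by (simp_all add: bounded_law_def)
    show "spec (dsets (n i) d) (adjacency_matrix (union_cells k S)) \<in> space (prob_algebra borel)"
      if "S \<in> steiner_tuples (n i) d k" for i S
      using adj_bnd[OF that] by (simp add: bounded_law_def space_prob_algebra)
  qed (rule mean_conv_imp_in_probability[OF adj_bnd mu_bnd finite_steiner_tuples adjacency_conv[OF ctx]])
  ultimately show ?thesis using mu_eq_distr[OF one_le_k] by blast
qed

end
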